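(* Let $p\in\mathbb{Z}[x]$ be a monic polynomial of degree $d\ge2$. Let $a\in L^1_x(\mathbb{T};L^\infty_t(0,\infty))$ with $a\ge0$, and assume that there exist $T>0$ and $\alpha_0>0$ such that the set $\mathcal{A}=\{a_n:n\ge1\}$, where $a_n(t,x)=a((n-1)T+t,x)$ for $(t,x)\in[0,T]\times\mathbb{T}$, is precompact in $L^1_x(\mathbb{T};L^\infty_t([0,T]))$ and $\inf_{n\ge1}\|a_n\|_{L^1_x(\mathbb{T};L^\infty_t([0,T]))}\ge\alpha_0$. Then there exist constants $C,\gamma>0$ such that every solution $u$ of $$i\partial_tu+P(D)u+ia(t,x)u=0,\quad(t,x)\in\mathbb{R}^+\times\mathbb{T},\qquad u|_{t=0}=u_0\in L^2(\mathbb{T}),$$ satisfies $$\|u(t,\cdot)\|_{L^2(\mathbb{T})}\le Ce^{-\gamma t}\|u_0\|_{L^2(\mathbb{T})},\qquad\forall t\ge0.$$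
   Context: $\mathbb{T}=\mathbb{R}/2\pi\mathbb{Z}$. $P(D)$ is the Fourier multiplier $\widehat{P(D)u}(k)=p(k)\widehat u(k)$, $k\in\mathbb{Z}$. For an interval $I$, $L^1_x(\mathbb{T};L^\infty_t(I))$ has norm $\int_{\mathbb{T}}\operatorname{ess\,sup}_{t\in I}|a(t,x)|\,dx$. Solutions are understood in the mild (Duhamel) sense $u(t)=e^{itP(D)}u_0-\int_0^te^{i(t-s)P(D)}(a(s)u(s))\,ds$, with $u\in C([0,\infty);L^2(\mathbb{T}))$ and $u\in L^\infty_x(\mathbb{T};L^2_t([0,\tau]))$ for every $\tau>0$ (so that $au\in L^1_x(\mathbb{T};L^2_t([0,\tau]))$). *)

theory Defs
  imports
    "HOL-Analysis.Analysis"
    "HOL-Probability.Essential_Supremum"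
    "HOL-Computational_Algebra.Polynomial"
begin

(* The circle R/2piZ is represented by its fundamental domain [0,2pi) with Lebesgue measure dx.
   Elements of Lebesgue spaces on I x T are represented by curried functions (t, x) that are
   jointly Borel measurable on I x [0,2pi); values elsewhere are irrelevant. *)

definition torus :: "real measure" where
  "torus = restrict_space lborel {0..<2 * pi}"

abbreviation time :: "real set \<Rightarrow> real measure" where
  "time I \<equiv> restrict_space lborel I"

definition L2_torus :: "(real \<Rightarrow> complex) set" where
  "L2_torus = {f \<in> borel_measurable torus. integrable torus (\<lambda>x. (cmod (f x))\<^sup>2)}"

definition L2_norm_torus :: "(real \<Rightarrow> complex) \<Rightarrow> real" where
  "L2_norm_torus f = sqrt (LINT x|torus. (cmod (f x))\<^sup>2)"

definition fourier_coeff :: "(real \<Rightarrow> complex) \<Rightarrow> int \<Rightarrow> complex" where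
  "fourier_coeff f k = 1 / (2 * pi) * (LINT x|torus. cis (- (of_int k * x)) * f x)"

definition norm_L1x_Linft :: "real set \<Rightarrow> (real \<Rightarrow> real \<Rightarrow> real) \<Rightarrow> ennreal" where
  "norm_L1x_Linft I f = (\<integral>\<^sup>+ x. esssup (time I) (\<lambda>t. ennreal \<bar>f t x\<bar>) \<partial>torus)"

definition L1x_Linft :: "real set \<Rightarrow> (real \<Rightarrow> real \<Rightarrow> real) set" where
  "L1x_Linft I = {f. (\<lambda>(t, x). f t x) \<in> borel_measurable (time I \<Otimes>\<^sub>M torus) \<and>
                      norm_L1x_Linft I f < \<infinity>}"

(* Membership only, so the essential supremum of the squared L^2_t norm suffices. *)
definition Linfx_L2t :: "real set \<Rightarrow> (real \<Rightarrow> real \<Rightarrow> complex) set" where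
  "Linfx_L2t I = {u. (\<lambda>(t, x). u t x) \<in> borel_measurable (time I \<Otimes>\<^sub>M torus) \<and>
     esssup torus (\<lambda>x. \<integral>\<^sup>+ t. ennreal ((cmod (u t x))\<^sup>2) \<partial>time I) < \<infinity>}"

(* The norm topology, generated by the open balls.  It lives on functions rather than on
   almost-everywhere classes, so it is only pseudo-metrizable; its Kolmogorov quotient is the
   usual Banach space, and (relative) compactness is the same in both. *)
definition top_L1x_Linft :: "real set \<Rightarrow> (real \<Rightarrow> real \<Rightarrow> real) topology" where
  "top_L1x_Linft I = topology_generated_by
     {{g \<in> L1x_Linft I. norm_L1x_Linft I (\<lambda>t x. g t x - f t x) < ennreal r} | f r.
        f \<in> L1x_Linft I \<and> 0 < r}"

definition precompact_in :: "'a topology \<Rightarrow> 'a set \<Rightarrow> bool" where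
  "precompact_in X S \<longleftrightarrow> S \<subseteq> topspace X \<and> compactin X (X closure_of S)"

definition time_slice :: "real \<Rightarrow> (real \<Rightarrow> real \<Rightarrow> real) \<Rightarrow> nat \<Rightarrow> real \<Rightarrow> real \<Rightarrow> real" where
  "time_slice T a n = (\<lambda>t x. a ((real n - 1) * T + t) x)"

(* The Fourier multiplier exp(i t P(D)), acting on sequences of Fourier coefficients
   (equivalently, on periodic distributions). *)
definition propagator :: "int poly \<Rightarrow> real \<Rightarrow> (int \<Rightarrow> complex) \<Rightarrow> int \<Rightarrow> complex" where
  "propagator p t c = (\<lambda>k. cis (t * of_int (poly p k)) * c k)"

(* u in C([0,oo); L^2) is represented by a jointly measurable function whose section u t
   represents the class u(t) for every t >= 0.  For fixed s the product a(s) u(s) is in general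
   only an L^1 function of x (for almost every s), so the Duhamel formula is an identity between
   periodic distributions: it is stated Fourier coefficient by Fourier coefficient, the time
   integral being the weak one. *)
definition mild_solution ::
  "int poly \<Rightarrow> (real \<Rightarrow> real \<Rightarrow> real) \<Rightarrow> (real \<Rightarrow> complex) \<Rightarrow> (real \<Rightarrow> real \<Rightarrow> complex) \<Rightarrow> bool" where
  "mild_solution p a u0 u \<longleftrightarrow>
     (\<lambda>(t, x). u t x) \<in> borel_measurable (time {0..} \<Otimes>\<^sub>M torus) \<and>
     (\<forall>t\<ge>0. u t \<in> L2_torus) \<and>
     (\<forall>t\<ge>0. ((\<lambda>s. L2_norm_torus (\<lambda>x. u s x - u t x)) \<longlongrightarrow> 0) (at t within {0..})) \<and>
     (\<forall>\<tau>>0. u \<in> Linfx_L2t {0..\<tau>}) \<and>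
     (\<forall>t\<ge>0. \<forall>k. fourier_coeff (u t) k =
        propagator p t (fourier_coeff u0) k -
        (LINT s:{0..t}|lborel.
           propagator p (t - s) (fourier_coeff (\<lambda>x. complex_of_real (a s x) * u s x)) k))"

end

theory Submission
  imports Defs
begin

text \<open>
  Write \<open>e\<^sub>k(t, x) = exp(i(kx + p(k)t))\<close>. For a set \<open>E\<close> of positive measure in space-time, the quadratic form
  \<open>\<integral>\<^sub>E |\<Sum> c\<^sub>k e\<^sub>k|\<^sup>2\<close> is \<open>|E| \<Sum> |c\<^sub>k|\<^sup>2\<close> plus an off-diagonal part whose entries are the Fourier coefficients of
  \<open>1\<^sub>E\<close> at \<open>(k - l, p(k) - p(l))\<close>. Since \<open>deg p \<ge> 2\<close>, a point of \<open>\<int>\<^sup>2\<close> is hit by at most \<open>deg p\<close> pairs \<open>k \<noteq> l\<close>, so this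
  part is Hilbert--Schmidt and negligible at high frequency. The finitely many remaining frequencies are removed one by one
  with difference operators \<open>f \<mapsto> f(\<cdot> + h) - exp(ilh) f\<close> in \<open>x\<close>, \<open>h / 2\<pi>\<close> irrational, which only shrink \<open>E\<close> slightly. This
  gives an observability inequality for free waves with any nonzero weight \<open>b\<close> in \<open>L\<^sup>1_x L\<^sup>\<infinity>_t\<close>; by the estimate
  \<open>\<parallel>\<Sum> c\<^sub>k e\<^sub>k\<parallel> \<le> C \<parallel>c\<parallel>\<close> in \<open>L\<^sup>\<infinity>_x L\<^sup>2_t\<close> it is stable under small perturbations of \<open>b\<close>.

  For a damped solution, duality with the same estimate bounds the distance to the free evolution in \<open>L\<^sup>2\<close>
  by the dissipation \<open>\<integral>\<integral> a|u|\<^sup>2\<close>. Observing with the bounded weight \<open>min 1 a\<close>, the dissipation over one period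
  dominates the initial energy, and the energy inequality turns this into a contraction. Compactness of the
  family of time slices makes the contraction factor uniform.
\<close>

section \<open>Fourier series on the torus\<close>

text \<open>Two obstacles shape the argument. First, a damped solution cannot simply be paired with
  its own equation: for fixed time the product \<open>a s x * u s x\<close> is in general only
  integrable in x. The energy law is therefore reached through Fourier multipliers. Sharp truncation
  need not preserve a bound in L^inf_x L^2_t; Fejer means do, because their kernel is positive. As
  \<open>a\<close> is unbounded, their convergence in space-time L^2 must still be upgraded to
  convergence against the weight \<open>a\<close>. Only an inequality comes out, and this suffices
  for decay. Second, the distance from the free wave is controlled in L^2 in x without weight, so an
  unbounded weight could not be moved from the solution to the wave. This is the reason for the cap
  at 1. Difference operators take the place of a unique continuation argument: finitely many
  translates of the set are enough, and no limit of solutions is taken. Compactness makes the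
  constants uniform because the lower bound on the slices passes to the closure, which therefore
  contains no weight of norm 0.\<close>

lemma integrable_cmod_square_imp_integrable:
  fixes f :: "'a \<Rightarrow> complex"
  assumes "finite_measure M" "f \<in> borel_measurable M" "integrable M (\<lambda>x. (cmod (f x))\<^sup>2)"
  shows "integrable M f"
proof -
  interpret finite_measure M by fact
  have "cmod z \<le> 1 + (cmod z)\<^sup>2" for z
  proof -
    have "0 \<le> (1 - cmod z)\<^sup>2" by simp
    also have "\<dots> = 1 + (cmod z)\<^sup>2 - 2 * cmod z"
      by (simp add: power2_diff)
    finally show ?thesis
      using norm_ge_zero[of z] by linarith
  qed
  then show ?thesis
    by (intro Bochner_Integration.integrable_bound[OF _ assms(2), where f = "\<lambda>x. 1 + (cmod (f x))\<^sup>2"])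
      (use assms(3) in \<open>auto intro!: AE_I2\<close>)
qed

lemma borel_measurable_cnj [measurable]:
  assumes [measurable]: "f \<in> borel_measurable M"
  shows "(\<lambda>x. cnj (f x)) \<in> borel_measurable M"
proof -
  have [measurable]: "cnj \<in> borel_measurable borel"
    by (intro borel_measurable_continuous_onI continuous_intros)
  show ?thesis by measurable
qed

lemma integrable_mult_bounded_complex:
  fixes f g :: "'a \<Rightarrow> complex"
  assumes "integrable M f" "g \<in> borel_measurable M" "\<And>x. x \<in> space M \<Longrightarrow> cmod (g x) \<le> K"
  shows "integrable M (\<lambda>x. f x * g x)"
proof -
  have [measurable]: "f \<in> borel_measurable M" "g \<in> borel_measurable M"
    using assms by auto
  show ?thesis
  proof (rule Bochner_Integration.integrable_bound)
    show "integrable M (\<lambda>x. \<bar>K\<bar> *\<^sub>R f x)" using assms(1) by auto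
    show "AE x in M. norm (f x * g x) \<le> norm (\<bar>K\<bar> *\<^sub>R f x)"
    proof (rule AE_I2)
      fix x assume "x \<in> space M"
      then have "cmod (g x) \<le> \<bar>K\<bar>" using assms(3)[of x] by linarith
      then show "norm (f x * g x) \<le> norm (\<bar>K\<bar> *\<^sub>R f x)"
        by (simp add: norm_mult mult.commute[of "\<bar>K\<bar>"] mult_left_mono)
    qed
  qed measurable
qed

text \<open>Stated for an abstract family because it serves the modes in x, the space-time modes
  (through \<open>bessel_inequality\<close>) and the exponentials in t of
  \<open>strichartz_wavesum\<close>. The pointwise bound on the family keeps every product
  integrable.\<close>

lemma integral_cmod_square_diff_orthogonal_sum:
  fixes e :: "'i \<Rightarrow> 'a \<Rightarrow> complex"
  assumes M: "finite_measure M" and F: "finite F"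
    and e: "\<And>i. i \<in> F \<Longrightarrow> e i \<in> borel_measurable M"
      "\<And>i x. i \<in> F \<Longrightarrow> x \<in> space M \<Longrightarrow> cmod (e i x) \<le> 1"
    and f: "f \<in> borel_measurable M" "integrable M (\<lambda>x. (cmod (f x))\<^sup>2)"
    and ortho: "\<And>i j. i \<in> F \<Longrightarrow> j \<in> F \<Longrightarrow>
      (LINT x|M. e i x * cnj (e j x)) = (if i = j then of_real \<kappa> else 0)"
  shows "integrable M (\<lambda>x. (cmod (f x - (\<Sum>i\<in>F. d i * e i x)))\<^sup>2)" (is ?I)
    and "(LINT x|M. (cmod (f x - (\<Sum>i\<in>F. d i * e i x)))\<^sup>2) =
      (LINT x|M. (cmod (f x))\<^sup>2) - 2 * Re (\<Sum>i\<in>F. cnj (d i) * (LINT x|M. f x * cnj (e i x)))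
      + \<kappa> * (\<Sum>i\<in>F. (cmod (d i))\<^sup>2)" (is ?E)
proof -
  interpret finite_measure M by fact
  note [measurable] = e(1) f(1)
  have fi: "integrable M f"
    by (rule integrable_cmod_square_imp_integrable[OF M f])
  have fe: "integrable M (\<lambda>x. f x * cnj (e i x))" if "i \<in> F" for i
    using that e by (intro integrable_mult_bounded_complex[OF fi, where K = 1]) auto
  have ee: "integrable M (\<lambda>x. e i x * cnj (e j x))" if "i \<in> F" "j \<in> F" for i j
  proof -
    have "integrable M (\<lambda>x. 1 * e i x)"
      by (rule integrable_mult_bounded_complex[where K = 1]) (use that e in auto)
    then have "integrable M (e i)" by simp
    then show ?thesis
      by (rule integrable_mult_bounded_complex[where K = 1]) (use that e in auto)
  qed
  define s where "s x = (\<Sum>i\<in>F. d i * e i x)" for x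
  have pt: "(cmod (f x - s x))\<^sup>2 =
      (cmod (f x))\<^sup>2 - 2 * Re (\<Sum>i\<in>F. cnj (d i) * (f x * cnj (e i x)))
      + Re (\<Sum>i\<in>F. \<Sum>j\<in>F. (d i * cnj (d j)) * (e i x * cnj (e j x)))" for x
  proof -
    have 1: "(\<Sum>i\<in>F. cnj (d i) * (f x * cnj (e i x))) = f x * cnj (s x)"
      unfolding s_def by (simp add: sum_distrib_left algebra_simps)
    have 2: "(\<Sum>i\<in>F. \<Sum>j\<in>F. (d i * cnj (d j)) * (e i x * cnj (e j x))) = s x * cnj (s x)"
      unfolding s_def by (simp add: sum_product algebra_simps)
    show ?thesis
      unfolding 1 2 cmod_power2 by (simp add: power2_eq_square algebra_simps)
  qed
  have i1: "integrable M (\<lambda>x. Re (\<Sum>i\<in>F. cnj (d i) * (f x * cnj (e i x))))"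
    using fe by (intro integrable_Re integrable_sum integrable_mult_right) auto
  have i2: "integrable M (\<lambda>x. Re (\<Sum>i\<in>F. \<Sum>j\<in>F. (d i * cnj (d j)) * (e i x * cnj (e j x))))"
    using ee by (intro integrable_Re integrable_sum integrable_mult_right) auto
  show ?I
    unfolding s_def[symmetric] pt using f i1 i2 by auto
  have "(LINT x|M. (cmod (f x - s x))\<^sup>2) = (LINT x|M. (cmod (f x))\<^sup>2)
      - 2 * (LINT x|M. Re (\<Sum>i\<in>F. cnj (d i) * (f x * cnj (e i x))))
      + (LINT x|M. Re (\<Sum>i\<in>F. \<Sum>j\<in>F. (d i * cnj (d j)) * (e i x * cnj (e j x))))"
    unfolding pt using f i1 i2 by simp
  also have "(LINT x|M. Re (\<Sum>i\<in>F. cnj (d i) * (f x * cnj (e i x))))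
     = Re (\<Sum>i\<in>F. cnj (d i) * (LINT x|M. f x * cnj (e i x)))"
    using fe by (subst integral_Re) (auto simp: Bochner_Integration.integral_sum)
  also have "(LINT x|M. Re (\<Sum>i\<in>F. \<Sum>j\<in>F. (d i * cnj (d j)) * (e i x * cnj (e j x))))
     = Re (\<Sum>i\<in>F. \<Sum>j\<in>F. (d i * cnj (d j)) * (LINT x|M. e i x * cnj (e j x)))"
    using ee by (subst integral_Re) (auto simp: Bochner_Integration.integral_sum integrable_sum)
  also have "(\<Sum>i\<in>F. \<Sum>j\<in>F. (d i * cnj (d j)) * (LINT x|M. e i x * cnj (e j x)))
     = (\<Sum>i\<in>F. \<Sum>j\<in>F. if j = i then d i * cnj (d j) * of_real \<kappa> else 0)"
    by (intro sum.cong refl) (simp add: ortho)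
  also have "\<dots> = (\<Sum>i\<in>F. of_real (\<kappa> * (cmod (d i))\<^sup>2))"
    using F unfolding of_real_mult complex_norm_square by (simp add: sum.delta mult_ac)
  also have "Re \<dots> = \<kappa> * (\<Sum>i\<in>F. (cmod (d i))\<^sup>2)"
    unfolding Re_sum Re_complex_of_real by (simp add: sum_distrib_left)
  finally show ?E
    unfolding s_def .
qed

lemma bessel_inequality:
  fixes e :: "'i \<Rightarrow> 'a \<Rightarrow> complex"
  assumes M: "finite_measure M" and F: "finite F"
    and e: "\<And>i. i \<in> F \<Longrightarrow> e i \<in> borel_measurable M"
      "\<And>i x. i \<in> F \<Longrightarrow> x \<in> space M \<Longrightarrow> cmod (e i x) \<le> 1"
    and f: "f \<in> borel_measurable M" "integrable M (\<lambda>x. (cmod (f x))\<^sup>2)"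
    and ortho: "\<And>i j. i \<in> F \<Longrightarrow> j \<in> F \<Longrightarrow>
      (LINT x|M. e i x * cnj (e j x)) = (if i = j then of_real \<kappa> else 0)"
    and \<kappa>: "\<kappa> > 0"
  shows "(\<Sum>i\<in>F. (cmod (LINT x|M. f x * cnj (e i x)))\<^sup>2) \<le> \<kappa> * (LINT x|M. (cmod (f x))\<^sup>2)"
proof -
  define c where "c i = (LINT x|M. f x * cnj (e i x))" for i
  \<comment> \<open>These are the coefficients of the orthogonal projection, for which the expansion
    is sharpest.\<close>
  have "0 \<le> (LINT x|M. (cmod (f x - (\<Sum>i\<in>F. c i / \<kappa> * e i x)))\<^sup>2)"
    by simp
  also have "\<dots> = (LINT x|M. (cmod (f x))\<^sup>2) - 2 * Re (\<Sum>i\<in>F. cnj (c i / \<kappa>) * c i)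
      + \<kappa> * (\<Sum>i\<in>F. (cmod (c i / \<kappa>))\<^sup>2)"
    unfolding c_def by (rule integral_cmod_square_diff_orthogonal_sum(2)) (use assms in auto)
  also have "(\<Sum>i\<in>F. cnj (c i / \<kappa>) * c i) = of_real ((\<Sum>i\<in>F. (cmod (c i))\<^sup>2) / \<kappa>)"
    unfolding sum_divide_distrib of_real_sum of_real_divide complex_norm_square
    by (intro sum.cong refl) simp
  also have "\<kappa> * (\<Sum>i\<in>F. (cmod (c i / \<kappa>))\<^sup>2) = (\<Sum>i\<in>F. (cmod (c i))\<^sup>2) / \<kappa>"
    using \<kappa> by (simp add: norm_divide power_divide sum_divide_distrib sum_distrib_left power2_eq_square)
  finally have "(\<Sum>i\<in>F. (cmod (c i))\<^sup>2) / \<kappa> \<le> (LINT x|M. (cmod (f x))\<^sup>2)"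
    by simp
  then show ?thesis
    using \<kappa> by (simp add: c_def divide_le_eq mult.commute)
qed

lemma space_torus [simp]: "space torus = {0..<2 * pi}"
  by (simp add: torus_def space_restrict_space)

lemma emeasure_torus_space [simp]: "emeasure torus {0..<2 * pi} = ennreal (2 * pi)"
  by (simp add: torus_def emeasure_restrict_space)

lemma finite_measure_torus: "finite_measure torus"
  by (rule finite_measureI) simp

interpretation torus: finite_measure torus
  by (rule finite_measure_torus)

lemma measure_torus_space [simp]: "measure torus {0..<2 * pi} = 2 * pi"
  by (simp add: measure_def)

lemma borel_measurable_torus [measurable (raw)]:
  "f \<in> borel_measurable borel \<Longrightarrow> f \<in> borel_measurable torus"
  unfolding torus_def by (rule measurable_restrict_space1) simp

lemma measurable_cis [measurable]: "cis \<in> borel_measurable borel"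
  by (intro borel_measurable_continuous_onI continuous_intros)

text \<open>Several periods are needed because a time window \<open>[0, T]\<close> is later enlarged
  to a whole number of them, where exponentials with integer frequency are orthogonal.\<close>

lemma integral_cis_multiples_of_period:
  fixes n :: int and m :: nat
  shows "(LINT x|restrict_space lborel {0..<2 * pi * m}. cis (of_int n * x)) =
    (if n = 0 then 2 * pi * m else 0)"
proof -
  have "(LINT x|restrict_space lborel {0..<2 * pi * m}. cis (of_int n * x)) =
      (LINT x|lborel. indicator {0..<2 * pi * m} x *\<^sub>R cis (of_int n * x))"
    by (subst integral_restrict_space) (auto simp: set_lebesgue_integral_def)
  also have "\<dots> = (LINT x|lborel. indicator {0..2 * pi * m} x *\<^sub>R cis (of_int n * x))"
  proof (rule integral_cong_AE)
    have "AE x in lborel. x \<noteq> 2 * pi * m"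
      by (rule AE_lborel_singleton)
    then show "AE x in lborel. indicator {0..<2 * pi * m} x *\<^sub>R cis (of_int n * x) =
       indicator {0..2 * pi * m} x *\<^sub>R cis (of_int n * x)"
      by eventually_elim (auto simp: indicator_def)
  qed measurable
  also have "\<dots> = (if n = 0 then 2 * pi * m else 0)"
  proof (cases "n = 0")
    case True
    then show ?thesis by (simp add: scaleR_conv_of_real)
  next
    case False
    let ?F = "\<lambda>x::real. cis (of_int n * x) / (\<i> * of_int n)"
    have "(LINT x|lborel. indicator {0..2 * pi * m} x *\<^sub>R cis (of_int n * x))
        = ?F (2 * pi * m) - ?F 0"
    proof (rule integral_FTC_Icc)
      show "(?F has_vector_derivative cis (of_int n * x)) (at x within {0..2 * pi * m})" for x
        using False
        unfolding cis_conv_exp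
        by (auto intro!: derivative_eq_intros has_vector_derivative_real_field simp: field_simps)
      show "continuous_on {0..2 * pi * m} (\<lambda>x. cis (of_int n * x))"
        by (intro continuous_intros)
    qed simp
    also have "cis (of_int n * (2 * pi * m)) = 1"
      using cis_multiple_2pi[of "of_int (n * int m)"] by (simp add: mult_ac)
    finally show ?thesis using False by simp
  qed
  finally show ?thesis .
qed

definition mode :: "int \<Rightarrow> real \<Rightarrow> complex" where
  "mode k x = cis (of_int k * x)"

lemma measurable_mode [measurable]: "mode k \<in> borel_measurable borel"
  unfolding mode_def by measurable

lemma cmod_mode [simp]: "cmod (mode k x) = 1"
  by (simp add: mode_def)

lemma mode_mult_cnj: "mode k x * cnj (mode l x) = mode (k - l) x"
  by (simp add: mode_def cis_cnj cis_mult algebra_simps)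

lemma integral_mode: "(LINT x|torus. mode k x) = (if k = 0 then 2 * pi else 0)"
  using integral_cis_multiples_of_period[of 1 k] by (simp add: torus_def mode_def)

lemma fourier_coeff_eq: "fourier_coeff f k = (LINT x|torus. f x * cnj (mode k x)) / (2 * pi)"
  by (simp add: fourier_coeff_def mode_def cis_cnj mult.commute)

lemma L2_torus_integrable: "f \<in> L2_torus \<Longrightarrow> integrable torus f"
  unfolding L2_torus_def by (auto intro: integrable_cmod_square_imp_integrable[OF finite_measure_torus])

text \<open>Completing the square separates the energy outside F from the mismatch of the
  coefficients inside F. The numbers \<open>d k\<close> will be the exact coefficients, those of
  some approximant, Fejer-weighted ones, or those of a free wave.\<close>

lemma integral_cmod_square_diff_trig:
  assumes f: "f \<in> L2_torus" and F: "finite F"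
  shows "integrable torus (\<lambda>x. (cmod (f x - (\<Sum>k\<in>F. d k * mode k x)))\<^sup>2)" (is ?I)
    and "(LINT x|torus. (cmod (f x - (\<Sum>k\<in>F. d k * mode k x)))\<^sup>2) =
      (L2_norm_torus f)\<^sup>2 - 2 * pi * (\<Sum>k\<in>F. (cmod (fourier_coeff f k))\<^sup>2)
        + 2 * pi * (\<Sum>k\<in>F. (cmod (fourier_coeff f k - d k))\<^sup>2)" (is ?E)
proof -
  note * = integral_cmod_square_diff_orthogonal_sum[OF finite_measure_torus F, where e = mode and f = f and \<kappa> = "2 * pi" and d = d]
  show ?I
    using f by (intro *(1)) (auto simp: L2_torus_def mode_mult_cnj integral_mode)
  have "(LINT x|torus. (cmod (f x - (\<Sum>k\<in>F. d k * mode k x)))\<^sup>2) =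
    (L2_norm_torus f)\<^sup>2 - 2 * Re (\<Sum>i\<in>F. cnj (d i) * (2 * pi * fourier_coeff f i))
      + 2 * pi * (\<Sum>i\<in>F. (cmod (d i))\<^sup>2)"
    using f by (subst *(2)) (auto simp: L2_torus_def mode_mult_cnj integral_mode fourier_coeff_eq L2_norm_torus_def)
  also have "Re (\<Sum>i\<in>F. cnj (d i) * (2 * pi * fourier_coeff f i)) = 2 * pi * (\<Sum>i\<in>F. Re (cnj (d i) * fourier_coeff f i))"
    by (simp add: sum_distrib_left algebra_simps)
  also have "(\<Sum>i\<in>F. (cmod (fourier_coeff f i - d i))\<^sup>2) = (\<Sum>i\<in>F. (cmod (fourier_coeff f i))\<^sup>2
     - 2 * Re (cnj (d i) * fourier_coeff f i) + (cmod (d i))\<^sup>2)"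
    by (intro sum.cong refl) (simp only: cmod_power2, simp add: power2_eq_square algebra_simps)
  then have "(\<Sum>i\<in>F. (cmod (fourier_coeff f i - d i))\<^sup>2) = (\<Sum>i\<in>F. (cmod (fourier_coeff f i))\<^sup>2)
     - 2 * (\<Sum>i\<in>F. Re (cnj (d i) * fourier_coeff f i)) + (\<Sum>i\<in>F. (cmod (d i))\<^sup>2)"
    by (simp only: sum.distrib sum_subtractf sum_distrib_left)
  then have "2 * pi * (\<Sum>i\<in>F. Re (cnj (d i) * fourier_coeff f i)) = pi * (\<Sum>i\<in>F. (cmod (fourier_coeff f i))\<^sup>2)
    + pi * (\<Sum>i\<in>F. (cmod (d i))\<^sup>2) - pi * (\<Sum>i\<in>F. (cmod (fourier_coeff f i - d i))\<^sup>2)"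
    by (simp only: right_diff_distrib distrib_left)
  finally show ?E by (simp only: algebra_simps)
qed


section \<open>Density of trigonometric polynomials in L^2 of the circle\<close>

inductive trigpoly :: "(real \<Rightarrow> complex) \<Rightarrow> bool" where
  monomial: "trigpoly (\<lambda>x. c * mode k x)"
| add: "trigpoly f \<Longrightarrow> trigpoly g \<Longrightarrow> trigpoly (\<lambda>x. f x + g x)"

lemma trigpoly_mult:
  assumes "trigpoly f" "trigpoly g"
  shows "trigpoly (\<lambda>x. f x * g x)"
  using assms
proof (induction f rule: trigpoly.induct)
  case (monomial c k)
  then show ?case
  proof (induction g rule: trigpoly.induct)
    case (monomial d l)
    have "c * mode k x * (d * mode l x) = (c * d) * mode (k + l) x" for x
      by (simp add: mode_def algebra_simps flip: cis_mult)
    then show ?case by (simp only: trigpoly.monomial)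
  next
    case (add f g)
    then show ?case by (simp add: algebra_simps trigpoly.add)
  qed
next
  case (add f h)
  then show ?case by (simp add: algebra_simps trigpoly.add)
qed

lemma trigpoly_const: "trigpoly (\<lambda>x. c)"
  using trigpoly.monomial[of c 0] by (simp add: mode_def)

lemma trigpoly_cmult: "trigpoly f \<Longrightarrow> trigpoly (\<lambda>x. c * f x)"
  by (rule trigpoly_mult[OF trigpoly_const])

lemma trigpoly_imp_sum:
  assumes "trigpoly f"
  obtains N d where "f = (\<lambda>x. \<Sum>k\<in>{- int N..int N}. d k * mode k x)"
proof -
  have "\<exists>N d. f = (\<lambda>x. \<Sum>k\<in>{- int N..int N}. d k * mode k x)"
    using assms
  proof (induction rule: trigpoly.induct)
    case (monomial c k)
    have "(\<Sum>l\<in>{- int (nat \<bar>k\<bar>)..int (nat \<bar>k\<bar>)}. (if l = k then c else 0) * mode l x) = c * mode k x" for x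
    proof -
      have "k \<in> {- int (nat \<bar>k\<bar>)..int (nat \<bar>k\<bar>)}" by auto
      then show ?thesis
        by (simp add: if_distrib[of "\<lambda>c. c * _"] sum.delta cong: if_cong)
    qed
    then show ?case by metis
  next
    case (add f g)
    then obtain N d N' d' where
      f: "f = (\<lambda>x. \<Sum>k\<in>{- int N..int N}. d k * mode k x)" and
      g: "g = (\<lambda>x. \<Sum>k\<in>{- int N'..int N'}. d' k * mode k x)"
      by blast
    define M where "M = max N N'"
    have ext: "(\<Sum>k\<in>{- int K..int K}. h k * mode k x) =
        (\<Sum>k\<in>{- int M..int M}. (if k \<in> {- int K..int K} then h k else 0) * mode k x)"
      if "K \<le> M" for K h x
      using that by (intro sum.mono_neutral_cong_left) auto
    have "(\<lambda>x. f x + g x) = (\<lambda>x. \<Sum>k\<in>{- int M..int M}.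
        ((if k \<in> {- int N..int N} then d k else 0) + (if k \<in> {- int N'..int N'} then d' k else 0)) * mode k x)"
      unfolding f g by (subst (1 2) ext) (auto simp: M_def distrib_right sum.distrib)
    then show ?case
      by (intro exI)
  qed
  then show ?thesis using that by blast
qed

text \<open>On the circle a linear form of the plane is a combination of cosine and sine, and
  \<open>trigpoly\<close> is closed under sums and products. For this induction
  \<open>trigpoly\<close> is an inductive predicate rather than a finite sum.\<close>

lemma trigpoly_real_polynomial_cis:
  assumes "real_polynomial_function q"
  shows "trigpoly (\<lambda>x. complex_of_real (q (cis x)))"
  using assms
proof (induction rule: real_polynomial_function.induct)
  case (linear f)
  interpret bounded_linear f by fact
  have "f (cis x) = f 1 * cos x + f \<i> * sin x" for x
  proof -
    have "cis x = cos x *\<^sub>R 1 + sin x *\<^sub>R \<i>"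
      by (simp add: complex_eq_iff)
    then show ?thesis
      by (simp only: add scaleR) simp
  qed
  moreover have "complex_of_real (cos x) = 1/2 * mode 1 x + 1/2 * mode (-1) x"
    and "complex_of_real (sin x) = (- \<i>/2) * mode 1 x + (\<i>/2) * mode (-1) x" for x
    by (simp_all add: mode_def complex_eq_iff)
  ultimately have "(\<lambda>x. complex_of_real (f (cis x))) =
     (\<lambda>x. of_real (f 1) * (1/2 * mode 1 x + 1/2 * mode (-1) x)
        + of_real (f \<i>) * ((- \<i>/2) * mode 1 x + (\<i>/2) * mode (-1) x))"
    by (simp only: of_real_add of_real_mult)
  then show ?case
    by (simp only:) (intro trigpoly.add trigpoly_cmult trigpoly.monomial)
qed (simp_all add: trigpoly_const trigpoly.add trigpoly_mult)

lemma measurable_trigpoly: "trigpoly f \<Longrightarrow> f \<in> borel_measurable borel"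
  by (induction rule: trigpoly.induct) auto

lemma bounded_trigpoly: "trigpoly f \<Longrightarrow> \<exists>K. \<forall>x. cmod (f x) \<le> K"
proof (induction rule: trigpoly.induct)
  case (monomial c k)
  then show ?case by (intro exI[of _ "cmod c"]) (simp add: norm_mult)
next
  case (add f g)
  then obtain K L where "\<forall>x. cmod (f x) \<le> K" "\<forall>x. cmod (g x) \<le> L" by blast
  then show ?case by (intro exI[of _ "K + L"]) (auto intro: norm_triangle_mono)
qed

lemma bounded_measurable_in_L2_torus:
  assumes "f \<in> borel_measurable torus" "\<And>x. x \<in> space torus \<Longrightarrow> cmod (f x) \<le> K"
  shows "f \<in> L2_torus"
proof -
  have "(cmod (f x))\<^sup>2 \<le> K\<^sup>2" if "x \<in> space torus" for x
    using assms(2)[OF that] by (intro power_mono) auto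
  then have "integrable torus (\<lambda>x. (cmod (f x))\<^sup>2)"
    using assms(1) by (intro torus.integrable_const_bound[where B = "K\<^sup>2"] AE_I2) auto
  then show ?thesis using assms by (simp add: L2_torus_def)
qed

lemma trigpoly_in_L2_torus: "trigpoly f \<Longrightarrow> f \<in> L2_torus"
  using bounded_trigpoly measurable_trigpoly by (metis bounded_measurable_in_L2_torus borel_measurable_torus)

lemma cmod_add_square_le: "(cmod (x + y))\<^sup>2 \<le> 2 * (cmod x)\<^sup>2 + 2 * (cmod y)\<^sup>2"
proof -
  have "(cmod (x + y))\<^sup>2 \<le> (cmod x + cmod y)\<^sup>2"
    by (intro power_mono norm_triangle_ineq) auto
  also have "\<dots> \<le> 2 * (cmod x)\<^sup>2 + 2 * (cmod y)\<^sup>2"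
    using sum_squares_bound[of "cmod x" "cmod y"] by (simp add: power2_sum)
  finally show ?thesis .
qed

lemma cmod_diff_square_le: "(cmod (x - y))\<^sup>2 \<le> 2 * (cmod x)\<^sup>2 + 2 * (cmod y)\<^sup>2"
  using cmod_add_square_le[of x "- y"] by simp

lemma L2_torus_add: "f \<in> L2_torus \<Longrightarrow> g \<in> L2_torus \<Longrightarrow> (\<lambda>x. f x + g x) \<in> L2_torus"
proof -
  assume *: "f \<in> L2_torus" "g \<in> L2_torus"
  then have [measurable]: "f \<in> borel_measurable torus" "g \<in> borel_measurable torus"
    by (auto simp: L2_torus_def)
  have "integrable torus (\<lambda>x. (cmod (f x + g x))\<^sup>2)"
    by (rule Bochner_Integration.integrable_bound[where f = "\<lambda>x. 2 * (cmod (f x))\<^sup>2 + 2 * (cmod (g x))\<^sup>2"])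
      (use * cmod_add_square_le in \<open>auto simp: L2_torus_def\<close>)
  then show ?thesis by (simp add: L2_torus_def)
qed

lemma L2_torus_cmult: "f \<in> L2_torus \<Longrightarrow> (\<lambda>x. c * f x) \<in> L2_torus"
  by (auto simp: L2_torus_def norm_mult power_mult_distrib)

lemma L2_torus_diff: "f \<in> L2_torus \<Longrightarrow> g \<in> L2_torus \<Longrightarrow> (\<lambda>x. f x - g x) \<in> L2_torus"
  using L2_torus_add[of f "\<lambda>x. (-1) * g x"] L2_torus_cmult[of g "-1"] by simp

definition trig_approximable :: "(real \<Rightarrow> complex) \<Rightarrow> bool" where
  "trig_approximable f \<longleftrightarrow> f \<in> L2_torus \<and>
     (\<forall>e>0. \<exists>g. trigpoly g \<and> (LINT x|torus. (cmod (f x - g x))\<^sup>2) < e)"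

lemma trig_approximable_limit:
  assumes f: "f \<in> L2_torus"
    and approx: "\<And>e. e > 0 \<Longrightarrow> \<exists>g. trig_approximable g \<and> (LINT x|torus. (cmod (f x - g x))\<^sup>2) < e"
  shows "trig_approximable f"
  unfolding trig_approximable_def
proof (intro conjI allI impI f)
  fix e :: real assume "e > 0"
  \<comment> \<open>A quarter for each error, because the squared triangle inequality doubles
    both.\<close>
  then obtain g where g: "trig_approximable g" "(LINT x|torus. (cmod (f x - g x))\<^sup>2) < e / 4"
    using approx[of "e / 4"] by auto
  then obtain h where h: "trigpoly h" "(LINT x|torus. (cmod (g x - h x))\<^sup>2) < e / 4"
    using \<open>e > 0\<close> unfolding trig_approximable_def by (meson divide_pos_pos zero_less_numeral)
  have L2: "g \<in> L2_torus" "h \<in> L2_torus"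
    using g h trigpoly_in_L2_torus by (auto simp: trig_approximable_def)
  have i: "integrable torus (\<lambda>x. (cmod (f x - g x))\<^sup>2)" "integrable torus (\<lambda>x. (cmod (g x - h x))\<^sup>2)"
    "integrable torus (\<lambda>x. (cmod (f x - h x))\<^sup>2)"
    using L2_torus_diff[OF f L2(1)] L2_torus_diff[OF L2] L2_torus_diff[OF f L2(2)] by (auto simp: L2_torus_def)
  have "(LINT x|torus. (cmod (f x - h x))\<^sup>2) \<le>
      (LINT x|torus. 2 * (cmod (f x - g x))\<^sup>2 + 2 * (cmod (g x - h x))\<^sup>2)"
  proof (rule integral_mono)
    show "(cmod (f x - h x))\<^sup>2 \<le> 2 * (cmod (f x - g x))\<^sup>2 + 2 * (cmod (g x - h x))\<^sup>2" for x
      using cmod_add_square_le[of "f x - g x" "g x - h x"] by simp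
  qed (use i in auto)
  also have "\<dots> < e"
    using i g h by simp
  finally show "\<exists>g. trigpoly g \<and> (LINT x|torus. (cmod (f x - g x))\<^sup>2) < e"
    using h by blast
qed

lemma trig_approximable_trigpoly: "trigpoly f \<Longrightarrow> trig_approximable f"
  unfolding trig_approximable_def by (auto simp: trigpoly_in_L2_torus intro!: exI[of _ f])

lemma trig_approximable_add:
  assumes "trig_approximable f" "trig_approximable g"
  shows "trig_approximable (\<lambda>x. f x + g x)"
  unfolding trig_approximable_def
proof (intro conjI allI impI)
  have L2: "f \<in> L2_torus" "g \<in> L2_torus" using assms by (auto simp: trig_approximable_def)
  then show "(\<lambda>x. f x + g x) \<in> L2_torus" by (rule L2_torus_add)
  fix e :: real assume "e > 0"
  then obtain p q where p: "trigpoly p" "(LINT x|torus. (cmod (f x - p x))\<^sup>2) < e / 4"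
    and q: "trigpoly q" "(LINT x|torus. (cmod (g x - q x))\<^sup>2) < e / 4"
    using assms unfolding trig_approximable_def by (meson divide_pos_pos zero_less_numeral)
  have i: "integrable torus (\<lambda>x. (cmod (f x - p x))\<^sup>2)" "integrable torus (\<lambda>x. (cmod (g x - q x))\<^sup>2)"
    "integrable torus (\<lambda>x. (cmod ((f x + g x) - (p x + q x)))\<^sup>2)"
    using L2_torus_diff[OF L2(1) trigpoly_in_L2_torus[OF p(1)]] L2_torus_diff[OF L2(2) trigpoly_in_L2_torus[OF q(1)]]
      L2_torus_diff[OF L2_torus_add[OF L2] trigpoly_in_L2_torus[OF trigpoly.add[OF p(1) q(1)]]]
    by (auto simp: L2_torus_def)
  have "(LINT x|torus. (cmod ((f x + g x) - (p x + q x)))\<^sup>2) \<le>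
      (LINT x|torus. 2 * (cmod (f x - p x))\<^sup>2 + 2 * (cmod (g x - q x))\<^sup>2)"
  proof (rule integral_mono)
    show "(cmod ((f x + g x) - (p x + q x)))\<^sup>2 \<le> 2 * (cmod (f x - p x))\<^sup>2 + 2 * (cmod (g x - q x))\<^sup>2" for x
      using cmod_add_square_le[of "f x - p x" "g x - q x"] by (simp add: algebra_simps)
  qed (use i in auto)
  also have "\<dots> < e"
    using i p q by simp
  finally show "\<exists>r. trigpoly r \<and> (LINT x|torus. (cmod (f x + g x - r x))\<^sup>2) < e"
    using trigpoly.add[OF p(1) q(1)] by blast
qed

lemma trig_approximable_cmult:
  assumes "trig_approximable f"
  shows "trig_approximable (\<lambda>x. c * f x)"
  unfolding trig_approximable_def
proof (intro conjI allI impI)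
  show "(\<lambda>x. c * f x) \<in> L2_torus" using assms by (simp add: trig_approximable_def L2_torus_cmult)
  fix e :: real assume e: "e > 0"
  show "\<exists>r. trigpoly r \<and> (LINT x|torus. (cmod (c * f x - r x))\<^sup>2) < e"
  proof (cases "c = 0")
    case True
    then show ?thesis using e trigpoly_const[of 0] by (intro exI[of _ "\<lambda>x. 0"]) auto
  next
    case False
    then obtain g where g: "trigpoly g" "(LINT x|torus. (cmod (f x - g x))\<^sup>2) < e / (cmod c)\<^sup>2"
      using assms e unfolding trig_approximable_def by (meson divide_pos_pos zero_less_norm_iff zero_less_power)
    have "(LINT x|torus. (cmod (c * f x - c * g x))\<^sup>2) = (cmod c)\<^sup>2 * (LINT x|torus. (cmod (f x - g x))\<^sup>2)"
      by (simp add: norm_mult power_mult_distrib flip: right_diff_distrib)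
    also have "\<dots> < e" using g False by (simp add: field_simps)
    finally show ?thesis using trigpoly_cmult[OF g(1)] by blast
  qed
qed

lemma trig_approximable_sum:
  "(\<And>i. i \<in> I \<Longrightarrow> trig_approximable (f i)) \<Longrightarrow> trig_approximable (\<lambda>x. \<Sum>i\<in>I. f i x)"
  by (induction I rule: infinite_finite_induct)
    (auto intro: trig_approximable_add trig_approximable_trigpoly trigpoly_const)


lemma inner_regular_compact:
  fixes M :: "'a::{second_countable_topology, complete_space} measure"
  assumes M: "finite_measure M" "sets M = sets borel" and B: "B \<in> sets borel" and e: "e > 0"
  obtains K where "compact K" "K \<subseteq> B" "measure M B < measure M K + e"
proof -
  interpret finite_measure M by fact
  show ?thesis
  proof (cases "measure M B < e")
    case True
    then show ?thesis by (intro that[of "{}"]) auto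
  next
    case False
    \<comment> \<open>In this case the difference is nonnegative, so \<open>ennreal\<close> does not
      cut it off at 0.\<close>
    have "ennreal (measure M B - e) < ennreal (measure M B)"
      using False e by (intro ennreal_lessI) auto
    also have "\<dots> = (SUP K \<in> {K. K \<subseteq> B \<and> compact K}. emeasure M K)"
      using inner_regular[OF M(2) _ B] by (simp add: emeasure_eq_measure)
    finally obtain K where K: "K \<subseteq> B" "compact K" "ennreal (measure M B - e) < emeasure M K"
      by (auto simp: less_SUP_iff)
    then have "measure M B - e < measure M K"
      using False by (simp add: emeasure_eq_measure ennreal_less_iff)
    then show ?thesis using K by (intro that[of K]) auto
  qed
qed

text \<open>The angle jumps across the nonnegative real axis; on that axis it is constantly 0, and
  off it it is continuous.\<close>

lemma measurable_Arg2pi: "Arg2pi \<in> measurable borel torus"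
proof -
  have "(\<lambda>z. if z \<in> \<real>\<^sub>\<ge>\<^sub>0 then 0 else Arg2pi z) \<in> borel_measurable borel"
  proof (rule borel_measurable_continuous_on_if)
    show "continuous_on (- \<real>\<^sub>\<ge>\<^sub>0) Arg2pi"
      by (intro continuous_at_imp_continuous_on ballI continuous_at_Arg2pi) auto
  qed (auto simp: closed_nonneg_Reals_complex)
  also have "(\<lambda>z. if z \<in> \<real>\<^sub>\<ge>\<^sub>0 then 0 else Arg2pi z) = Arg2pi"
    by (auto simp: fun_eq_iff complex_nonneg_Reals_iff Arg2pi_eq_0 complex_is_Real_iff)
  finally show ?thesis
    unfolding torus_def by (intro measurable_restrict_space2) (use Arg2pi in auto)
qed

lemma Arg2pi_cis: "0 \<le> x \<Longrightarrow> x < 2 * pi \<Longrightarrow> Arg2pi (cis x) = x"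
  by (rule Arg2pi_unique[of 1]) (auto simp: cis_conv_exp)

text \<open>The set is carried to the unit circle, where continuity already includes the matching of
  the endpoints 0 and 2 pi. Compact sets inside and outside it miss little measure, Urysohn's lemma
  joins them by a continuous function, and by Stone-Weierstrass a real polynomial in the plane is
  uniformly close to that function on the circle.\<close>

lemma trig_approximable_indicator:
  assumes A: "A \<in> sets torus"
  shows "trig_approximable (indicator A)"
proof (rule trig_approximable_limit)
  have [measurable]: "A \<in> sets torus" by (rule A)
  show L2: "(indicator A :: real \<Rightarrow> complex) \<in> L2_torus"
    by (rule bounded_measurable_in_L2_torus[where K = 1]) (auto simp: indicator_def)
  fix e :: real assume e: "e > 0"
  \<comment> \<open>The final error is at most 4 \<eta> + 4 pi \<eta>^2, which is below 20 \<eta> as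
    soon as \<eta> is at most 1.\<close>
  define \<eta> where "\<eta> = min 1 (e / 20)"
  have \<eta>: "0 < \<eta>" "\<eta> \<le> 1" "20 * \<eta> \<le> e" using e by (auto simp: \<eta>_def)
  define \<mu> where "\<mu> = distr torus borel cis"
  interpret \<mu>: finite_measure \<mu>
    unfolding \<mu>_def by (intro torus.finite_measure_distr) measurable
  have sets_\<mu>: "sets \<mu> = sets borel" by (simp add: \<mu>_def)
  define B where "B = Arg2pi -` A"
  have B: "B \<in> sets borel"
    using measurable_sets[OF measurable_Arg2pi A] by (simp add: B_def)
  obtain K where K: "compact K" "K \<subseteq> B" "measure \<mu> B < measure \<mu> K + \<eta>"
    using inner_regular_compact[OF \<mu>.finite_measure_axioms sets_\<mu> B \<eta>(1)] .
  have "- B \<in> sets borel" using B by auto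
  then obtain K' where K': "compact K'" "K' \<subseteq> - B" "measure \<mu> (- B) < measure \<mu> K' + \<eta>"
    using inner_regular_compact[OF \<mu>.finite_measure_axioms sets_\<mu> _ \<eta>(1)] by metis
  obtain f :: "complex \<Rightarrow> real" where f: "continuous_on UNIV f" "\<And>x. f x \<in> closed_segment 1 0"
    "\<And>x. x \<in> K \<Longrightarrow> f x = 1" "\<And>x. x \<in> K' \<Longrightarrow> f x = 0"
  proof (rule Urysohn[of K K' 1 0])
    show "K \<inter> K' = {}" using K K' by auto
  qed (use K K' in \<open>auto intro: compact_imp_closed\<close>)
  have f01: "0 \<le> f x" "f x \<le> 1" for x
    using f(2)[of x] by (auto simp: closed_segment_eq_real_ivl split: if_splits)
  obtain q where q: "real_polynomial_function q" "\<And>x. x \<in> sphere 0 1 \<Longrightarrow> \<bar>f x - q x\<bar> < \<eta>"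
    using Stone_Weierstrass_real_polynomial_function[of "sphere 0 1" f \<eta>] f(1) \<eta>
    by (metis compact_sphere continuous_on_subset subset_UNIV)
  define g where "g x = complex_of_real (q (cis x))" for x
  have g: "trigpoly g"
    using trigpoly_real_polynomial_cis[OF q(1)] by (simp add: g_def[abs_def])
  \<comment> \<open>Off R the Urysohn function agrees with the indicator; on R the two differ by at
    most 1.\<close>
  define R where "R = (B - K) \<union> (- B - K')"
  have KM: "K \<in> sets borel" "K' \<in> sets borel" using K K' by (auto intro: borel_compact)
  then have R: "R \<in> sets borel" using B by (auto simp: R_def)
  have "measure \<mu> R \<le> measure \<mu> (B - K) + measure \<mu> (- B - K')"
    unfolding R_def using B KM sets_\<mu> by (intro measure_Un_le) auto
  also have "\<dots> \<le> 2 * \<eta>"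
    using K K' B KM sets_\<mu> \<mu>.finite_measure_Diff[of B K] \<mu>.finite_measure_Diff[of "- B" K'] by auto
  finally have mR: "measure \<mu> R \<le> 2 * \<eta>" .
  have mR': "measure torus (cis -` R \<inter> space torus) = measure \<mu> R"
    unfolding \<mu>_def using R by (intro measure_distr[symmetric]) auto
  have RM: "cis -` R \<inter> space torus \<in> sets torus"
    by (rule measurable_sets[OF _ R]) measurable
  have pt: "(cmod (indicator A x - g x))\<^sup>2 \<le> 2 * indicator (cis -` R \<inter> space torus) x + 2 * \<eta>\<^sup>2"
    if x: "x \<in> space torus" for x
  proof -
    let ?z = "cis x"
    have "indicator A x = (indicator B ?z :: real)"
      using x by (auto simp: B_def indicator_def Arg2pi_cis)
    then have "complex_of_real (indicator B ?z) = indicator A x"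
      by (auto simp: indicator_def split: if_splits)
    then have eq: "indicator A x - g x = complex_of_real ((indicator B ?z - f ?z) + (f ?z - q ?z))"
      by (simp add: g_def)
    have 1: "\<bar>f ?z - q ?z\<bar> \<le> \<eta>" using q(2)[of ?z] by simp
    have 2: "\<bar>indicator B ?z - f ?z\<bar> \<le> indicator (cis -` R \<inter> space torus) x"
      using x f01[of ?z] f(3,4)[of ?z] K(2) K'(2) by (auto simp: R_def indicator_def)
    have "(cmod (indicator A x - g x))\<^sup>2 = ((indicator B ?z - f ?z) + (f ?z - q ?z))\<^sup>2"
      unfolding eq norm_of_real by simp
    also have "\<dots> \<le> 2 * (indicator B ?z - f ?z)\<^sup>2 + 2 * (f ?z - q ?z)\<^sup>2"
      using sum_squares_bound[of "indicator B ?z - f ?z" "f ?z - q ?z"] by (simp only: power2_sum)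
    also have "\<dots> \<le> 2 * (indicator (cis -` R \<inter> space torus) x)\<^sup>2 + 2 * \<eta>\<^sup>2"
      using 1 2 by (intro add_mono mult_left_mono) (auto intro: power2_le_iff_abs_le[THEN iffD2] simp: abs_le_square_iff[symmetric])
    finally show ?thesis by (auto simp: indicator_def)
  qed
  have "(LINT x|torus. (cmod (indicator A x - g x))\<^sup>2)
      \<le> (LINT x|torus. 2 * indicator (cis -` R \<inter> space torus) x + 2 * \<eta>\<^sup>2)"
  proof (intro integral_mono pt)
    show "integrable torus (\<lambda>x. 2 * indicat_real (cis -` R \<inter> space torus) x + 2 * \<eta>\<^sup>2)"
      by (intro Bochner_Integration.integrable_add integrable_mult_right integrable_real_indicator)
        (use RM torus.emeasure_finite in \<open>auto simp: less_top[symmetric]\<close>)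
  qed (use L2_torus_diff[OF L2 trigpoly_in_L2_torus[OF g]] in \<open>auto simp: L2_torus_def\<close>)
  also have "\<dots> = 2 * measure \<mu> R + 4 * pi * \<eta>\<^sup>2"
    by (subst Bochner_Integration.integral_add)
      (use RM torus.emeasure_finite mR' in
        \<open>auto simp: less_top[symmetric] intro!: integrable_mult_right integrable_real_indicator\<close>)
  also have "\<dots> \<le> 4 * \<eta> + 4 * 3.15 * \<eta>"
  proof (rule add_mono)
    have "\<eta>\<^sup>2 \<le> \<eta>" using \<eta> by (simp add: power2_eq_square mult_left_le)
    then show "4 * pi * \<eta>\<^sup>2 \<le> 4 * 3.15 * \<eta>"
      using pi_less_4 pi_approx \<eta> by (intro mult_mono) auto
  qed (use mR in simp)
  also have "\<dots> < 20 * \<eta>" using \<eta> by simp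
  also have "\<dots> \<le> e" by (rule \<eta>)
  finally show "\<exists>g. trig_approximable g \<and> (LINT x|torus. (cmod (indicator A x - g x))\<^sup>2) < e"
    using trig_approximable_trigpoly[OF g] by blast
qed

lemma trig_approximable_simple_function:
  fixes f :: "real \<Rightarrow> complex"
  assumes f: "simple_function torus f"
  shows "trig_approximable f"
proof -
  have fin: "finite (f ` space torus)" using f by (simp add: simple_function_def)
  have *: "trig_approximable (\<lambda>x. \<Sum>y\<in>f ` space torus. y * indicator (f -` {y} \<inter> space torus) x)"
    by (intro trig_approximable_sum trig_approximable_cmult trig_approximable_indicator)
      (rule simple_functionD(2)[OF f])
  have eq: "(\<Sum>y\<in>f ` space torus. y * indicator (f -` {y} \<inter> space torus) x) = f x" if "x \<in> space torus" for x
  proof -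
    have "(\<Sum>y\<in>f ` space torus. y * indicator (f -` {y} \<inter> space torus) x) =
       (\<Sum>y\<in>f ` space torus. if y = f x then y else 0)"
      using that by (intro sum.cong) (auto simp: indicator_def)
    also have "\<dots> = f x" using fin that by (simp add: sum.delta)
    finally show ?thesis .
  qed
  show ?thesis
  proof (rule trig_approximable_limit)
    have "f \<in> borel_measurable torus" using f by (rule borel_measurable_simple_function)
    moreover have "cmod (f x) \<le> Max (cmod ` f ` space torus)" if "x \<in> space torus" for x
      using fin that by (intro Max_ge) auto
    ultimately show "f \<in> L2_torus" by (rule bounded_measurable_in_L2_torus)
    fix e :: real assume "e > 0"
    have "(LINT x|torus. (cmod (f x - (\<Sum>y\<in>f ` space torus. y * indicator (f -` {y} \<inter> space torus) x)))\<^sup>2) = (LINT x|torus. 0)"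
      by (intro Bochner_Integration.integral_cong refl) (simp add: eq del: space_torus)
    also have "\<dots> < e" using \<open>e > 0\<close> by simp
    finally show "\<exists>g. trig_approximable g \<and> (LINT x|torus. (cmod (f x - g x))\<^sup>2) < e"
      using * by (intro exI conjI)
  qed
qed

lemma trig_approximable_L2_torus:
  assumes f: "f \<in> L2_torus"
  shows "trig_approximable f"
proof (rule trig_approximable_limit[OF f])
  have [measurable]: "f \<in> borel_measurable torus" using f by (simp add: L2_torus_def)
  from borel_measurable_implies_sequence_metric[OF this, of 0] obtain s where
    s: "\<And>i. simple_function torus (s i)" and
    lim: "\<And>x. x \<in> space torus \<Longrightarrow> (\<lambda>i. s i x) \<longlonglongrightarrow> f x" and
    bound: "\<And>i x. x \<in> space torus \<Longrightarrow> cmod (s i x) \<le> 2 * cmod (f x)"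
    by (simp del: space_torus) blast
  have [measurable]: "s i \<in> borel_measurable torus" for i using s by (rule borel_measurable_simple_function)
  have "(\<lambda>i. LINT x|torus. (cmod (f x - s i x))\<^sup>2) \<longlonglongrightarrow> (LINT x|torus. (0::real))"
  \<comment> \<open>The approximants have modulus at most 2 |f|, so the error is at most 3
    |f|.\<close>
  proof (rule integral_dominated_convergence[where w = "\<lambda>x. 9 * (cmod (f x))\<^sup>2"])
    show "integrable torus (\<lambda>x. 9 * (cmod (f x))\<^sup>2)" using f by (simp add: L2_torus_def)
    show "AE x in torus. (\<lambda>i. (cmod (f x - s i x))\<^sup>2) \<longlonglongrightarrow> 0"
    proof (rule AE_I2)
      fix x assume "x \<in> space torus"
      from lim[OF this] have "(\<lambda>i. (cmod (f x - s i x))\<^sup>2) \<longlonglongrightarrow> (cmod (f x - f x))\<^sup>2"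
        by (intro tendsto_intros)
      then show "(\<lambda>i. (cmod (f x - s i x))\<^sup>2) \<longlonglongrightarrow> 0" by simp
    qed
    show "AE x in torus. norm ((cmod (f x - s i x))\<^sup>2) \<le> 9 * (cmod (f x))\<^sup>2" for i
    proof (rule AE_I2)
      fix x assume "x \<in> space torus"
      have "cmod (f x - s i x) \<le> cmod (f x) + cmod (s i x)" by (rule norm_triangle_ineq4)
      also have "\<dots> \<le> 3 * cmod (f x)" using bound[OF \<open>x \<in> space torus\<close>, of i] by simp
      finally have "(cmod (f x - s i x))\<^sup>2 \<le> (3 * cmod (f x))\<^sup>2" by (intro power_mono) auto
      then show "norm ((cmod (f x - s i x))\<^sup>2) \<le> 9 * (cmod (f x))\<^sup>2" by (simp add: power_mult_distrib)
    qed
  qed measurable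
  then have *: "(\<lambda>i. LINT x|torus. (cmod (f x - s i x))\<^sup>2) \<longlonglongrightarrow> 0" by simp
  fix e :: real assume "e > 0"
  then have "eventually (\<lambda>i. (LINT x|torus. (cmod (f x - s i x))\<^sup>2) < e) sequentially"
    using * by (rule order_tendstoD(2)[rotated])
  then obtain i where "(LINT x|torus. (cmod (f x - s i x))\<^sup>2) < e"
    by (auto simp: eventually_sequentially)
  then show "\<exists>g. trig_approximable g \<and> (LINT x|torus. (cmod (f x - g x))\<^sup>2) < e"
    using trig_approximable_simple_function[OF s] by blast
qed

lemma sum_fourier_coeff_le:
  assumes "f \<in> L2_torus" "finite F"
  shows "2 * pi * (\<Sum>k\<in>F. (cmod (fourier_coeff f k))\<^sup>2) \<le> (L2_norm_torus f)\<^sup>2"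
proof -
  have "0 \<le> (LINT x|torus. (cmod (f x - (\<Sum>k\<in>F. fourier_coeff f k * mode k x)))\<^sup>2)" by simp
  also have "\<dots> = (L2_norm_torus f)\<^sup>2 - 2 * pi * (\<Sum>k\<in>F. (cmod (fourier_coeff f k))\<^sup>2)"
    by (subst integral_cmod_square_diff_trig(2)[OF assms]) simp
  finally show ?thesis by simp
qed

text \<open>Among sums with frequencies up to N the partial Fourier sum is the best approximation. A
  trigonometric polynomial with squared error below e thus shows that less than e of the energy is
  missing, from its degree on.\<close>

theorem parseval_torus:
  assumes f: "f \<in> L2_torus"
  shows "(\<lambda>N. 2 * pi * (\<Sum>k\<in>{- int N..int N}. (cmod (fourier_coeff f k))\<^sup>2)) \<longlonglongrightarrow> (L2_norm_torus f)\<^sup>2"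
proof (rule LIMSEQ_I)
  fix e :: real assume "e > 0"
  then obtain g where g: "trigpoly g" "(LINT x|torus. (cmod (f x - g x))\<^sup>2) < e"
    using trig_approximable_L2_torus[OF f] by (auto simp: trig_approximable_def)
  obtain N d where gN: "g = (\<lambda>x. \<Sum>k\<in>{- int N..int N}. d k * mode k x)"
    using trigpoly_imp_sum[OF g(1)] .
  let ?S = "\<lambda>N. 2 * pi * (\<Sum>k\<in>{- int N..int N}. (cmod (fourier_coeff f k))\<^sup>2)"
  have "(L2_norm_torus f)\<^sup>2 - ?S N \<le> (LINT x|torus. (cmod (f x - g x))\<^sup>2)"
    unfolding gN by (subst integral_cmod_square_diff_trig(2)[OF f]) (auto intro!: sum_nonneg mult_nonneg_nonneg)
  then have 1: "(L2_norm_torus f)\<^sup>2 - e < ?S N" using g by simp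
  have "norm (?S n - (L2_norm_torus f)\<^sup>2) < e" if "n \<ge> N" for n
  proof -
    have "?S N \<le> ?S n" using that by (intro mult_left_mono sum_mono2) auto
    moreover have "?S n \<le> (L2_norm_torus f)\<^sup>2" by (rule sum_fourier_coeff_le[OF f]) simp
    ultimately show ?thesis using 1 by (simp only: real_norm_def abs_less_iff) linarith
  qed
  then show "\<exists>no. \<forall>n\<ge>no. norm (?S n - (L2_norm_torus f)\<^sup>2) < e" by blast
qed

section \<open>Observability for finite sums of free waves\<close>

text \<open>Turns the product of a time interval and the circle into planar Lebesgue measure on a
  box, whose regularity and translation invariance the observability argument uses.\<close>

lemma pair_measure_restrict_space:
  assumes M: "sigma_finite_measure M" and N: "sigma_finite_measure N"
    and A: "A \<in> sets M" and B: "B \<in> sets N"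
  shows "restrict_space M A \<Otimes>\<^sub>M restrict_space N B = restrict_space (M \<Otimes>\<^sub>M N) (A \<times> B)"
proof (rule pair_measure_eqI)
  interpret N: sigma_finite_measure N by fact
  show "sigma_finite_measure (restrict_space M A)" "sigma_finite_measure (restrict_space N B)"
    using assms by (auto intro: sigma_finite_measure_restrict_space)
  have AB: "A \<times> B \<in> sets (M \<Otimes>\<^sub>M N)" using A B by auto
  show "sets (restrict_space M A \<Otimes>\<^sub>M restrict_space N B) = sets (restrict_space (M \<Otimes>\<^sub>M N) (A \<times> B))"
  proof (rule antisym)
    show "sets (restrict_space M A \<Otimes>\<^sub>M restrict_space N B) \<subseteq> sets (restrict_space (M \<Otimes>\<^sub>M N) (A \<times> B))"
    proof (rule sets_pair_in_sets)
      fix a b assume "a \<in> sets (restrict_space M A)" "b \<in> sets (restrict_space N B)"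
      then show "a \<times> b \<in> sets (restrict_space (M \<Otimes>\<^sub>M N) (A \<times> B))"
        using A B AB by (auto simp: sets_restrict_space_iff)
    qed
    have id: "(\<lambda>z. z) \<in> measurable (restrict_space M A \<Otimes>\<^sub>M restrict_space N B) (M \<Otimes>\<^sub>M N)"
    proof -
      have "(\<lambda>z. (fst z, snd z)) \<in> measurable (restrict_space M A \<Otimes>\<^sub>M restrict_space N B) (M \<Otimes>\<^sub>M N)"
        by (intro measurable_Pair measurable_compose[OF measurable_fst] measurable_compose[OF measurable_snd]
            measurable_restrict_space1 measurable_ident_sets refl)
      then show ?thesis by simp
    qed
    show "sets (restrict_space (M \<Otimes>\<^sub>M N) (A \<times> B)) \<subseteq> sets (restrict_space M A \<Otimes>\<^sub>M restrict_space N B)"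
    proof
      fix X assume "X \<in> sets (restrict_space (M \<Otimes>\<^sub>M N) (A \<times> B))"
      then have X: "X \<in> sets (M \<Otimes>\<^sub>M N)" "X \<subseteq> A \<times> B"
        using AB by (auto simp: sets_restrict_space_iff)
      have "(\<lambda>z. z) -` X \<inter> space (restrict_space M A \<Otimes>\<^sub>M restrict_space N B) = X"
        using X sets.sets_into_space[OF A] sets.sets_into_space[OF B]
        by (auto simp: space_pair_measure space_restrict_space)
      then show "X \<in> sets (restrict_space M A \<Otimes>\<^sub>M restrict_space N B)"
        using measurable_sets[OF id X(1)] by simp
    qed
  qed
  fix a b assume "a \<in> sets (restrict_space M A)" "b \<in> sets (restrict_space N B)"
  then have a: "a \<subseteq> A" "a \<in> sets M" and b: "b \<subseteq> B" "b \<in> sets N"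
    using A B by (auto simp: sets_restrict_space_iff)
  have "emeasure (restrict_space (M \<Otimes>\<^sub>M N) (A \<times> B)) (a \<times> b) = emeasure (M \<Otimes>\<^sub>M N) (a \<times> b)"
    using a b AB by (intro emeasure_restrict_space) auto
  also have "\<dots> = emeasure M a * emeasure N b"
    using a b by (intro N.emeasure_pair_measure_Times)
  finally show "emeasure (restrict_space M A) a * emeasure (restrict_space N B) b =
      emeasure (restrict_space (M \<Otimes>\<^sub>M N) (A \<times> B)) (a \<times> b)"
    using a b A B by (simp add: emeasure_restrict_space)
qed

definition slab :: "real set \<Rightarrow> (real \<times> real) measure" where
  "slab I = restrict_space lborel (I \<times> {0..<2 * pi})"

lemma time_torus_eq_slab: "I \<in> sets borel \<Longrightarrow> time I \<Otimes>\<^sub>M torus = slab I"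
  unfolding torus_def slab_def lborel_prod[symmetric]
  by (rule pair_measure_restrict_space) (auto intro: sigma_finite_lborel)

lemma space_slab [simp]: "space (slab I) = I \<times> {0..<2 * pi}"
  by (simp add: slab_def space_restrict_space)

lemma borel_measurable_slab [measurable (raw)]:
  "f \<in> borel_measurable borel \<Longrightarrow> f \<in> borel_measurable (slab I)"
  unfolding slab_def by (rule measurable_restrict_space1) simp

lemma finite_measure_time:
  assumes "I \<in> sets borel" "bounded I"
  shows "finite_measure (time I)"
proof (rule finite_measureI)
  have "emeasure (time I) (space (time I)) = emeasure lborel I"
    using assms(1) by (subst emeasure_restrict_space) (auto simp: space_restrict_space)
  then show "emeasure (time I) (space (time I)) \<noteq> \<infinity>"
    using emeasure_bounded_finite[OF assms(2)] by simp
qed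

text \<open>Squeeze E between a compact set K and an open set U. A short translation keeps K inside
  U, so a point of K can leave E only into the small set U - E.\<close>

lemma measure_translate_diff_small:
  fixes E :: "'a::euclidean_space set"
  assumes E: "E \<in> sets borel" "bounded E" and e: "e > 0"
  obtains r where "r > 0" "\<And>v. norm v < r \<Longrightarrow> measure lborel {z \<in> E. z + v \<notin> E} \<le> e"
proof -
  obtain U where U: "open U" "E \<subseteq> U" "emeasure lborel (U - E) < ennreal (e / 2)"
    using outer_regular_lborel[OF E(1), of "e / 2"] e by (metis half_gt_zero)
  have "E \<in> sets lebesgue" using E(1) by (simp add: sets_completionI_sets)
  then obtain K where K: "closed K" "K \<subseteq> E" "emeasure lebesgue (E - K) < ennreal (e / 2)"
    by (rule sets_lebesgue_inner_closed[where e = "e / 2"]) (use e in auto)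
  have "compact K" using K E by (auto simp: compact_eq_bounded_closed intro: bounded_subset)
  then obtain r where r: "r > 0" "(\<Union>x\<in>K. ball x r) \<subseteq> U"
    using compact_subset_open_imp_ball_epsilon_subset[of K U] U K by blast
  have "measure lborel {z \<in> E. z + v \<notin> E} \<le> e" if "norm v < r" for v
  proof -
    have [measurable]: "E \<in> sets borel" "U \<in> sets borel" "K \<in> sets borel"
      using E U K by auto
    have KE: "emeasure lborel (E - K) \<le> ennreal (e / 2)"
      using K(3) by (simp add: less_imp_le)
    have "emeasure lborel {z. z + v \<in> U - E} = emeasure (distr lborel borel ((+) v)) (U - E)"
      by (subst emeasure_distr) (auto intro!: arg_cong[where f = "emeasure lborel"] simp: add.commute)
    also have "\<dots> \<le> ennreal (e / 2)"
      using U(3) by (simp add: lborel_distr_plus less_imp_le)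
    finally have UE: "emeasure lborel {z. z + v \<in> U - E} \<le> ennreal (e / 2)" .
    have "z + v \<in> U" if "z \<in> K" for z
      using r(2) that \<open>norm v < r\<close> by (force simp: dist_norm)
    then have "{z \<in> E. z + v \<notin> E} \<subseteq> (E - K) \<union> {z. z + v \<in> U - E}"
      by auto
    then have "emeasure lborel {z \<in> E. z + v \<notin> E} \<le> emeasure lborel ((E - K) \<union> {z. z + v \<in> U - E})"
      by (intro emeasure_mono) measurable
    also have "\<dots> \<le> emeasure lborel (E - K) + emeasure lborel {z. z + v \<in> U - E}"
      by (intro emeasure_subadditive) measurable
    also have "\<dots> \<le> ennreal (e / 2) + ennreal (e / 2)"
      by (intro add_mono KE UE)
    also have "\<dots> = ennreal e" using e by (simp flip: ennreal_plus)
    finally show ?thesis using e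
      by (simp add: measure_def enn2real_leI)
  qed
  then show ?thesis using r that by blast
qed

section \<open>Counting frequencies and pairs of frequencies on a fibre\<close>

lemma card_int_poly_roots_le:
  fixes q :: "int poly"
  assumes "q \<noteq> 0"
  shows "finite {k. poly q k = 0}" "card {k. poly q k = 0} \<le> degree q"
  using poly_roots_finite[OF assms] card_poly_roots_bound[OF assms] by auto

lemma card_poly_fibre_le:
  fixes p :: "int poly"
  assumes "degree p > 0"
  shows "finite {k. poly p k = m}" "card {k. poly p k = m} \<le> degree p"
proof -
  have "degree (p - [:m:]) = degree p"
    unfolding diff_conv_add_uminus by (rule degree_add_eq_left) (use assms in simp)
  moreover from this have "p - [:m:] \<noteq> 0" using assms by auto
  moreover have "{k. poly p k = m} = {k. poly (p - [:m:]) k = 0}" by auto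
  ultimately show "finite {k. poly p k = m}" "card {k. poly p k = m} \<le> degree p"
    using card_int_poly_roots_le[of "p - [:m:]"] by auto
qed

text \<open>If p(k) - p(k - j) were constant in k, then p would be affine along the multiples of j
  and hence of degree at most 1. In degree 1 this does happen and fibres are infinite, so degree at
  least 2 is essential here.\<close>

lemma card_poly_difference_fibre_le:
  fixes p :: "int poly"
  assumes p: "degree p \<ge> 2" and j: "j \<noteq> 0"
  shows "finite {k. poly p k - poly p (k - j) = n}" "card {k. poly p k - poly p (k - j) = n} \<le> degree p"
proof -
  define r where "r = p - pcompose p [:-j, 1:] - [:n:]"
  have poly_r: "poly r k = poly p k - poly p (k - j) - n" for k
    by (simp add: r_def poly_pcompose)
  have "r \<noteq> 0"
  proof
    assume "r = 0"
    then have step: "poly p k = poly p (k - j) + n" for k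
      using poly_r[of k] by simp
    have lin: "poly p (j * int i) = poly p 0 + n * int i" for i :: nat
    proof (induction i)
      case (Suc i)
      have "poly p (j * int (Suc i)) = poly p (j * int i) + n"
        using step[of "j * int (Suc i)"] by (simp add: algebra_simps)
      then show ?case using Suc by (simp add: algebra_simps)
    qed simp
    \<comment> \<open>By \<open>lin\<close>, p(j x) agrees with an affine polynomial at every
      natural number, hence identically.\<close>
    define q where "q = pcompose p [:0, j:] - [:poly p 0, n:]"
    have "range int \<subseteq> {k. poly q k = 0}"
      using lin by (auto simp: q_def poly_pcompose mult.commute)
    then have "infinite {k. poly q k = 0}"
      using finite_subset[of "range int"] range_inj_infinite[of int] by auto
    then have "q = 0" using poly_roots_finite by blast
    then have "pcompose p [:0, j:] = [:poly p 0, n:]" by (simp add: q_def)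
    then have "degree (pcompose p [:0, j:]) \<le> 1" by simp
    then show False using p j by (simp add: degree_pcompose)
  qed
  moreover have "degree r \<le> degree p"
    unfolding r_def by (intro degree_diff_le) (auto simp: degree_pcompose)
  moreover have "{k. poly p k - poly p (k - j) = n} = {k. poly r k = 0}"
    by (auto simp: poly_r)
  ultimately show "finite {k. poly p k - poly p (k - j) = n}" "card {k. poly p k - poly p (k - j) = n} \<le> degree p"
    using card_int_poly_roots_le[of r] by auto
qed

section \<open>Free waves and Fourier coefficients of a space-time set\<close>

definition wave :: "int poly \<Rightarrow> int \<Rightarrow> real \<times> real \<Rightarrow> complex" where
  "wave p k z = cis (of_int k * snd z + of_int (poly p k) * fst z)"

lemma cmod_wave [simp]: "cmod (wave p k z) = 1"
  by (simp add: wave_def)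

lemma measurable_wave [measurable]: "wave p k \<in> borel_measurable borel"
  unfolding wave_def[abs_def] by (intro borel_measurable_continuous_onI continuous_intros)

text \<open>Beware the order: the index is (space frequency, time frequency), the argument is (time,
  space).\<close>

definition mode2 :: "int \<times> int \<Rightarrow> real \<times> real \<Rightarrow> complex" where
  "mode2 j z = cis (of_int (fst j) * snd z + of_int (snd j) * fst z)"

lemma measurable_mode2 [measurable]: "mode2 j \<in> borel_measurable borel"
  unfolding mode2_def[abs_def] by (intro borel_measurable_continuous_onI continuous_intros)

lemma cmod_mode2 [simp]: "cmod (mode2 j z) = 1"
  by (simp add: mode2_def)

lemma integral_mode2:
  "(LINT z|slab {0..<2 * pi * real m}. mode2 j z) = (if j = 0 then 4 * pi\<^sup>2 * m else 0)"
proof -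
  let ?I = "{0..<2 * pi * real m}"
  interpret T: finite_measure "time ?I" by (rule finite_measure_time) (auto intro: bounded_subset[OF bounded_cbox[of 0 "2 * pi * real m"]])
  interpret P: pair_sigma_finite "time ?I" torus ..
  have eq: "time ?I \<Otimes>\<^sub>M torus = slab ?I" by (rule time_torus_eq_slab) auto
  interpret F: finite_measure "time ?I \<Otimes>\<^sub>M torus"
    by (rule finite_measure_pair_measure) (fact T.finite_measure_axioms finite_measure_torus)+
  have int: "integrable (time ?I \<Otimes>\<^sub>M torus) (mode2 j)"
    unfolding eq by (intro finite_measure.integrable_const_bound[where B = 1] F.finite_measure_axioms[unfolded eq]) auto
  have split: "mode2 j (t, x) = cis (of_int (snd j) * t) * mode (fst j) x" for t x
    by (simp add: mode2_def mode_def cis_mult algebra_simps)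
  have "(LINT z|slab ?I. mode2 j z) = (LINT t|time ?I. LINT x|torus. mode2 j (t, x))"
    using P.integral_fst'[OF int] by (simp add: eq)
  also have "\<dots> = (LINT t|time ?I. cis (of_int (snd j) * t)) * (LINT x|torus. mode (fst j) x)"
    by (simp add: split)
  also have "\<dots> = (if j = 0 then 4 * pi\<^sup>2 * m else 0)"
    by (cases j) (simp add: integral_mode integral_cis_multiples_of_period power2_eq_square zero_prod_def)
  finally show ?thesis .
qed


lemma indicator_scaleR_complex: "indicator A z *\<^sub>R (w :: complex) = indicator A z * w"
  by (simp add: indicator_def)

definition fourier2 :: "(real \<times> real) set \<Rightarrow> int \<times> int \<Rightarrow> complex" where
  "fourier2 A j = (LINT z|lborel. indicator A z * mode2 j z)"

lemma mode2_mult_cnj: "mode2 i z * cnj (mode2 j z) = mode2 (i - j) z"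
  by (simp add: mode2_def cis_cnj cis_mult algebra_simps)

lemma wave_mult_cnj: "wave p k z * cnj (wave p l z) = mode2 (k - l, poly p k - poly p l) z"
  by (simp add: wave_def mode2_def cis_cnj cis_mult algebra_simps)

lemma sum_fourier2_le:
  assumes A: "A \<in> sets borel" "A \<subseteq> {0..<2 * pi * real m} \<times> {0..<2 * pi}" and m: "m > 0" and J: "finite J"
  shows "(\<Sum>j\<in>J. (cmod (fourier2 A j))\<^sup>2) \<le> 4 * pi\<^sup>2 * m * measure lborel A"
proof -
  let ?I = "{0..<2 * pi * real m}"
  let ?M = "slab ?I"
  have fin: "finite_measure ?M"
  proof -
    have "bounded ?I" by (rule bounded_subset[OF bounded_cbox[of 0 "2 * pi * real m"]]) auto
    then have "finite_measure (time ?I \<Otimes>\<^sub>M torus)"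
      by (intro finite_measure_pair_measure finite_measure_time finite_measure_torus) auto
    then show ?thesis by (simp add: time_torus_eq_slab)
  qed
  have box: "?I \<times> {0..<2 * pi} \<in> sets (borel :: (real \<times> real) measure)"
    unfolding borel_prod[symmetric] by auto
  have restr: "(LINT z|?M. indicator A z *\<^sub>R f z) = (LINT z|lborel. indicator A z *\<^sub>R f z)"
    for f :: "real \<times> real \<Rightarrow> 'b::{banach, second_countable_topology}"
    unfolding slab_def using box A
    by (subst integral_restrict_space)
      (auto simp: set_lebesgue_integral_def intro!: Bochner_Integration.integral_cong split: split_indicator)
  let ?f = "indicator A :: real \<times> real \<Rightarrow> complex"
  have f2: "(cmod (?f z))\<^sup>2 = indicator A z *\<^sub>R 1" for z by (simp add: indicator_def)
  have Am: "A \<in> sets ?M" unfolding slab_def using A box by (simp add: sets_restrict_space_iff)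
  have int: "integrable ?M (\<lambda>z. (cmod (?f z))\<^sup>2)"
    by (rule finite_measure.integrable_const_bound[OF fin, where B = 1]) (use Am in \<open>auto simp: indicator_def\<close>)
  \<comment> \<open>Bessel's inequality involves conjugated modes, \<open>fourier2\<close> does not;
    hence the negated frequencies.\<close>
  have "(\<Sum>j\<in>uminus ` J. (cmod (LINT z|?M. ?f z * cnj (mode2 j z)))\<^sup>2) \<le> (4 * pi\<^sup>2 * m) * (LINT z|?M. (cmod (?f z))\<^sup>2)"
  proof (rule bessel_inequality[OF fin])
    show "(LINT z|?M. mode2 i z * cnj (mode2 j z)) = (if i = j then of_real (4 * pi\<^sup>2 * m) else 0)" for i j
      by (simp add: mode2_mult_cnj integral_mode2)
  qed (use J int Am m in auto)
  also have "(LINT z|?M. (cmod (?f z))\<^sup>2) = measure lborel A"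
    unfolding f2 restr using A by simp
  also have "(\<Sum>j\<in>uminus ` J. (cmod (LINT z|?M. ?f z * cnj (mode2 j z)))\<^sup>2) = (\<Sum>j\<in>J. (cmod (fourier2 A j))\<^sup>2)"
  proof (subst sum.reindex)
    have "cnj (mode2 (- j) z) = mode2 j z" for j z by (simp add: mode2_def cis_cnj ac_simps)
    moreover have "(LINT z|?M. ?f z * g z) = (LINT z|lborel. ?f z * g z)" for g
      using restr[of g] by (simp only: indicator_scaleR_complex)
    ultimately show "sum ((\<lambda>j. (cmod (LINT z|?M. ?f z * cnj (mode2 j z)))\<^sup>2) \<circ> uminus) J = (\<Sum>j\<in>J. (cmod (fourier2 A j))\<^sup>2)"
      by (simp add: fourier2_def)
  qed (auto simp: inj_on_def)
  finally show ?thesis .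
qed

text \<open>Bounds the squared Hilbert-Schmidt norm of an off-diagonal block. The bound is linear in
  the measure of the set: removing a small part of a set therefore perturbs the quadratic form
  little.\<close>

lemma sum_gram_le:
  fixes p :: "int poly"
  assumes p: "degree p \<ge> 2"
    and A: "A \<in> sets borel" "A \<subseteq> {0..<2 * pi * real m} \<times> {0..<2 * pi}" and m: "m > 0"
    and P: "finite P" "\<And>k l. (k, l) \<in> P \<Longrightarrow> k \<noteq> l"
  shows "(\<Sum>(k, l)\<in>P. (cmod (fourier2 A (k - l, poly p k - poly p l)))\<^sup>2) \<le> degree p * (4 * pi\<^sup>2 * m * measure lborel A)"
proof -
  define \<phi> where "\<phi> = (\<lambda>(k, l). (k - l, poly p k - poly p l))"
  have fibre: "card {q \<in> P. \<phi> q = y} \<le> degree p" if "y \<in> \<phi> ` P" for y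
  proof -
    obtain j n where y: "y = (j, n)" by (cases y)
    have "j \<noteq> 0" using that P(2) by (auto simp: y \<phi>_def)
    note fin = card_poly_difference_fibre_le[OF p this, of n]
    \<comment> \<open>Once the difference j is fixed, k determines l = k - j, so the first entry
      alone identifies the pair.\<close>
    have "card {q \<in> P. \<phi> q = y} \<le> card {k. poly p k - poly p (k - j) = n}"
    proof (rule card_inj_on_le[where f = fst])
      show "inj_on fst {q \<in> P. \<phi> q = y}" by (auto simp: inj_on_def \<phi>_def y)
      show "fst ` {q \<in> P. \<phi> q = y} \<subseteq> {k. poly p k - poly p (k - j) = n}"
        by (auto simp: \<phi>_def y)
    qed (rule fin)
    then show ?thesis using fin(2) by linarith
  qed
  have "(\<Sum>(k, l)\<in>P. (cmod (fourier2 A (k - l, poly p k - poly p l)))\<^sup>2) = (\<Sum>q\<in>P. (cmod (fourier2 A (\<phi> q)))\<^sup>2)"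
    by (intro sum.cong) (auto simp: \<phi>_def)
  also have "\<dots> = (\<Sum>y\<in>\<phi> ` P. \<Sum>q\<in>{q \<in> P. \<phi> q = y}. (cmod (fourier2 A (\<phi> q)))\<^sup>2)"
    by (rule sum.image_gen[OF P(1)])
  also have "\<dots> = (\<Sum>y\<in>\<phi> ` P. real (card {q \<in> P. \<phi> q = y}) * (cmod (fourier2 A y))\<^sup>2)"
    by (intro sum.cong refl) simp
  also have "\<dots> \<le> (\<Sum>y\<in>\<phi> ` P. real (degree p) * (cmod (fourier2 A y))\<^sup>2)"
    using fibre by (intro sum_mono mult_right_mono) auto
  also have "\<dots> = degree p * (\<Sum>y\<in>\<phi> ` P. (cmod (fourier2 A y))\<^sup>2)"
    by (simp add: sum_distrib_left)
  also have "\<dots> \<le> degree p * (4 * pi\<^sup>2 * m * measure lborel A)"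
    using P(1) by (intro mult_left_mono sum_fourier2_le[OF A m]) auto
  finally show ?thesis .
qed

definition wavesum :: "int poly \<Rightarrow> int set \<Rightarrow> (int \<Rightarrow> complex) \<Rightarrow> real \<times> real \<Rightarrow> complex" where
  "wavesum p S c z = (\<Sum>k\<in>S. c k * wave p k z)"

definition energy_on :: "(real \<times> real) set \<Rightarrow> (real \<times> real \<Rightarrow> complex) \<Rightarrow> real" where
  "energy_on A f = (LINT z|lborel. indicator A z * (cmod (f z))\<^sup>2)"

lemma measurable_wavesum [measurable]: "wavesum p S c \<in> borel_measurable borel"
  unfolding wavesum_def[abs_def] by measurable

lemma cmod_wavesum_le: "cmod (wavesum p S c z) \<le> (\<Sum>k\<in>S. cmod (c k))"
  unfolding wavesum_def by (rule order_trans[OF norm_sum]) (simp add: norm_mult)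

lemma integrable_indicator_bounded:
  fixes f :: "real \<times> real \<Rightarrow> 'b::{banach, second_countable_topology}"
  assumes "A \<in> sets borel" "bounded A" "f \<in> borel_measurable borel" "\<And>z. norm (f z) \<le> K"
  shows "integrable lborel (\<lambda>z. indicator A z *\<^sub>R f z)"
proof (rule integrableI_bounded_set_indicator[where B = K])
  show "emeasure lborel A < \<infinity>" using assms(2) by (rule emeasure_bounded_finite)
qed (use assms in auto)

lemma integrable_energy_wavesum:
  assumes "A \<in> sets borel" "bounded A"
  shows "integrable lborel (\<lambda>z. indicator A z * (cmod (wavesum p S c z))\<^sup>2)"
proof -
  have "norm ((cmod (wavesum p S c z))\<^sup>2) \<le> (\<Sum>k\<in>S. cmod (c k))\<^sup>2" for z
    using cmod_wavesum_le[of p S c z] by (simp add: power_mono)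
  then have "integrable lborel (\<lambda>z. indicator A z *\<^sub>R (cmod (wavesum p S c z))\<^sup>2)"
    using assms by (intro integrable_indicator_bounded) auto
  then show ?thesis by simp
qed

lemma energy_on_wavesum:
  assumes A: "A \<in> sets borel" "bounded A" and S: "finite S"
  shows "energy_on A (wavesum p S c) =
    Re (\<Sum>k\<in>S. \<Sum>l\<in>S. c k * cnj (c l) * fourier2 A (k - l, poly p k - poly p l))"
proof -
  have int: "integrable lborel (\<lambda>z. indicator A z * mode2 j z)" for j
  proof -
    have "integrable lborel (\<lambda>z. indicator A z *\<^sub>R mode2 j z)"
      by (rule integrable_indicator_bounded[OF A, of _ 1]) auto
    then show ?thesis by (simp only: indicator_scaleR_complex)
  qed
  have pt: "indicator A z * (cmod (wavesum p S c z))\<^sup>2 =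
      Re (\<Sum>k\<in>S. \<Sum>l\<in>S. c k * cnj (c l) * (indicator A z * mode2 (k - l, poly p k - poly p l) z))" for z
  proof -
    have "complex_of_real ((cmod (wavesum p S c z))\<^sup>2) = (\<Sum>k\<in>S. \<Sum>l\<in>S. (c k * wave p k z) * (cnj (c l) * cnj (wave p l z)))"
      unfolding complex_norm_square wavesum_def by (simp add: sum_product)
    also have "\<dots> = (\<Sum>k\<in>S. \<Sum>l\<in>S. c k * cnj (c l) * mode2 (k - l, poly p k - poly p l) z)"
      by (intro sum.cong refl) (simp add: mult_ac flip: wave_mult_cnj)
    finally have "(cmod (wavesum p S c z))\<^sup>2 = Re (\<Sum>k\<in>S. \<Sum>l\<in>S. c k * cnj (c l) * mode2 (k - l, poly p k - poly p l) z)"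
      by (metis Re_complex_of_real)
    then show ?thesis by (auto simp: indicator_def)
  qed
  have "energy_on A (wavesum p S c) = Re (LINT z|lborel. (\<Sum>k\<in>S. \<Sum>l\<in>S. c k * cnj (c l) * (indicator A z * mode2 (k - l, poly p k - poly p l) z)))"
    unfolding energy_on_def pt using int by (intro integral_Re) (auto intro!: integrable_sum)
  also have "(LINT z|lborel. (\<Sum>k\<in>S. \<Sum>l\<in>S. c k * cnj (c l) * (indicator A z * mode2 (k - l, poly p k - poly p l) z)))
     = (\<Sum>k\<in>S. \<Sum>l\<in>S. c k * cnj (c l) * fourier2 A (k - l, poly p k - poly p l))"
    using int by (simp add: Bochner_Integration.integral_sum integrable_sum fourier2_def)
  finally show ?thesis .
qed

text \<open>The diagonal gives the measure of the set times the energy. By Cauchy-Schwarz over the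
  pairs, the Hilbert-Schmidt bound \<eta> also bounds the off-diagonal quadratic form.\<close>

lemma energy_on_diagonal:
  assumes A: "A \<in> sets borel" "bounded A" and S: "finite S"
    and HS: "(\<Sum>(k, l)\<in>{(k, l) \<in> S \<times> S. k \<noteq> l}. (cmod (fourier2 A (k - l, poly p k - poly p l)))\<^sup>2) \<le> \<eta>\<^sup>2"
    and \<eta>: "\<eta> \<ge> 0"
  shows "\<bar>energy_on A (wavesum p S c) - measure lborel A * (\<Sum>k\<in>S. (cmod (c k))\<^sup>2)\<bar> \<le> \<eta> * (\<Sum>k\<in>S. (cmod (c k))\<^sup>2)"
proof -
  let ?M = "\<lambda>k l. fourier2 A (k - l, poly p k - poly p l)"
  let ?D = "{(k, l) \<in> S \<times> S. k \<noteq> l}"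
  have finD: "finite ?D" using S by (rule_tac finite_subset[of _ "S \<times> S"]) auto
  have diag: "fourier2 A (0, 0) = measure lborel A"
  proof -
    have "fourier2 A (0, 0) = (LINT z|lborel. indicator A z *\<^sub>R (1::complex))"
      unfolding fourier2_def by (intro Bochner_Integration.integral_cong refl) (simp add: mode2_def indicator_def)
    also have "\<dots> = measure lborel A" using A by (simp add: scaleR_conv_of_real)
    finally show ?thesis .
  qed
  have "(\<Sum>k\<in>S. \<Sum>l\<in>S. c k * cnj (c l) * ?M k l) = (\<Sum>(k, l)\<in>S \<times> S. c k * cnj (c l) * ?M k l)"
    by (simp add: sum.cartesian_product)
  also have "\<dots> = (\<Sum>(k, l)\<in>(\<lambda>k. (k, k)) ` S. c k * cnj (c l) * ?M k l) + (\<Sum>(k, l)\<in>?D. c k * cnj (c l) * ?M k l)"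
    using S finD by (subst sum.union_disjoint[symmetric]) (auto intro!: sum.cong)
  also have "(\<Sum>(k, l)\<in>(\<lambda>k. (k, k)) ` S. c k * cnj (c l) * ?M k l) = of_real (measure lborel A * (\<Sum>k\<in>S. (cmod (c k))\<^sup>2))"
  proof -
    have "(\<Sum>(k, l)\<in>(\<lambda>k. (k, k)) ` S. c k * cnj (c l) * ?M k l) = (\<Sum>k\<in>S. c k * cnj (c k) * ?M k k)"
      by (subst sum.reindex) (auto simp: inj_on_def)
    also have "\<dots> = (\<Sum>k\<in>S. of_real (measure lborel A * (cmod (c k))\<^sup>2))"
      unfolding of_real_mult complex_norm_square by (simp add: diag mult_ac)
    finally show ?thesis by (simp only: of_real_sum sum_distrib_left)
  qed
  finally have "energy_on A (wavesum p S c) - measure lborel A * (\<Sum>k\<in>S. (cmod (c k))\<^sup>2) = Re (\<Sum>(k, l)\<in>?D. c k * cnj (c l) * ?M k l)"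
    unfolding energy_on_wavesum[OF A S] by simp
  then have "\<bar>energy_on A (wavesum p S c) - measure lborel A * (\<Sum>k\<in>S. (cmod (c k))\<^sup>2)\<bar> \<le> cmod (\<Sum>(k, l)\<in>?D. c k * cnj (c l) * ?M k l)"
    by (simp only: abs_Re_le_cmod)
  also have "\<dots> \<le> (\<Sum>q\<in>?D. (cmod (c (fst q)) * cmod (c (snd q))) * cmod (?M (fst q) (snd q)))"
    by (rule order_trans[OF norm_sum]) (auto simp: norm_mult split_beta)
  also have "\<dots> \<le> L2_set (\<lambda>q. cmod (c (fst q)) * cmod (c (snd q))) ?D * L2_set (\<lambda>q. cmod (?M (fst q) (snd q))) ?D"
    using L2_set_mult_ineq[of "\<lambda>q. cmod (c (fst q)) * cmod (c (snd q))" "\<lambda>q. cmod (?M (fst q) (snd q))" ?D] by simp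
  also have "\<dots> \<le> (\<Sum>k\<in>S. (cmod (c k))\<^sup>2) * \<eta>"
  proof (rule mult_mono)
    have "(\<Sum>q\<in>?D. (cmod (c (fst q)) * cmod (c (snd q)))\<^sup>2) \<le> (\<Sum>q\<in>S \<times> S. (cmod (c (fst q)) * cmod (c (snd q)))\<^sup>2)"
      using S by (intro sum_mono2) auto
    also have "\<dots> = (\<Sum>k\<in>S. (cmod (c k))\<^sup>2)\<^sup>2"
      by (simp add: power2_eq_square sum_product sum.cartesian_product split_beta mult_ac)
    finally show "L2_set (\<lambda>q. cmod (c (fst q)) * cmod (c (snd q))) ?D \<le> (\<Sum>k\<in>S. (cmod (c k))\<^sup>2)"
      unfolding L2_set_def by (intro real_le_lsqrt) (auto intro: sum_nonneg)
    show "L2_set (\<lambda>q. cmod (?M (fst q) (snd q))) ?D \<le> \<eta>"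
      unfolding L2_set_def using HS \<eta> by (intro real_le_lsqrt) (auto simp: split_beta intro: sum_nonneg)
  qed (auto intro: sum_nonneg)
  finally show ?thesis by (simp add: mult.commute)
qed


text \<open>Take a finite set whose sum is within e of the supremum; a finite set disjoint from it
  cannot add more than e.\<close>

lemma tail_of_bounded_sums:
  fixes g :: "'a \<Rightarrow> real"
  assumes bdd: "\<And>P. finite P \<Longrightarrow> P \<subseteq> D \<Longrightarrow> sum g P \<le> B" and e: "e > 0"
  obtains P\<^sub>0 where "finite P\<^sub>0" "P\<^sub>0 \<subseteq> D" "\<And>P. finite P \<Longrightarrow> P \<subseteq> D - P\<^sub>0 \<Longrightarrow> sum g P \<le> e"
proof -
  define X where "X = sum g ` {P. finite P \<and> P \<subseteq> D}"
  have X: "X \<noteq> {}" "bdd_above X"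
    using bdd by (auto simp: X_def bdd_above_def)
  obtain x where "x \<in> X" "Sup X - e < x"
    using less_cSupE[of "Sup X - e" X] X e by auto
  then obtain P\<^sub>0 where P0: "finite P\<^sub>0" "P\<^sub>0 \<subseteq> D" "Sup X - e < sum g P\<^sub>0"
    by (auto simp: X_def)
  have "sum g P \<le> e" if "finite P" "P \<subseteq> D - P\<^sub>0" for P
  proof -
    have "sum g (P \<union> P\<^sub>0) \<le> Sup X"
      using that P0 X by (intro cSup_upper) (auto simp: X_def)
    also have "sum g (P \<union> P\<^sub>0) = sum g P + sum g P\<^sub>0"
      using that P0 by (intro sum.union_disjoint) auto
    finally show ?thesis using P0 by simp
  qed
  then show ?thesis using that P0 by blast
qed

lemma gram_tail:
  fixes p :: "int poly"
  assumes p: "degree p \<ge> 2"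
    and A: "A \<in> sets borel" "A \<subseteq> {0..<2 * pi * real m} \<times> {0..<2 * pi}" and m: "m > 0" and e: "e > 0"
  obtains N :: nat where "\<And>P. finite P \<Longrightarrow> (\<And>k l. (k, l) \<in> P \<Longrightarrow> k \<noteq> l \<and> (\<bar>k\<bar> > int N \<or> \<bar>l\<bar> > int N)) \<Longrightarrow>
    (\<Sum>(k, l)\<in>P. (cmod (fourier2 A (k - l, poly p k - poly p l)))\<^sup>2) \<le> e"
proof -
  let ?g = "\<lambda>(k, l). (cmod (fourier2 A (k - l, poly p k - poly p l)))\<^sup>2"
  let ?D = "{(k, l). k \<noteq> l} :: (int \<times> int) set"
  obtain P\<^sub>0 where P0: "finite P\<^sub>0" "P\<^sub>0 \<subseteq> ?D" "\<And>P. finite P \<Longrightarrow> P \<subseteq> ?D - P\<^sub>0 \<Longrightarrow> sum ?g P \<le> e"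
  proof (rule tail_of_bounded_sums[of ?D ?g _ e])
    show "sum ?g P \<le> degree p * (4 * pi\<^sup>2 * m * measure lborel A)" if "finite P" "P \<subseteq> ?D" for P
      by (rule sum_gram_le[OF p A m]) (use that in auto)
  qed (use e in auto)
  \<comment> \<open>Any bound on all entries of the pairs in \<open>P\<^sub>0\<close> would do; the
    sum of their absolute values is one.\<close>
  define N where "N = nat (\<Sum>(k, l)\<in>P\<^sub>0. \<bar>k\<bar> + \<bar>l\<bar>)"
  have N: "\<bar>k\<bar> \<le> int N \<and> \<bar>l\<bar> \<le> int N" if "(k, l) \<in> P\<^sub>0" for k l
  proof -
    have "(\<lambda>(k, l). \<bar>k\<bar> + \<bar>l\<bar>) (k, l) \<le> (\<Sum>(k, l)\<in>P\<^sub>0. \<bar>k\<bar> + \<bar>l\<bar>)"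
      using P0(1) that by (intro member_le_sum) auto
    moreover have "int N = (\<Sum>(k, l)\<in>P\<^sub>0. \<bar>k\<bar> + \<bar>l\<bar>)"
      unfolding N_def by (intro int_nat_eq[THEN trans] if_P sum_nonneg) auto
    ultimately show ?thesis
      by (simp only: prod.case) (intro conjI; linarith)
  qed
  show ?thesis
  proof (rule that)
    fix P assume P: "finite P" "\<And>k l. (k, l) \<in> P \<Longrightarrow> k \<noteq> l \<and> (\<bar>k\<bar> > int N \<or> \<bar>l\<bar> > int N)"
    show "sum ?g P \<le> e"
    proof (rule P0(3)[OF P(1)])
      show "P \<subseteq> ?D - P\<^sub>0"
      proof (rule subrelI)
        fix k l assume "(k, l) \<in> P"
        with P(2)[OF this] N[of k l] show "(k, l) \<in> ?D - P\<^sub>0" by auto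
      qed
    qed
  qed
qed

lemma energy_on_mono:
  assumes "A \<subseteq> B" "A \<in> sets borel" "B \<in> sets borel" "bounded B"
  shows "energy_on A (wavesum p S c) \<le> energy_on B (wavesum p S c)"
  unfolding energy_on_def
  using assms bounded_subset[OF assms(4,1)]
  by (intro integral_mono integrable_energy_wavesum mult_right_mono) (auto simp: indicator_def)

lemma energy_on_Diff:
  assumes "A \<subseteq> B" "A \<in> sets borel" "B \<in> sets borel" "bounded B"
  shows "energy_on A (wavesum p S c) = energy_on B (wavesum p S c) - energy_on (B - A) (wavesum p S c)"
proof -
  have "energy_on A (wavesum p S c) = (LINT z|lborel. indicator B z * (cmod (wavesum p S c z))\<^sup>2 - indicator (B - A) z * (cmod (wavesum p S c z))\<^sup>2)"
    unfolding energy_on_def using assms(1) by (intro Bochner_Integration.integral_cong) (auto simp: indicator_def)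
  then show ?thesis
    unfolding energy_on_def using assms bounded_subset[OF assms(4), of "B - A"]
    by (simp add: integrable_energy_wavesum)
qed

text \<open>A single low frequency in \<open>S\<close> is harmless, because all off-diagonal pairs still contain a
  high frequency.\<close>

lemma high_frequency_bound:
  fixes p :: "int poly"
  assumes p: "degree p \<ge> 2"
    and E: "E \<in> sets borel" "E \<subseteq> {0..<2 * pi * real m} \<times> {0..<2 * pi}" and m: "m > 0"
    and pos: "measure lborel E > 0"
  obtains N :: nat and \<delta> :: real where "\<delta> > 0"
    "\<And>F S c. F \<in> sets borel \<Longrightarrow> F \<subseteq> E \<Longrightarrow> measure lborel (E - F) \<le> \<delta> \<Longrightarrow> finite S \<Longrightarrow>
      (\<And>k l. k \<in> S \<Longrightarrow> l \<in> S \<Longrightarrow> \<bar>k\<bar> \<le> int N \<Longrightarrow> \<bar>l\<bar> \<le> int N \<Longrightarrow> k = l) \<Longrightarrow>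
      measure lborel E / 2 * (\<Sum>k\<in>S. (cmod (c k))\<^sup>2) \<le> energy_on F (wavesum p S c)"
proof -
  define \<mu> where "\<mu> = measure lborel E"
  define B where "B = degree p * (4 * pi\<^sup>2 * m)"
  have \<mu>: "\<mu> > 0" and B: "B > 0" using pos p m by (auto simp: \<mu>_def B_def)
  have bE: "bounded E"
    by (rule bounded_subset[OF bounded_cbox[of "(0, 0)" "(2 * pi * real m, 2 * pi)"]]) (use E(2) in \<open>force simp: cbox_Pair_eq\<close>)
  obtain N where N: "\<And>P. finite P \<Longrightarrow> (\<And>k l. (k, l) \<in> P \<Longrightarrow> k \<noteq> l \<and> (\<bar>k\<bar> > int N \<or> \<bar>l\<bar> > int N)) \<Longrightarrow>
    (\<Sum>(k, l)\<in>P. (cmod (fourier2 E (k - l, poly p k - poly p l)))\<^sup>2) \<le> (\<mu> / 4)\<^sup>2"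
    by (rule gram_tail[OF p E m, of "(\<mu> / 4)\<^sup>2"]) (use \<mu> in auto)
  \<comment> \<open>The first entry controls the diagonal of the removed set E - F, the second its
    Hilbert-Schmidt norm. The total loss is \<mu>/4 + \<mu>/8 + \<mu>/8, which leaves
    \<mu>/2.\<close>
  define \<delta> where "\<delta> = min (\<mu> / 8) ((\<mu> / 8)\<^sup>2 / B)"
  have \<delta>: "\<delta> > 0" "\<delta> \<le> \<mu> / 8" "B * \<delta> \<le> (\<mu> / 8)\<^sup>2"
    using \<mu> B by (auto simp: \<delta>_def min_def field_simps)
  show ?thesis
  proof (rule that[OF \<delta>(1), of N])
    fix F S and c :: "int \<Rightarrow> complex"
    assume F: "F \<in> sets borel" "F \<subseteq> E" "measure lborel (E - F) \<le> \<delta>" and S: "finite S"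
      and low: "\<And>k l. k \<in> S \<Longrightarrow> l \<in> S \<Longrightarrow> \<bar>k\<bar> \<le> int N \<Longrightarrow> \<bar>l\<bar> \<le> int N \<Longrightarrow> k = l"
    let ?D = "{(k, l) \<in> S \<times> S. k \<noteq> l}" and ?c = "\<Sum>k\<in>S. (cmod (c k))\<^sup>2"
    have finD: "finite ?D" using S by (rule_tac finite_subset[of _ "S \<times> S"]) auto
    have c0: "?c \<ge> 0" by (simp add: sum_nonneg)
    have EF: "E - F \<in> sets borel" "bounded (E - F)" "E - F \<subseteq> {0..<2 * pi * real m} \<times> {0..<2 * pi}"
      using E F bE by (auto intro: bounded_subset)
    have "\<bar>energy_on E (wavesum p S c) - \<mu> * ?c\<bar> \<le> \<mu> / 4 * ?c"
      unfolding \<mu>_def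
    proof (rule energy_on_diagonal[OF E(1) bE S])
      show "(\<Sum>(k, l)\<in>?D. (cmod (fourier2 E (k - l, poly p k - poly p l)))\<^sup>2) \<le> (measure lborel E / 4)\<^sup>2"
        unfolding \<mu>_def[symmetric]
      proof (rule N[OF finD])
        fix k l assume "(k, l) \<in> ?D"
        then have "k \<in> S" "l \<in> S" "k \<noteq> l" by auto
        then show "k \<noteq> l \<and> (\<bar>k\<bar> > int N \<or> \<bar>l\<bar> > int N)"
          using low[of k l] by (meson not_less)
      qed
    qed simp
    moreover have "\<bar>energy_on (E - F) (wavesum p S c) - measure lborel (E - F) * ?c\<bar> \<le> \<mu> / 8 * ?c"
    proof (rule energy_on_diagonal[OF EF(1,2) S])
      have "(\<Sum>(k, l)\<in>?D. (cmod (fourier2 (E - F) (k - l, poly p k - poly p l)))\<^sup>2)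
        \<le> degree p * (4 * pi\<^sup>2 * m * measure lborel (E - F))"
        by (rule sum_gram_le[OF p EF(1,3) m finD]) auto
      also have "\<dots> = B * measure lborel (E - F)" by (simp add: B_def)
      also have "\<dots> \<le> B * \<delta>" using F B by (intro mult_left_mono) auto
      also have "\<dots> \<le> (\<mu> / 8)\<^sup>2" by (rule \<delta>)
      finally show "(\<Sum>(k, l)\<in>?D. (cmod (fourier2 (E - F) (k - l, poly p k - poly p l)))\<^sup>2) \<le> (\<mu> / 8)\<^sup>2" .
    qed (use \<mu> in simp)
    moreover have "energy_on F (wavesum p S c) = energy_on E (wavesum p S c) - energy_on (E - F) (wavesum p S c)"
      using F E bE by (intro energy_on_Diff) auto
    moreover have "measure lborel (E - F) * ?c \<le> \<mu> / 8 * ?c"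
      using F(3) \<delta>(2) c0 by (intro mult_right_mono) auto
    ultimately have "energy_on F (wavesum p S c) \<ge> \<mu> * ?c - \<mu> / 4 * ?c - \<mu> / 8 * ?c - \<mu> / 8 * ?c"
      by linarith
    then show "measure lborel E / 2 * ?c \<le> energy_on F (wavesum p S c)"
      by (simp add: \<mu>_def[symmetric])
  qed
qed

text \<open>Translating in \<open>x\<close> by \<open>h\<close> multiplies the \<open>k\<close>-th coefficient by \<open>mode k h\<close>; the factor
  \<open>mode k h - mode l h\<close> therefore removes the frequency \<open>l\<close> at the cost of shrinking the observation set.\<close>

definition shifted_core :: "(real \<times> real) set \<Rightarrow> real \<Rightarrow> nat \<Rightarrow> (real \<times> real) set" where
  "shifted_core E h j = {z. \<forall>i\<le>j. z + (0, real i * h) \<in> E}"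

lemma shifted_core_sets:
  assumes [measurable]: "E \<in> sets borel"
  shows "shifted_core E h j \<in> sets borel"
  unfolding shifted_core_def by measurable

lemma shifted_core_subset: "shifted_core E h j \<subseteq> E"
  unfolding shifted_core_def by (auto dest: spec[of _ 0])

lemma energy_on_translate_le:
  assumes F: "F \<in> sets borel" and G: "G \<in> sets borel" "bounded G" and sub: "\<And>z. z \<in> F \<Longrightarrow> z + v \<in> G"
  shows "energy_on F (\<lambda>z. wavesum p S c (z + v)) \<le> energy_on G (wavesum p S c)"
    and "integrable lborel (\<lambda>z. indicator F z * (cmod (wavesum p S c (z + v)))\<^sup>2)"
proof -
  note [measurable] = F G(1)
  let ?f = "\<lambda>z. indicator G z * (cmod (wavesum p S c z))\<^sup>2"
  have int: "integrable lborel ?f" by (rule integrable_energy_wavesum[OF G])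
  have distr: "distr lborel borel (\<lambda>z. z + v) = lborel"
    using lborel_distr_plus[of v] by (subst add.commute) simp
  have int2: "integrable lborel (\<lambda>z. ?f (z + v))"
    by (rule integrable_distr[where M' = borel]) (use int in \<open>auto simp: distr\<close>)
  show i: "integrable lborel (\<lambda>z. indicator F z * (cmod (wavesum p S c (z + v)))\<^sup>2)"
    by (rule Bochner_Integration.integrable_bound[OF int2]) (use sub in \<open>auto simp: indicator_def\<close>)
  have "energy_on F (\<lambda>z. wavesum p S c (z + v)) \<le> (LINT z|lborel. ?f (z + v))"
    unfolding energy_on_def by (rule integral_mono[OF i int2]) (use sub in \<open>auto simp: indicator_def\<close>)
  also have "\<dots> = (LINT z|distr lborel borel (\<lambda>z. z + v). ?f z)"
    by (subst integral_distr) auto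
  also have "\<dots> = energy_on G (wavesum p S c)"
    by (simp add: distr energy_on_def)
  finally show "energy_on F (\<lambda>z. wavesum p S c (z + v)) \<le> energy_on G (wavesum p S c)" .
qed

definition annihilate :: "real \<Rightarrow> int set \<Rightarrow> (int \<Rightarrow> complex) \<Rightarrow> int \<Rightarrow> complex" where
  "annihilate h L c k = (\<Prod>l\<in>L. mode k h - mode l h) * c k"

lemma wave_shift: "wave p k (z + (0, h)) = mode k h * wave p k z"
  by (simp add: wave_def mode_def cis_mult algebra_simps)

text \<open>Each frequency in L is one difference operator. It costs a factor 2 + 2 = 4, since
  \<open>mode l h\<close> has modulus 1, and uses up one more translate of E; so the order of the
  core and the exponent of 4 are both \<open>card L\<close>.\<close>

lemma energy_on_annihilate_le:
  assumes E: "E \<in> sets borel" "bounded E" and L: "finite L"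
  shows "energy_on (shifted_core E h (card L)) (wavesum p S (annihilate h L c)) \<le> 4 ^ card L * energy_on E (wavesum p S c)"
  using L
proof (induction L rule: finite_induct)
  case empty
  have "annihilate h {} c = c" by (auto simp: annihilate_def)
  then show ?case by (simp add: shifted_core_def zero_prod_def[symmetric])
next
  case (insert l L)
  let ?G = "shifted_core E h (card L)" and ?F = "shifted_core E h (Suc (card L))"
  let ?u = "wavesum p S (annihilate h L c)"
  have G: "?G \<in> sets borel" "bounded ?G" and F: "?F \<in> sets borel" "bounded ?F"
    using E by (auto intro: shifted_core_sets bounded_subset[OF _ shifted_core_subset])
  have sub: "?F \<subseteq> ?G" by (auto simp: shifted_core_def)
  have sub2: "z + (0, h) \<in> ?G" if "z \<in> ?F" for z
    unfolding shifted_core_def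
  proof (intro CollectI allI impI)
    fix i assume "i \<le> card L"
    then have "z + (0, real (Suc i) * h) \<in> E"
      using that unfolding shifted_core_def by (auto simp del: of_nat_Suc)
    then show "z + (0, h) + (0, real i * h) \<in> E" by (simp add: algebra_simps)
  qed
  have step: "wavesum p S (annihilate h (insert l L) c) z = ?u (z + (0, h)) - mode l h * ?u z" for z
    using insert.hyps
    by (simp add: wavesum_def annihilate_def wave_shift sum_distrib_left algebra_simps flip: sum_subtractf)
  have i1: "integrable lborel (\<lambda>z. indicator ?F z * (cmod (?u (z + (0, h))))\<^sup>2)"
    by (rule energy_on_translate_le(2)[OF F(1) G sub2])
  have i2: "integrable lborel (\<lambda>z. indicator ?F z * (cmod (?u z))\<^sup>2)"
    by (rule integrable_energy_wavesum[OF F])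
  have "energy_on ?F (wavesum p S (annihilate h (insert l L) c)) \<le>
     (LINT z|lborel. 2 * (indicator ?F z * (cmod (?u (z + (0, h))))\<^sup>2) + 2 * (indicator ?F z * (cmod (?u z))\<^sup>2))"
    unfolding energy_on_def
  proof (rule integral_mono)
    show "integrable lborel (\<lambda>z. indicator ?F z * (cmod (wavesum p S (annihilate h (insert l L) c) z))\<^sup>2)"
      by (rule integrable_energy_wavesum[OF F])
    show "integrable lborel (\<lambda>z. 2 * (indicator ?F z * (cmod (?u (z + (0, h))))\<^sup>2) + 2 * (indicator ?F z * (cmod (?u z))\<^sup>2))"
      using i1 i2 by (intro Bochner_Integration.integrable_add integrable_mult_right)
    show "indicator ?F z * (cmod (wavesum p S (annihilate h (insert l L) c) z))\<^sup>2
      \<le> 2 * (indicator ?F z * (cmod (?u (z + (0, h))))\<^sup>2) + 2 * (indicator ?F z * (cmod (?u z))\<^sup>2)" for z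
      using cmod_diff_square_le[of "?u (z + (0, h))" "mode l h * ?u z"]
      by (simp add: step indicator_def norm_mult)
  qed
  also have "\<dots> = 2 * energy_on ?F (\<lambda>z. ?u (z + (0, h))) + 2 * energy_on ?F ?u"
    unfolding energy_on_def using i1 i2
    by (subst Bochner_Integration.integral_add) auto
  also have "\<dots> \<le> 2 * energy_on ?G ?u + 2 * energy_on ?G ?u"
    using energy_on_translate_le(1)[OF F(1) G sub2] energy_on_mono[OF sub F(1) G]
    by (intro add_mono mult_left_mono) auto
  also have "\<dots> \<le> 4 ^ card (insert l L) * energy_on E (wavesum p S c)"
    using insert by simp
  finally show ?case using insert.hyps by simp
qed


text \<open>Injectivity makes every factor \<open>mode k h - mode l h\<close> with k and l distinct
  nonzero. It fails only for rational multiples of 2 pi, and these are countable.\<close>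

lemma exists_generic_shift:
  assumes "\<rho> > 0"
  obtains h where "0 < h" "h < \<rho>" "inj (\<lambda>k. mode k h)"
proof -
  define X where "X = (\<lambda>(n, k). 2 * pi * of_int n / of_int k) ` (UNIV :: (int \<times> int) set)"
  have "countable X" unfolding X_def by (intro countable_image) auto
  then have "\<not> {0<..<\<rho>} \<subseteq> X"
    using uncountable_open_interval[of 0 \<rho>] assms countable_subset by blast
  then obtain h where "h \<in> {0<..<\<rho>}" "h \<notin> X" by blast
  then have h: "0 < h" "h < \<rho>" "h \<notin> X" by auto
  have "k = l" if "mode k h = mode l h" for k l
  proof (rule ccontr)
    assume "k \<noteq> l"
    have "mode (k - l) h = 1"
      using that mode_mult_cnj[of k h l] by (simp add: mode_def cis_cnj cis_mult)
    then have "cos (of_int (k - l) * h) = 1" by (simp add: mode_def complex_eq_iff)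
    then obtain n :: int where "of_int (k - l) * h = of_int n * 2 * pi"
      by (auto simp: cos_one_2pi_int)
    then have "h = 2 * pi * of_int n / of_int (k - l)"
      using \<open>k \<noteq> l\<close> by (simp add: field_simps)
    then have "h \<in> X" unfolding X_def by (intro image_eqI[of _ _ "(n, k - l)"]) auto
    then show False using h(3) by simp
  qed
  then show ?thesis using h that by (auto simp: inj_def)
qed

text \<open>A union bound over the J + 1 translates, each of length at most J h and each losing at
  most e / (J + 1).\<close>

lemma measure_shifted_core_small:
  assumes E: "E \<in> sets borel" "bounded E" and e: "e > 0"
  obtains \<rho> where "\<rho> > 0" "\<And>h. 0 < h \<Longrightarrow> h < \<rho> \<Longrightarrow> measure lborel (E - shifted_core E h J) \<le> e"
proof -
  note [measurable] = E(1)
  obtain r where r: "r > 0" "\<And>v. norm v < r \<Longrightarrow> measure lborel {z \<in> E. z + v \<notin> E} \<le> e / (J + 1)"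
    using measure_translate_diff_small[OF E, of "e / (J + 1)"] e by auto
  have "measure lborel (E - shifted_core E h J) \<le> e" if h: "0 < h" "h < r / (J + 1)" for h
  proof -
    let ?X = "\<lambda>i. {z \<in> E. z + (0, real i * h) \<notin> E}"
    have fm: "?X i \<in> fmeasurable lborel" for i
      by (rule fmeasurableI2[of E]) (use E(1) emeasure_bounded_finite[OF E(2)] in \<open>auto simp: fmeasurable_def\<close>)
    have "E - shifted_core E h J = (\<Union>i\<in>{..J}. ?X i)"
      by (auto simp: shifted_core_def)
    then have "measure lborel (E - shifted_core E h J) \<le> (\<Sum>i\<in>{..J}. measure lborel (?X i))"
      by (simp only:) (intro measure_UNION_le; use fm in auto)
    also have "\<dots> \<le> (\<Sum>i\<in>{..J}. e / (J + 1))"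
    proof (intro sum_mono r(2))
      fix i assume i: "i \<in> {..J}"
      have "real i * h \<le> real J * h" using i h by (intro mult_right_mono) auto
      also have "\<dots> < (real J + 1) * h" using h by simp
      also have "\<dots> < r" using h by (simp add: field_simps)
      finally show "norm ((0::real), real i * h) < r" using h by simp
    qed
    also have "\<dots> = e" by (simp add: field_simps)
    finally show ?thesis .
  qed
  then show ?thesis using r that[of "r / (J + 1)"] by auto
qed

lemma energy_on_wavesum_le:
  assumes A: "A \<in> sets borel" "bounded A" and S: "finite S"
  shows "energy_on A (wavesum p S c) \<le> measure lborel A * card S * (\<Sum>k\<in>S. (cmod (c k))\<^sup>2)"
proof -
  have pt: "(cmod (wavesum p S c z))\<^sup>2 \<le> card S * (\<Sum>k\<in>S. (cmod (c k))\<^sup>2)" for z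
  proof -
    have "(cmod (wavesum p S c z))\<^sup>2 \<le> (\<Sum>k\<in>S. cmod (c k))\<^sup>2"
      by (intro power_mono cmod_wavesum_le) auto
    also have "\<dots> \<le> card S * (\<Sum>k\<in>S. (cmod (c k))\<^sup>2)"
      using Cauchy_Schwarz_ineq_sum[of "\<lambda>_. 1" "\<lambda>k. cmod (c k)" S] by simp
    finally show ?thesis .
  qed
  have "energy_on A (wavesum p S c) \<le> (LINT z|lborel. indicator A z * (card S * (\<Sum>k\<in>S. (cmod (c k))\<^sup>2)))"
    unfolding energy_on_def
  proof (rule integral_mono[OF integrable_energy_wavesum[OF A]])
    show "integrable lborel (\<lambda>z. indicator A z * (card S * (\<Sum>k\<in>S. (cmod (c k))\<^sup>2)))"
      using A emeasure_bounded_finite[OF A(2)] by (intro integrable_mult_left integrable_real_indicator) auto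
  qed (use pt in \<open>auto simp: indicator_def\<close>)
  then show ?thesis using A by simp
qed

text \<open>For one low frequency k all other low frequencies are annihilated. The high-frequency
  bound tolerates the single one left, and on the shrunken set it controls the coefficient of k by
  the energy on E. With all low coefficients controlled, the low part is subtracted and the same
  bound applies to the remainder.\<close>

theorem observability_wavesum:
  fixes p :: "int poly"
  assumes p: "degree p \<ge> 2"
    and E: "E \<in> sets borel" "E \<subseteq> {0..<2 * pi * real m} \<times> {0..<2 * pi}" and m: "m > 0"
    and pos: "measure lborel E > 0"
  obtains \<kappa> where "\<kappa> > 0"
    "\<And>S c. finite S \<Longrightarrow> \<kappa> * (\<Sum>k\<in>S. (cmod (c k))\<^sup>2) \<le> energy_on E (wavesum p S c)"
proof -
  define \<mu> where "\<mu> = measure lborel E"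
  have \<mu>: "\<mu> > 0" using pos by (simp add: \<mu>_def)
  have bE: "bounded E"
    by (rule bounded_subset[OF bounded_cbox[of "(0, 0)" "(2 * pi * real m, 2 * pi)"]]) (use E(2) in \<open>force simp: cbox_Pair_eq\<close>)
  obtain N :: nat and \<delta> :: real where \<delta>: "\<delta> > 0" and
    high: "\<And>F S c. F \<in> sets borel \<Longrightarrow> F \<subseteq> E \<Longrightarrow> measure lborel (E - F) \<le> \<delta> \<Longrightarrow> finite S \<Longrightarrow>
      (\<And>k l. k \<in> S \<Longrightarrow> l \<in> S \<Longrightarrow> \<bar>k\<bar> \<le> int N \<Longrightarrow> \<bar>l\<bar> \<le> int N \<Longrightarrow> k = l) \<Longrightarrow>
      \<mu> / 2 * (\<Sum>k\<in>S. (cmod (c k))\<^sup>2) \<le> energy_on F (wavesum p S c)"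
    unfolding \<mu>_def by (rule high_frequency_bound[OF p E m pos]) blast
  define Low where "Low = {- int N..int N}"
  \<comment> \<open>Besides k there are 2 N low frequencies, and removing each costs one
    translate.\<close>
  obtain \<rho> where \<rho>: "\<rho> > 0" "\<And>h. 0 < h \<Longrightarrow> h < \<rho> \<Longrightarrow> measure lborel (E - shifted_core E h (2 * N)) \<le> \<delta>"
    using measure_shifted_core_small[OF E(1) bE \<delta>, of "2 * N"] by blast
  obtain h where h: "0 < h" "h < \<rho>" "inj (\<lambda>k. mode k h)"
    using exists_generic_shift[OF \<rho>(1)] .
  \<comment> \<open>The factor by which annihilating the other low frequencies multiplies the
    squared modulus of the k-th coefficient.\<close>
  define w where "w k = (cmod (\<Prod>l\<in>Low - {k}. mode k h - mode l h))\<^sup>2" for k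
  have w: "w k > 0" for k
    using h(3) by (auto simp: w_def Low_def inj_def)
  define w\<^sub>0 where "w\<^sub>0 = Min (w ` Low)"
  have Low: "finite Low" "Low \<noteq> {}" by (auto simp: Low_def)
  have w0: "w\<^sub>0 > 0" "\<And>k. k \<in> Low \<Longrightarrow> w\<^sub>0 \<le> w k"
    using Low w by (auto simp: w\<^sub>0_def)
  \<comment> \<open>\<open>C\<^sub>1\<close> adds up the bound \<open>single\<close> over the low
    frequencies. \<open>C\<^sub>2\<close> bounds the high part, to which the subtracted low part
    contributes as an error.\<close>
  define C\<^sub>1 where "C\<^sub>1 = card Low * (2 / \<mu> * 4 ^ (2 * N) / w\<^sub>0)"
  define C\<^sub>2 where "C\<^sub>2 = 2 / \<mu> * (2 + 2 * (\<mu> * card Low * C\<^sub>1))"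
  have "C\<^sub>1 \<ge> 0"
    using w0 \<mu> by (simp add: C\<^sub>1_def)
  moreover from this have "C\<^sub>2 > 0"
    unfolding C\<^sub>2_def using \<mu> by (intro mult_pos_pos add_pos_nonneg mult_nonneg_nonneg) auto
  ultimately have C: "C\<^sub>1 \<ge> 0" "C\<^sub>2 > 0" by auto
  have main: "(\<Sum>k\<in>S. (cmod (c k))\<^sup>2) \<le> (C\<^sub>1 + C\<^sub>2) * energy_on E (wavesum p S c)"
    if S: "finite S" "Low \<subseteq> S" for S c
  proof -
    define Q where "Q = energy_on E (wavesum p S c)"
    have single: "(cmod (c k))\<^sup>2 \<le> 2 / \<mu> * 4 ^ (2 * N) / w\<^sub>0 * Q" if k: "k \<in> Low" for k
    proof -
      let ?L = "Low - {k}" and ?S = "S - (Low - {k})" and ?d = "annihilate h (Low - {k}) c"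
      let ?F = "shifted_core E h (2 * N)"
      have cardL: "card ?L = 2 * N" using k by (simp add: Low_def)
      have "w\<^sub>0 * (cmod (c k))\<^sup>2 \<le> (cmod (?d k))\<^sup>2"
        using w0(2)[OF k] by (simp add: annihilate_def norm_mult power_mult_distrib w_def mult_right_mono)
      also have "\<dots> \<le> (\<Sum>k\<in>?S. (cmod (?d k))\<^sup>2)"
        using k S by (intro member_le_sum) auto
      also have "\<dots> \<le> 2 / \<mu> * energy_on ?F (wavesum p ?S ?d)"
      proof -
        have "\<mu> / 2 * (\<Sum>k\<in>?S. (cmod (?d k))\<^sup>2) \<le> energy_on ?F (wavesum p ?S ?d)"
          by (rule high) (use E h \<rho>(2) S in \<open>auto simp: Low_def shifted_core_sets intro: subsetD[OF shifted_core_subset]\<close>)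
        then show ?thesis using \<mu> by (simp add: field_simps)
      qed
      \<comment> \<open>The coefficients at the removed frequencies are already 0, so the full sum
        may be used again.\<close>
      also have "wavesum p ?S ?d = wavesum p S ?d"
      proof
        have "?d l = 0" if "l \<in> ?L" for l
          unfolding annihilate_def using that Low by (simp add: prod_zero_iff) (auto intro: bexI[of _ l])
        then show "wavesum p ?S ?d z = wavesum p S ?d z" for z
          unfolding wavesum_def using S by (intro sum.mono_neutral_left) auto
      qed
      also have "energy_on ?F (wavesum p S ?d) \<le> 4 ^ (2 * N) * Q"
        using energy_on_annihilate_le[OF E(1) bE, of ?L h p S c] Low cardL by (simp add: Q_def)
      finally show ?thesis using w0 \<mu> by (simp add: field_simps)
    qed
    have low: "(\<Sum>k\<in>Low. (cmod (c k))\<^sup>2) \<le> C\<^sub>1 * Q"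
      using sum_bounded_above[OF single, of Low] by (simp add: C\<^sub>1_def mult_ac)
    have high': "(\<Sum>k\<in>S - Low. (cmod (c k))\<^sup>2) \<le> C\<^sub>2 * Q"
    proof -
      have eqS: "wavesum p (S - Low) c z = wavesum p S c z - wavesum p Low c z" for z
        unfolding wavesum_def using S by (simp add: sum_diff)
      have "\<mu> / 2 * (\<Sum>k\<in>S - Low. (cmod (c k))\<^sup>2) \<le> energy_on E (wavesum p (S - Low) c)"
        by (rule high) (use E \<delta> S in \<open>auto simp: Low_def\<close>)
      also have "\<dots> \<le> (LINT z|lborel. 2 * (indicator E z * (cmod (wavesum p S c z))\<^sup>2) + 2 * (indicator E z * (cmod (wavesum p Low c z))\<^sup>2))"
        unfolding energy_on_def
      proof (rule integral_mono)
        show "indicator E z * (cmod (wavesum p (S - Low) c z))\<^sup>2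
          \<le> 2 * (indicator E z * (cmod (wavesum p S c z))\<^sup>2) + 2 * (indicator E z * (cmod (wavesum p Low c z))\<^sup>2)" for z
          using cmod_diff_square_le[of "wavesum p S c z" "wavesum p Low c z"] by (simp add: eqS indicator_def)
      qed (intro integrable_energy_wavesum[OF E(1) bE] Bochner_Integration.integrable_add integrable_mult_right)+
      also have "\<dots> = 2 * Q + 2 * energy_on E (wavesum p Low c)"
        unfolding energy_on_def Q_def using integrable_energy_wavesum[OF E(1) bE] by simp
      also have "energy_on E (wavesum p Low c) \<le> \<mu> * card Low * (\<Sum>k\<in>Low. (cmod (c k))\<^sup>2)"
        unfolding \<mu>_def by (rule energy_on_wavesum_le[OF E(1) bE Low(1)])
      also have "\<dots> \<le> \<mu> * card Low * (C\<^sub>1 * Q)"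
        using low \<mu> by (intro mult_left_mono) auto
      finally have "\<mu> / 2 * (\<Sum>k\<in>S - Low. (cmod (c k))\<^sup>2) \<le> \<mu> / 2 * (C\<^sub>2 * Q)"
        using \<mu> by (simp add: C\<^sub>2_def algebra_simps)
      then show ?thesis using \<mu> by simp
    qed
    have "(\<Sum>k\<in>S. (cmod (c k))\<^sup>2) = (\<Sum>k\<in>Low. (cmod (c k))\<^sup>2) + (\<Sum>k\<in>S - Low. (cmod (c k))\<^sup>2)"
      using S by (simp add: sum.subset_diff add.commute)
    then show ?thesis
      using low high' by (simp add: Q_def algebra_simps)
  qed
  show ?thesis
  proof (rule that[of "1 / (C\<^sub>1 + C\<^sub>2)"])
    fix S :: "int set" and c :: "int \<Rightarrow> complex" assume S: "finite S"
    \<comment> \<open>Padding by 0 produces an index set that contains all low frequencies, as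
      \<open>main\<close> requires.\<close>
    let ?c = "\<lambda>k. if k \<in> S then c k else 0"
    have "(\<Sum>k\<in>S. (cmod (c k))\<^sup>2) = (\<Sum>k\<in>S \<union> Low. (cmod (?c k))\<^sup>2)"
      using S Low by (intro sum.mono_neutral_cong_left) auto
    also have "\<dots> \<le> (C\<^sub>1 + C\<^sub>2) * energy_on E (wavesum p (S \<union> Low) ?c)"
      using S Low by (intro main) auto
    also have "wavesum p (S \<union> Low) ?c = wavesum p S c"
      unfolding wavesum_def using S Low by (intro ext sum.mono_neutral_cong_right) auto
    finally show "1 / (C\<^sub>1 + C\<^sub>2) * (\<Sum>k\<in>S. (cmod (c k))\<^sup>2) \<le> energy_on E (wavesum p S c)"
      using C by (simp add: field_simps)
  qed (use C in simp)
qed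

section \<open>Mixed norms and observability for rough weights\<close>

lemma sigma_finite_time:
  assumes "I \<in> sets borel"
  shows "sigma_finite_measure (time I)"
  using assms by (intro sigma_finite_measure_restrict_space sigma_finite_lborel) auto

lemma measurable_slab_section:
  assumes "I \<in> sets borel" "f \<in> borel_measurable (slab I)" "x \<in> space torus"
  shows "(\<lambda>t. f (t, x)) \<in> borel_measurable (time I)"
proof -
  have "f \<in> borel_measurable (time I \<Otimes>\<^sub>M torus)"
    using assms by (simp add: time_torus_eq_slab)
  then show ?thesis
    by (rule measurable_compose[OF measurable_Pair2'[OF assms(3)]])
qed

lemma nn_integral_slab:
  assumes I: "I \<in> sets borel" and f: "f \<in> borel_measurable (slab I)"
  shows "(\<integral>\<^sup>+ z. f z \<partial>slab I) = (\<integral>\<^sup>+ x. \<integral>\<^sup>+ t. f (t, x) \<partial>time I \<partial>torus)"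
    and "(\<integral>\<^sup>+ z. f z \<partial>slab I) = (\<integral>\<^sup>+ t. \<integral>\<^sup>+ x. f (t, x) \<partial>torus \<partial>time I)"
proof -
  interpret T: sigma_finite_measure "time I" by (rule sigma_finite_time[OF I])
  interpret P: pair_sigma_finite "time I" torus ..
  note eq = time_torus_eq_slab[OF I]
  show "(\<integral>\<^sup>+ z. f z \<partial>slab I) = (\<integral>\<^sup>+ x. \<integral>\<^sup>+ t. f (t, x) \<partial>time I \<partial>torus)"
    using P.nn_integral_snd[of f] f by (simp add: eq)
  show "(\<integral>\<^sup>+ z. f z \<partial>slab I) = (\<integral>\<^sup>+ t. \<integral>\<^sup>+ x. f (t, x) \<partial>torus \<partial>time I)"
    using torus.nn_integral_fst[of f "time I"] f by (simp add: eq)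
qed

lemma measurable_nn_integral_slab:
  assumes I: "I \<in> sets borel" and f: "f \<in> borel_measurable (slab I)"
  shows "(\<lambda>x. \<integral>\<^sup>+ t. f (t, x) \<partial>time I) \<in> borel_measurable torus"
    and "(\<lambda>t. \<integral>\<^sup>+ x. f (t, x) \<partial>torus) \<in> borel_measurable (time I)"
proof -
  interpret T: sigma_finite_measure "time I" by (rule sigma_finite_time[OF I])
  have f': "f \<in> borel_measurable (time I \<Otimes>\<^sub>M torus)"
    using f by (simp add: time_torus_eq_slab[OF I])
  show "(\<lambda>t. \<integral>\<^sup>+ x. f (t, x) \<partial>torus) \<in> borel_measurable (time I)"
    using f' by measurable
  have "(\<lambda>(x, t). f (t, x)) \<in> borel_measurable (torus \<Otimes>\<^sub>M time I)"
    using measurable_pair_swap[OF f'] by (simp add: split_beta')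
  then show "(\<lambda>x. \<integral>\<^sup>+ t. f (t, x) \<partial>time I) \<in> borel_measurable torus"
    by (rule T.borel_measurable_nn_integral)
qed

definition linft_t :: "real set \<Rightarrow> (real \<Rightarrow> real \<Rightarrow> real) \<Rightarrow> real \<Rightarrow> ennreal" where
  "linft_t I f x = esssup (time I) (\<lambda>t. ennreal \<bar>f t x\<bar>)"

lemma norm_L1x_Linft_eq: "norm_L1x_Linft I f = (\<integral>\<^sup>+ x. linft_t I f x \<partial>torus)"
  by (simp add: norm_L1x_Linft_def linft_t_def)

text \<open>The essential supremum over t is at most y exactly when the times with value above y
  form a null set. The measure of these times is an integral over t, so it is measurable in x by
  Tonelli.\<close>

lemma measurable_linft_t:
  assumes I: "I \<in> sets borel" and f: "(\<lambda>(t, x). f t x) \<in> borel_measurable (slab I)"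
  shows "linft_t I f \<in> borel_measurable torus"
proof (rule borel_measurableI_le)
  fix y :: ennreal
  have meas: "(\<lambda>t. ennreal \<bar>f t x\<bar>) \<in> borel_measurable (time I)" if "x \<in> space torus" for x
    using measurable_slab_section[OF I f that] by simp
  have "linft_t I f x \<le> y \<longleftrightarrow> (\<integral>\<^sup>+ t. indicator {z \<in> space (slab I). y < ennreal \<bar>case z of (t, x) \<Rightarrow> f t x\<bar>} (t, x) \<partial>time I) = 0"
    if x: "x \<in> space torus" for x
  proof -
    have "linft_t I f x \<le> y \<longleftrightarrow> (AE t in time I. ennreal \<bar>f t x\<bar> \<le> y)"
    proof
      assume "linft_t I f x \<le> y"
      then show "AE t in time I. ennreal \<bar>f t x\<bar> \<le> y"
        using esssup_AE[of "\<lambda>t. ennreal \<bar>f t x\<bar>" "time I"] unfolding linft_t_def by (auto elim: eventually_mono)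
    next
      assume "AE t in time I. ennreal \<bar>f t x\<bar> \<le> y"
      then show "linft_t I f x \<le> y"
        unfolding linft_t_def by (rule esssup_I[OF meas[OF x]])
    qed
    also have "\<dots> \<longleftrightarrow> (\<integral>\<^sup>+ t. indicator {t \<in> space (time I). \<not> ennreal \<bar>f t x\<bar> \<le> y} t \<partial>time I) = 0"
      using meas[OF x] by (subst AE_iff_measurable[OF _ refl]) (auto simp: nn_integral_indicator)
    also have "(\<integral>\<^sup>+ t. indicator {t \<in> space (time I). \<not> ennreal \<bar>f t x\<bar> \<le> y} t \<partial>time I) =
      (\<integral>\<^sup>+ t. indicator {z \<in> space (slab I). y < ennreal \<bar>case z of (t, x) \<Rightarrow> f t x\<bar>} (t, x) \<partial>time I)"
      using x by (intro nn_integral_cong) (auto simp: indicator_def space_restrict_space not_le)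
    finally show ?thesis .
  qed
  then have "{x \<in> space torus. linft_t I f x \<le> y} = {x \<in> space torus.
     (\<integral>\<^sup>+ t. indicator {z \<in> space (slab I). y < ennreal \<bar>case z of (t, x) \<Rightarrow> f t x\<bar>} (t, x) \<partial>time I) = 0}"
    by auto
  also have "\<dots> \<in> sets torus"
  proof -
    have "(\<lambda>z. ennreal \<bar>case z of (t, x) \<Rightarrow> f t x\<bar>) \<in> borel_measurable (slab I)"
      using f by measurable
    then have [measurable]: "{z \<in> space (slab I). y < ennreal \<bar>case z of (t, x) \<Rightarrow> f t x\<bar>} \<in> sets (slab I)"
      by measurable
    have [measurable]: "(\<lambda>x. \<integral>\<^sup>+ t. indicator {z \<in> space (slab I). y < ennreal \<bar>case z of (t, x) \<Rightarrow> f t x\<bar>} (t, x) \<partial>time I) \<in> borel_measurable torus"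
      by (rule measurable_nn_integral_slab(1)[OF I]) measurable
    show ?thesis by measurable
  qed
  finally show "{x \<in> space torus. linft_t I f x \<le> y} \<in> sets torus" .
qed

lemma AE_linft_t: "AE t in time I. ennreal \<bar>f t x\<bar> \<le> linft_t I f x"
  unfolding linft_t_def by (rule esssup_AE)

lemma L1x_Linft_measurable:
  assumes "f \<in> L1x_Linft I" "I \<in> sets borel"
  shows "(\<lambda>(t, x). f t x) \<in> borel_measurable (slab I)"
  using assms by (simp add: L1x_Linft_def time_torus_eq_slab)

text \<open>Hoelder's inequality, in t for fixed x and then in x. With g the square of a function in
  L^inf_x L^2_t it makes a |u|^2 integrable over space-time, although \<open>a\<close> is
  unbounded.\<close>

lemma holder_L1x_Linft:
  assumes I: "I \<in> sets borel" and f: "(\<lambda>(t, x). f t x) \<in> borel_measurable (slab I)"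
    and g: "g \<in> borel_measurable (slab I)"
    and K: "AE x in torus. (\<integral>\<^sup>+ t. g (t, x) \<partial>time I) \<le> K"
  shows "(\<integral>\<^sup>+ z. ennreal \<bar>f (fst z) (snd z)\<bar> * g z \<partial>slab I) \<le> norm_L1x_Linft I f * K"
proof -
  have f': "(\<lambda>z. f (fst z) (snd z)) \<in> borel_measurable (slab I)"
    using f by (simp add: split_beta')
  have "(\<integral>\<^sup>+ z. ennreal \<bar>f (fst z) (snd z)\<bar> * g z \<partial>slab I) =
      (\<integral>\<^sup>+ x. \<integral>\<^sup>+ t. ennreal \<bar>f t x\<bar> * g (t, x) \<partial>time I \<partial>torus)"
    using f' g by (subst nn_integral_slab(1)[OF I]) auto
  also have "\<dots> \<le> (\<integral>\<^sup>+ x. linft_t I f x * K \<partial>torus)"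
  proof (rule nn_integral_mono_AE)
    show "AE x in torus. (\<integral>\<^sup>+ t. ennreal \<bar>f t x\<bar> * g (t, x) \<partial>time I) \<le> linft_t I f x * K"
      using K AE_space
    proof eventually_elim
      case (elim x)
      note [measurable] = measurable_slab_section[OF I g elim(2)]
      have "(\<integral>\<^sup>+ t. ennreal \<bar>f t x\<bar> * g (t, x) \<partial>time I) \<le> (\<integral>\<^sup>+ t. linft_t I f x * g (t, x) \<partial>time I)"
        by (intro nn_integral_mono_AE eventually_mono[OF AE_linft_t[where I = I and f = f and x = x]] mult_right_mono) auto
      also have "\<dots> = linft_t I f x * (\<integral>\<^sup>+ t. g (t, x) \<partial>time I)"
        by (rule nn_integral_cmult) measurable
      also have "\<dots> \<le> linft_t I f x * K"
        using elim by (intro mult_left_mono) auto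
      finally show ?case .
    qed
  qed
  also have "\<dots> = norm_L1x_Linft I f * K"
    unfolding norm_L1x_Linft_eq by (rule nn_integral_multc[OF measurable_linft_t[OF I f]])
  finally show ?thesis .
qed

lemma norm_L1x_Linft_triangle:
  assumes I: "I \<in> sets borel" and f: "(\<lambda>(t, x). f t x) \<in> borel_measurable (slab I)"
    and g: "(\<lambda>(t, x). g t x) \<in> borel_measurable (slab I)"
  shows "norm_L1x_Linft I f \<le> norm_L1x_Linft I g + norm_L1x_Linft I (\<lambda>t x. f t x - g t x)"
proof -
  have fg: "(\<lambda>(t, x). f t x - g t x) \<in> borel_measurable (slab I)"
    using borel_measurable_diff[OF f g] by (simp add: split_beta')
  have "norm_L1x_Linft I f \<le> (\<integral>\<^sup>+ x. linft_t I g x + linft_t I (\<lambda>t x. f t x - g t x) x \<partial>torus)"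
    unfolding norm_L1x_Linft_eq
  proof (rule nn_integral_mono)
    fix x assume x: "x \<in> space torus"
    have "(\<lambda>t. ennreal \<bar>f t x\<bar>) \<in> borel_measurable (time I)"
      using measurable_slab_section[OF I f x] by simp
    then show "linft_t I f x \<le> linft_t I g x + linft_t I (\<lambda>t x. f t x - g t x) x"
      unfolding linft_t_def[of I f]
    proof (rule esssup_I)
      show "AE t in time I. ennreal \<bar>f t x\<bar> \<le> linft_t I g x + linft_t I (\<lambda>t x. f t x - g t x) x"
        using AE_linft_t[where I = I and f = g and x = x] AE_linft_t[where I = I and f = "\<lambda>t x. f t x - g t x" and x = x]
      proof eventually_elim
        case (elim t)
        have "ennreal \<bar>f t x\<bar> \<le> ennreal (\<bar>g t x\<bar> + \<bar>f t x - g t x\<bar>)" by (intro ennreal_leI) auto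
        also have "\<dots> = ennreal \<bar>g t x\<bar> + ennreal \<bar>f t x - g t x\<bar>" by (rule ennreal_plus) auto
        also have "\<dots> \<le> linft_t I g x + linft_t I (\<lambda>t x. f t x - g t x) x" by (intro add_mono elim)
        finally show ?case .
      qed
    qed
  qed
  also have "\<dots> = norm_L1x_Linft I g + norm_L1x_Linft I (\<lambda>t x. f t x - g t x)"
    unfolding norm_L1x_Linft_eq by (intro nn_integral_add measurable_linft_t I fg g)
  finally show ?thesis .
qed

text \<open>Waves with the same value of p(k) are merged into one term. Distinct values give
  exponentials that are orthogonal in t over whole periods, and Cauchy-Schwarz inside a group costs
  its size, at most \<open>degree p\<close>. The bound holds at every x.\<close>

lemma strichartz_wavesum:
  fixes p :: "int poly"
  assumes p: "degree p > 0" and S: "finite S"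
  shows "(\<integral>\<^sup>+ t. ennreal ((cmod (wavesum p S c (t, x)))\<^sup>2) \<partial>time {0..<2 * pi * real m})
    \<le> ennreal (2 * pi * m * degree p * (\<Sum>k\<in>S. (cmod (c k))\<^sup>2))"
proof -
  let ?I = "{0..<2 * pi * real m}"
  let ?e = "\<lambda>n t. cis (of_int n * t)"
  have "bounded ?I" by (rule bounded_subset[OF bounded_cbox[of 0 "2 * pi * real m"]]) auto
  then have fin: "finite_measure (time ?I)" by (intro finite_measure_time) auto
  define A where "A n = (\<Sum>k\<in>{k \<in> S. poly p k = n}. c k * mode k x)" for n
  have eq: "wavesum p S c (t, x) = (\<Sum>n\<in>poly p ` S. A n * ?e n t)" for t
  proof -
    have "wavesum p S c (t, x) = (\<Sum>n\<in>poly p ` S. \<Sum>k\<in>{k \<in> S. poly p k = n}. c k * wave p k (t, x))"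
      unfolding wavesum_def by (rule sum.image_gen[OF S])
    also have "\<dots> = (\<Sum>n\<in>poly p ` S. A n * ?e n t)"
      unfolding A_def sum_distrib_right
      by (intro sum.cong refl) (auto simp: wave_def mode_def cis_mult)
    finally show ?thesis .
  qed
  have meas: "(\<lambda>t. cis (of_int n * t)) \<in> borel_measurable (time ?I)" for n :: int
    by (intro measurable_restrict_space1) (simp add: borel_measurable_continuous_onI continuous_intros)
  have orth: "(LINT t|time ?I. ?e i t * cnj (?e j t)) = (if i = j then of_real (2 * pi * m) else 0)" for i j
  proof -
    have "?e i t * cnj (?e j t) = cis (of_int (i - j) * t)" for t
      by (simp add: cis_cnj cis_mult algebra_simps)
    then show ?thesis using integral_cis_multiples_of_period[of m "i - j"] by simp
  qed
  note * = integral_cmod_square_diff_orthogonal_sum[OF fin, of "poly p ` S" ?e "\<lambda>_. 0" "2 * pi * m" A]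
  have int: "integrable (time ?I) (\<lambda>t. (cmod (wavesum p S c (t, x)))\<^sup>2)"
    and val: "(LINT t|time ?I. (cmod (wavesum p S c (t, x)))\<^sup>2) = 2 * pi * m * (\<Sum>n\<in>poly p ` S. (cmod (A n))\<^sup>2)"
    using * S meas orth by (simp_all add: eq)
  have "(\<Sum>n\<in>poly p ` S. (cmod (A n))\<^sup>2) \<le> (\<Sum>n\<in>poly p ` S. degree p * (\<Sum>k\<in>{k \<in> S. poly p k = n}. (cmod (c k))\<^sup>2))"
  proof (rule sum_mono)
    fix n
    let ?S = "{k \<in> S. poly p k = n}"
    have "card ?S \<le> card {k. poly p k = n}"
      using card_poly_fibre_le(1)[OF p] by (intro card_mono) auto
    then have card: "card ?S \<le> degree p" using card_poly_fibre_le(2)[OF p, of n] by linarith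
    have "(cmod (A n))\<^sup>2 \<le> (\<Sum>k\<in>?S. cmod (c k))\<^sup>2"
      unfolding A_def by (intro power_mono order_trans[OF norm_sum]) (auto simp: norm_mult)
    also have "\<dots> \<le> card ?S * (\<Sum>k\<in>?S. (cmod (c k))\<^sup>2)"
      using Cauchy_Schwarz_ineq_sum[of "\<lambda>_. 1" "\<lambda>k. cmod (c k)" ?S] by simp
    also have "\<dots> \<le> degree p * (\<Sum>k\<in>?S. (cmod (c k))\<^sup>2)"
      using card by (intro mult_right_mono sum_nonneg) auto
    finally show "(cmod (A n))\<^sup>2 \<le> degree p * (\<Sum>k\<in>?S. (cmod (c k))\<^sup>2)" .
  qed
  also have "\<dots> = degree p * (\<Sum>k\<in>S. (cmod (c k))\<^sup>2)"
    by (simp add: sum_distrib_left[symmetric] sum.image_gen[OF S, of _ "poly p", symmetric])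
  finally have "(LINT t|time ?I. (cmod (wavesum p S c (t, x)))\<^sup>2) \<le> 2 * pi * m * degree p * (\<Sum>k\<in>S. (cmod (c k))\<^sup>2)"
    unfolding val by (simp add: mult.assoc mult_left_mono)
  then show ?thesis
    by (subst nn_integral_eq_integral[OF int]) (auto intro: ennreal_leI)
qed

text \<open>The window \<open>[0, T]\<close> is enlarged to m whole periods to make orthogonality in
  t available.\<close>

lemma strichartz_weighted:
  fixes p :: "int poly"
  assumes p: "degree p > 0" and S: "finite S" and T: "T < 2 * pi * real m"
    and f: "(\<lambda>(t, x). f t x) \<in> borel_measurable (slab {0..T})"
  shows "(\<integral>\<^sup>+ z. ennreal \<bar>f (fst z) (snd z)\<bar> * ennreal ((cmod (wavesum p S c z))\<^sup>2) \<partial>slab {0..T})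
    \<le> norm_L1x_Linft {0..T} f * ennreal (2 * pi * m * degree p * (\<Sum>k\<in>S. (cmod (c k))\<^sup>2))"
proof (rule holder_L1x_Linft[OF _ f])
  show "AE x in torus. (\<integral>\<^sup>+ t. ennreal ((cmod (wavesum p S c (t, x)))\<^sup>2) \<partial>time {0..T})
      \<le> ennreal (2 * pi * m * degree p * (\<Sum>k\<in>S. (cmod (c k))\<^sup>2))"
  proof (rule AE_I2)
    fix x
    have "(\<integral>\<^sup>+ t. ennreal ((cmod (wavesum p S c (t, x)))\<^sup>2) \<partial>time {0..T})
      \<le> (\<integral>\<^sup>+ t. ennreal ((cmod (wavesum p S c (t, x)))\<^sup>2) \<partial>time {0..<2 * pi * real m})"
      using T by (subst (1 2) nn_integral_restrict_space) (auto intro!: nn_integral_mono simp: indicator_def)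
    also have "\<dots> \<le> ennreal (2 * pi * m * degree p * (\<Sum>k\<in>S. (cmod (c k))\<^sup>2))"
      by (rule strichartz_wavesum[OF p S])
    finally show "(\<integral>\<^sup>+ t. ennreal ((cmod (wavesum p S c (t, x)))\<^sup>2) \<partial>time {0..T})
      \<le> ennreal (2 * pi * m * degree p * (\<Sum>k\<in>S. (cmod (c k))\<^sup>2))" .
  qed
qed measurable

text \<open>Some level set where |b| exceeds 1/(n + 1) has positive measure. The capped weight is at
  least 1/(n + 1) there, so observability from that set carries over.\<close>

lemma observability_nontrivial_weight:
  fixes p :: "int poly"
  assumes p: "degree p \<ge> 2" and T: "T < 2 * pi * real m" and m: "m > 0"
    and b: "(\<lambda>(t, x). b t x) \<in> borel_measurable (slab {0..T})" and nz: "norm_L1x_Linft {0..T} b \<noteq> 0"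
  obtains \<kappa> where "\<kappa> > 0" "\<And>S c. finite S \<Longrightarrow> ennreal (\<kappa> * (\<Sum>k\<in>S. (cmod (c k))\<^sup>2)) \<le>
    (\<integral>\<^sup>+ z. ennreal (min 1 \<bar>b (fst z) (snd z)\<bar>) * ennreal ((cmod (wavesum p S c z))\<^sup>2) \<partial>slab {0..T})"
proof -
  let ?M = "slab {0..T}" and ?I = "{0..T}"
  have b': "(\<lambda>z. b (fst z) (snd z)) \<in> borel_measurable ?M" using b by (simp add: split_beta')
  define E where "E n = {z \<in> space ?M. \<bar>b (fst z) (snd z)\<bar> > 1 / real (Suc n)}" for n
  have E_M: "E n \<in> sets ?M" for n unfolding E_def using b' by measurable
  have box: "{0..T} \<times> {0..<2 * pi} \<in> sets (borel :: (real \<times> real) measure)"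
    unfolding borel_prod[symmetric] by auto
  have E: "E n \<in> sets borel" "E n \<subseteq> {0..T} \<times> {0..<2 * pi}" for n
    using E_M[of n] box unfolding slab_def by (auto simp: sets_restrict_space_iff)
  have "\<exists>n. emeasure ?M (E n) \<noteq> 0"
  proof (rule ccontr)
    assume "\<nexists>n. emeasure ?M (E n) \<noteq> 0"
    then have "emeasure ?M (\<Union>n. E n) = 0" using E_M by (intro emeasure_UN_eq_0) auto
    moreover have UE: "(\<Union>n. E n) = {z \<in> space ?M. \<not> b (fst z) (snd z) = 0}"
    proof -
      have "\<exists>n. \<bar>y\<bar> > 1 / real (Suc n)" if "y \<noteq> 0" for y :: real
        using reals_Archimedean[of "\<bar>y\<bar>"] that by (auto simp: inverse_eq_divide)
      then show ?thesis by (fastforce simp: E_def)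
    qed
    moreover have "(\<Union>n. E n) \<in> sets ?M" using E_M by auto
    ultimately have "AE z in ?M. b (fst z) (snd z) = 0"
      unfolding UE by (subst AE_iff_measurable[OF _ refl]) auto
    \<comment> \<open>Null sets of the plane are passed to almost every vertical line by Tonelli,
      because the norm takes its essential supremum line by line.\<close>
    then have "(\<integral>\<^sup>+ z. ennreal \<bar>b (fst z) (snd z)\<bar> \<partial>?M) = 0"
      using b' by (subst nn_integral_0_iff_AE) auto
    then have "(\<integral>\<^sup>+ x. \<integral>\<^sup>+ t. ennreal \<bar>b t x\<bar> \<partial>time ?I \<partial>torus) = 0"
      using b' by (subst (asm) nn_integral_slab(1)) auto
    then have "AE x in torus. (\<integral>\<^sup>+ t. ennreal \<bar>b t x\<bar> \<partial>time ?I) = 0"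
      using measurable_nn_integral_slab(1)[of ?I "\<lambda>z. ennreal \<bar>b (fst z) (snd z)\<bar>"] b'
      by (subst (asm) nn_integral_0_iff_AE) auto
    then have "AE x in torus. linft_t ?I b x = 0"
      using AE_space
    proof eventually_elim
      case (elim x)
      have m: "(\<lambda>t. ennreal \<bar>b t x\<bar>) \<in> borel_measurable (time ?I)"
        using measurable_slab_section[OF _ b elim(2)] by simp
      then have "AE t in time ?I. ennreal \<bar>b t x\<bar> = 0"
        using elim(1) by (simp add: nn_integral_0_iff_AE)
      then have "linft_t ?I b x \<le> 0"
        unfolding linft_t_def by (intro esssup_I[OF m]) (auto elim: eventually_mono)
      then show ?case by simp
    qed
    then have "norm_L1x_Linft ?I b = 0"
      unfolding norm_L1x_Linft_eq using measurable_linft_t[OF _ b] by (subst nn_integral_0_iff_AE) auto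
    then show False using nz by simp
  qed
  then obtain n where n: "emeasure ?M (E n) \<noteq> 0" by blast
  have bE: "bounded (E n)"
    by (rule bounded_subset[OF bounded_cbox[of "(0, 0)" "(T, 2 * pi)"]]) (use E(2)[of n] in \<open>force simp: cbox_Pair_eq\<close>)
  have emE: "emeasure ?M (E n) = emeasure lborel (E n)"
    unfolding slab_def using box E(2) by (intro emeasure_restrict_space) auto
  then have pos: "measure lborel (E n) > 0"
    using n emeasure_bounded_finite[OF bE] by (simp add: measure_def enn2real_positive_iff zero_less_iff_neq_zero)
  have sub: "E n \<subseteq> {0..<2 * pi * real m} \<times> {0..<2 * pi}" using E(2)[of n] T by force
  obtain \<kappa> where \<kappa>: "\<kappa> > 0"
    "\<And>S c. finite S \<Longrightarrow> \<kappa> * (\<Sum>k\<in>S. (cmod (c k))\<^sup>2) \<le> energy_on (E n) (wavesum p S c)"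
    by (rule observability_wavesum[OF p E(1) sub m pos]) blast
  show ?thesis
  proof (rule that[of "\<kappa> / Suc n"])
    fix S :: "int set" and c :: "int \<Rightarrow> complex" assume S: "finite S"
    let ?V = "\<lambda>z. (cmod (wavesum p S c z))\<^sup>2"
    have "ennreal (\<kappa> / Suc n * (\<Sum>k\<in>S. (cmod (c k))\<^sup>2)) \<le> ennreal (1 / Suc n * energy_on (E n) (wavesum p S c))"
      using \<kappa>(2)[OF S, of c] by (intro ennreal_leI) (simp add: divide_right_mono)
    also have "\<dots> = ennreal (LINT z|lborel. 1 / Suc n * (indicator (E n) z * ?V z))"
      by (simp add: energy_on_def)
    also have "\<dots> = (\<integral>\<^sup>+ z. ennreal (1 / Suc n * (indicator (E n) z * ?V z)) \<partial>lborel)"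
      using integrable_energy_wavesum[OF E(1) bE, of p S c]
      by (intro nn_integral_eq_integral[symmetric] integrable_mult_right) auto
    also have "\<dots> = (\<integral>\<^sup>+ z. ennreal (1 / Suc n * (indicator (E n) z * ?V z)) \<partial>?M)"
      unfolding slab_def using box E(2)[of n]
      by (subst nn_integral_restrict_space) (auto intro!: nn_integral_cong split: split_indicator)
    also have "\<dots> \<le> (\<integral>\<^sup>+ z. ennreal (min 1 \<bar>b (fst z) (snd z)\<bar>) * ennreal (?V z) \<partial>?M)"
    proof (rule nn_integral_mono)
      fix z assume "z \<in> space ?M"
      have "1 / Suc n * (indicator (E n) z * ?V z) \<le> min 1 \<bar>b (fst z) (snd z)\<bar> * ?V z"
      proof (cases "z \<in> E n")
        case True
        then have "1 / Suc n \<le> min 1 \<bar>b (fst z) (snd z)\<bar>" by (auto simp: E_def)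
        then have "1 / Suc n * ?V z \<le> min 1 \<bar>b (fst z) (snd z)\<bar> * ?V z" by (rule mult_right_mono) simp
        moreover have "indicator (E n) z * ?V z = ?V z" using True by simp
        ultimately show ?thesis by (simp only:)
      qed auto
      then show "ennreal (1 / Suc n * (indicator (E n) z * ?V z)) \<le> ennreal (min 1 \<bar>b (fst z) (snd z)\<bar>) * ennreal (?V z)"
        by (simp add: ennreal_leI flip: ennreal_mult)
    qed
    finally show "ennreal (\<kappa> / Suc n * (\<Sum>k\<in>S. (cmod (c k))\<^sup>2)) \<le>
      (\<integral>\<^sup>+ z. ennreal (min 1 \<bar>b (fst z) (snd z)\<bar>) * ennreal (?V z) \<partial>?M)" .
  qed (use \<kappa> in simp)
qed

text \<open>The cap \<open>min 1\<close> is 1-Lipschitz, so replacing b by a costs at most the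
  integral of |a - b| against the squared wave. The weighted space-time estimate bounds it by a
  multiple of the energy of the coefficients.\<close>

theorem observability_stable:
  fixes p :: "int poly"
  assumes p: "degree p \<ge> 2" and T: "T < 2 * pi * real m" and m: "m > 0"
    and b: "(\<lambda>(t, x). b t x) \<in> borel_measurable (slab {0..T})" and nz: "norm_L1x_Linft {0..T} b \<noteq> 0"
  obtains \<kappa> r where "\<kappa> > 0" "r > 0"
    "\<And>a S c. (\<lambda>(t, x). a t x) \<in> borel_measurable (slab {0..T}) \<Longrightarrow>
      norm_L1x_Linft {0..T} (\<lambda>t x. a t x - b t x) \<le> ennreal r \<Longrightarrow> finite S \<Longrightarrow>
      ennreal (\<kappa> * (\<Sum>k\<in>S. (cmod (c k))\<^sup>2)) \<le>
      (\<integral>\<^sup>+ z. ennreal (min 1 \<bar>a (fst z) (snd z)\<bar>) * ennreal ((cmod (wavesum p S c z))\<^sup>2) \<partial>slab {0..T})"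
proof -
  let ?M = "slab {0..T}"
  obtain \<kappa> where \<kappa>: "\<kappa> > 0" "\<And>S c. finite S \<Longrightarrow> ennreal (\<kappa> * (\<Sum>k\<in>S. (cmod (c k))\<^sup>2)) \<le>
    (\<integral>\<^sup>+ z. ennreal (min 1 \<bar>b (fst z) (snd z)\<bar>) * ennreal ((cmod (wavesum p S c z))\<^sup>2) \<partial>?M)"
    by (rule observability_nontrivial_weight[OF p T m b nz]) blast
  define K where "K = 2 * pi * m * degree p"
  have K: "K > 0" using m p by (simp add: K_def)
  \<comment> \<open>Chosen so that the perturbation eats exactly half of \<kappa>.\<close>
  define r where "r = \<kappa> / (2 * K)"
  show ?thesis
  proof (rule that[of "\<kappa> / 2" r])
    fix a and S :: "int set" and c :: "int \<Rightarrow> complex"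
    assume a: "(\<lambda>(t, x). a t x) \<in> borel_measurable ?M" and S: "finite S"
      and close: "norm_L1x_Linft {0..T} (\<lambda>t x. a t x - b t x) \<le> ennreal r"
    let ?c = "\<Sum>k\<in>S. (cmod (c k))\<^sup>2" and ?V = "\<lambda>z. ennreal ((cmod (wavesum p S c z))\<^sup>2)"
    have c0: "?c \<ge> 0" by (simp add: sum_nonneg)
    have ab: "(\<lambda>(t, x). a t x - b t x) \<in> borel_measurable ?M"
      using borel_measurable_diff[OF a b] by (simp add: split_beta')
    note [measurable] = a[unfolded split_beta'] b[unfolded split_beta']
    have "ennreal (\<kappa> / 2 * ?c) + ennreal (\<kappa> / 2 * ?c) = ennreal (\<kappa> * ?c)"
      using \<kappa>(1) c0 by (subst ennreal_plus[symmetric]) auto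
    also have "\<dots> \<le> (\<integral>\<^sup>+ z. ennreal (min 1 \<bar>b (fst z) (snd z)\<bar>) * ?V z \<partial>?M)"
      by (rule \<kappa>(2)[OF S])
    also have "\<dots> \<le> (\<integral>\<^sup>+ z. ennreal (min 1 \<bar>a (fst z) (snd z)\<bar>) * ?V z +
        ennreal \<bar>a (fst z) (snd z) - b (fst z) (snd z)\<bar> * ?V z \<partial>?M)"
    proof (rule nn_integral_mono)
      fix z
      have "ennreal (min 1 \<bar>b (fst z) (snd z)\<bar>) \<le> ennreal (min 1 \<bar>a (fst z) (snd z)\<bar> + \<bar>a (fst z) (snd z) - b (fst z) (snd z)\<bar>)"
        by (intro ennreal_leI) auto
      also have "\<dots> = ennreal (min 1 \<bar>a (fst z) (snd z)\<bar>) + ennreal \<bar>a (fst z) (snd z) - b (fst z) (snd z)\<bar>"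
        by (rule ennreal_plus) auto
      finally show "ennreal (min 1 \<bar>b (fst z) (snd z)\<bar>) * ?V z \<le>
        ennreal (min 1 \<bar>a (fst z) (snd z)\<bar>) * ?V z + ennreal \<bar>a (fst z) (snd z) - b (fst z) (snd z)\<bar> * ?V z"
        by (simp add: mult_right_mono flip: distrib_right)
    qed
    also have "\<dots> = (\<integral>\<^sup>+ z. ennreal (min 1 \<bar>a (fst z) (snd z)\<bar>) * ?V z \<partial>?M) +
        (\<integral>\<^sup>+ z. ennreal \<bar>a (fst z) (snd z) - b (fst z) (snd z)\<bar> * ?V z \<partial>?M)"
      by (rule nn_integral_add) measurable
    also have "(\<integral>\<^sup>+ z. ennreal \<bar>a (fst z) (snd z) - b (fst z) (snd z)\<bar> * ?V z \<partial>?M) \<le>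
       norm_L1x_Linft {0..T} (\<lambda>t x. a t x - b t x) * ennreal (K * ?c)"
      unfolding K_def by (rule strichartz_weighted[OF _ S T ab]) (use p in simp)
    also have "\<dots> \<le> ennreal r * ennreal (K * ?c)"
      by (intro mult_right_mono close) auto
    also have "\<dots> = ennreal (\<kappa> / 2 * ?c)"
      using K \<kappa>(1) c0 by (subst ennreal_mult[symmetric]) (auto simp: r_def)
    finally show "ennreal (\<kappa> / 2 * ?c) \<le> (\<integral>\<^sup>+ z. ennreal (min 1 \<bar>a (fst z) (snd z)\<bar>) * ?V z \<partial>?M)"
      by (auto simp: ennreal_add_left_cancel_le add.commute[of _ "ennreal (\<kappa> / 2 * ?c)"])
  qed (use \<kappa> K in \<open>auto simp: r_def\<close>)
qed

section \<open>Fejer means\<close>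

text \<open>The integrated form of (|F|^2)' = 2 Re (F' conj F), for a primitive F of a merely
  integrable function. The product f(s) conj f(r) is integrated over the plane and split along the
  diagonal.\<close>

lemma cmod_square_integral_eq:
  fixes f :: "real \<Rightarrow> complex"
  assumes f: "integrable lborel f"
  shows "integrable lborel (\<lambda>s. f s * cnj (LINT r|lborel. indicator {..s} r *\<^sub>R f r))"
    and "(cmod (LINT s|lborel. f s))\<^sup>2 = 2 * Re (LINT s|lborel. f s * cnj (LINT r|lborel. indicator {..s} r *\<^sub>R f r))"
proof -
  have fm [measurable]: "f \<in> borel_measurable lborel" using f by auto
  define H where "H z = f (fst z) * cnj (f (snd z))" for z
  have H: "integrable (lborel \<Otimes>\<^sub>M lborel) H"
  proof (rule lborel_pair.Fubini_integrable)
    show "H \<in> borel_measurable (lborel \<Otimes>\<^sub>M lborel)" unfolding H_def by measurable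
    have "(\<lambda>s. LINT r|lborel. norm (H (s, r))) = (\<lambda>s. cmod (f s) * (LINT r|lborel. cmod (f r)))"
      by (simp add: H_def norm_mult)
    then show "integrable lborel (\<lambda>s. LINT r|lborel. norm (H (s, r)))" using f by simp
    show "AE s in lborel. integrable lborel (\<lambda>r. H (s, r))"
      using f by (simp add: H_def)
  qed
  define L where "L = {z :: real \<times> real. snd z \<le> fst z}"
  have Lm [measurable]: "L \<in> sets (lborel \<Otimes>\<^sub>M lborel)"
  proof -
    have "{z \<in> space (lborel \<Otimes>\<^sub>M lborel). snd z \<le> fst (z :: real \<times> real)} \<in> sets (lborel \<Otimes>\<^sub>M lborel)"
      by measurable
    then show ?thesis by (simp add: L_def space_pair_measure)
  qed
  have HL: "integrable (lborel \<Otimes>\<^sub>M lborel) (\<lambda>z. indicator L z *\<^sub>R H z)"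
    using H by (rule integrable_mult_indicator[rotated]) measurable
  have HU: "integrable (lborel \<Otimes>\<^sub>M lborel) (\<lambda>z. indicator (- L) z *\<^sub>R H z)"
  proof -
    have "- L = space (lborel \<Otimes>\<^sub>M lborel) - L" by (auto simp: space_pair_measure)
    then have "- L \<in> sets (lborel \<Otimes>\<^sub>M lborel)" using sets.Diff[OF sets.top Lm] by (simp only:)
    then show ?thesis using H by (rule integrable_mult_indicator)
  qed
  define g where "g s = (LINT r|lborel. indicator {..s} r *\<^sub>R f r)" for s
  have low: "(LINT r|lborel. indicator L (s, r) *\<^sub>R H (s, r)) = f s * cnj (g s)" for s
  proof -
    have "(LINT r|lborel. indicator L (s, r) *\<^sub>R H (s, r)) = (LINT r|lborel. f s * cnj (indicator {..s} r *\<^sub>R f r))"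
      by (intro Bochner_Integration.integral_cong refl) (auto simp: L_def H_def indicator_def)
    also have "\<dots> = f s * cnj (g s)"
      by (simp add: g_def del: complex_cnj_scaleR)
    finally show ?thesis .
  qed
  \<comment> \<open>Exchanging the variables conjugates H, so the upper triangle contributes the
    conjugate of the lower one; the diagonal is a null set.\<close>
  have up: "(LINT s|lborel. indicator (- L) (s, r) *\<^sub>R H (s, r)) = cnj (f r * cnj (g r))" for r
  proof -
    have "(LINT s|lborel. indicator (- L) (s, r) *\<^sub>R H (s, r)) = (LINT s|lborel. cnj (f r) * (indicator {..r} s *\<^sub>R f s))"
    proof (rule integral_cong_AE)
      have "AE s in lborel. s \<noteq> r" by (rule AE_lborel_singleton)
      then show "AE s in lborel. indicator (- L) (s, r) *\<^sub>R H (s, r) = cnj (f r) * (indicator {..r} s *\<^sub>R f s)"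
        by eventually_elim (auto simp: L_def H_def indicator_def)
    qed (auto simp: H_def L_def)
    also have "\<dots> = cnj (f r * cnj (g r))"
      unfolding g_def by (subst integral_mult_right_zero) simp
    finally show ?thesis .
  qed
  show int: "integrable lborel (\<lambda>s. f s * cnj (LINT r|lborel. indicator {..s} r *\<^sub>R f r))"
    using lborel_pair.integrable_fst'[OF HL] unfolding low g_def .
  have "complex_of_real ((cmod (LINT s|lborel. f s))\<^sup>2) = (LINT s|lborel. f s) * cnj (LINT r|lborel. f r)"
    by (rule complex_norm_square)
  also have "\<dots> = (LINT s|lborel. LINT r|lborel. H (s, r))"
    by (simp add: H_def flip: integral_cnj)
  also have "\<dots> = integral\<^sup>L (lborel \<Otimes>\<^sub>M lborel) H"
    by (rule lborel_pair.integral_fst'[OF H])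
  also have "\<dots> = integral\<^sup>L (lborel \<Otimes>\<^sub>M lborel) (\<lambda>z. indicator L z *\<^sub>R H z + indicator (- L) z *\<^sub>R H z)"
    by (intro Bochner_Integration.integral_cong refl) (auto simp: indicator_def)
  also have "\<dots> = integral\<^sup>L (lborel \<Otimes>\<^sub>M lborel) (\<lambda>z. indicator L z *\<^sub>R H z) + integral\<^sup>L (lborel \<Otimes>\<^sub>M lborel) (\<lambda>z. indicator (- L) z *\<^sub>R H z)"
    by (rule Bochner_Integration.integral_add[OF HL HU])
  also have "integral\<^sup>L (lborel \<Otimes>\<^sub>M lborel) (\<lambda>z. indicator L z *\<^sub>R H z) = (LINT s|lborel. f s * cnj (g s))"
    using lborel_pair.integral_fst'[OF HL] by (simp only: low)
  also have "integral\<^sup>L (lborel \<Otimes>\<^sub>M lborel) (\<lambda>z. indicator (- L) z *\<^sub>R H z) = (LINT r|lborel. cnj (f r * cnj (g r)))"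
    using lborel_pair.integral_snd[of "\<lambda>s r. indicator (- L) (s, r) *\<^sub>R H (s, r)"] HU by (simp only: up split_beta' prod.collapse)
  also have "\<dots> = cnj (LINT s|lborel. f s * cnj (g s))" by (rule Bochner_Integration.integral_cnj)
  finally have "(cmod (LINT s|lborel. f s))\<^sup>2 = Re ((LINT s|lborel. f s * cnj (g s)) + cnj (LINT s|lborel. f s * cnj (g s)))"
    by (metis Re_complex_of_real)
  then show "(cmod (LINT s|lborel. f s))\<^sup>2 = 2 * Re (LINT s|lborel. f s * cnj (LINT r|lborel. indicator {..s} r *\<^sub>R f r))"
    by (simp add: g_def)
qed

section \<open>The Fejer kernel and convergence of Fejer means\<close>

definition fejer :: "nat \<Rightarrow> int \<Rightarrow> real" where
  "fejer N k = 1 - \<bar>real_of_int k\<bar> / (real N + 1)"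

lemma fejer_bounds: "k \<in> {- int N..int N} \<Longrightarrow> 0 \<le> fejer N k" "fejer N k \<le> 1"
  by (auto simp: fejer_def divide_le_eq)

lemma sum_symmetric_int_interval:
  fixes g :: "int \<Rightarrow> 'a::comm_monoid_add"
  shows "(\<Sum>k\<in>{- int (Suc N)..int (Suc N)}. g k) = (\<Sum>k\<in>{- int N..int N}. g k) + (g (int (Suc N)) + g (- int (Suc N)))"
proof -
  have "{- int (Suc N)..int (Suc N)} = insert (int (Suc N)) (insert (- int (Suc N)) {- int N..int N})"
    by auto
  then show ?thesis by (simp add: ac_simps)
qed

text \<open>A difference k comes from N + 1 - |k| pairs. Passing from N to N + 1 adds one row and
  one column of pairs, in which each difference from -(N + 1) to N + 1 occurs exactly once.\<close>

lemma sum_differences: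
  fixes g :: "int \<Rightarrow> complex"
  shows "(\<Sum>i\<le>N. \<Sum>j\<le>N. g (int i - int j)) = (\<Sum>k\<in>{- int N..int N}. of_real ((real N + 1) * fejer N k) * g k)"
proof -
  have w: "(real N + 1) * fejer N k = real N + 1 - \<bar>real_of_int k\<bar>" for N k
    by (simp add: fejer_def field_simps)
  have S: "(\<Sum>k\<in>{- int N..int N}. g k) = g 0 + ((\<Sum>i<N. g (int (Suc i))) + (\<Sum>i<N. g (- int (Suc i))))" for N
    by (induction N) (simp_all only: sum_symmetric_int_interval sum.lessThan_Suc, simp_all add: ac_simps)
  show ?thesis
    unfolding w
  proof (induction N)
    case (Suc N)
    have r1: "(\<Sum>i\<le>N. g (int i - int (Suc N))) = (\<Sum>i<Suc N. g (- int (Suc i)))"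
      by (rule sum.reindex_bij_witness[of _ "\<lambda>i. N - i" "\<lambda>i. N - i"]) (auto simp: of_nat_diff intro!: arg_cong[where f = g])
    have r2: "(\<Sum>j\<le>N. g (int (Suc N) - int j)) = (\<Sum>i<Suc N. g (int (Suc i)))"
      by (rule sum.reindex_bij_witness[of _ "\<lambda>i. N - i" "\<lambda>i. N - i"]) (auto simp: of_nat_diff intro!: arg_cong[where f = g])
    have "(\<Sum>i\<le>Suc N. \<Sum>j\<le>Suc N. g (int i - int j)) =
       (\<Sum>i\<le>N. \<Sum>j\<le>N. g (int i - int j)) + (\<Sum>i\<le>N. g (int i - int (Suc N)))
         + ((\<Sum>j\<le>N. g (int (Suc N) - int j)) + g 0)"
      by (simp add: sum.distrib)
    also have "\<dots> = (\<Sum>i\<le>N. \<Sum>j\<le>N. g (int i - int j)) + (\<Sum>k\<in>{- int (Suc N)..int (Suc N)}. g k)"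
      unfolding r1 r2 S by simp
    also have "\<dots> = (\<Sum>k\<in>{- int (Suc N)..int (Suc N)}. of_real (real N + 1 - \<bar>real_of_int k\<bar>) * g k)
        + (\<Sum>k\<in>{- int (Suc N)..int (Suc N)}. g k)"
      unfolding Suc sum_symmetric_int_interval by simp
    also have "\<dots> = (\<Sum>k\<in>{- int (Suc N)..int (Suc N)}. of_real (real (Suc N) + 1 - \<bar>real_of_int k\<bar>) * g k)"
      unfolding sum.distrib[symmetric] by (intro sum.cong refl) (simp add: algebra_simps)
    finally show ?case .
  qed simp
qed

text \<open>Written as a squared modulus so that positivity is visible;
  \<open>fejer_kernel_eq\<close> is the multiplier form.\<close>

definition fejer_kernel :: "nat \<Rightarrow> real \<Rightarrow> real" where
  "fejer_kernel N x = (cmod (\<Sum>i\<le>N. mode (int i) x))\<^sup>2 / (real N + 1)"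

lemma fejer_kernel_eq: "complex_of_real (fejer_kernel N x) = (\<Sum>k\<in>{- int N..int N}. of_real (fejer N k) * mode k x)"
proof -
  have "complex_of_real ((cmod (\<Sum>i\<le>N. mode (int i) x))\<^sup>2) = (\<Sum>i\<le>N. \<Sum>j\<le>N. mode (int i - int j) x)"
    unfolding complex_norm_square by (simp add: sum_product mode_mult_cnj)
  also have "\<dots> = of_real (real N + 1) * (\<Sum>k\<in>{- int N..int N}. of_real (fejer N k) * mode k x)"
    unfolding sum_differences[of "\<lambda>k. mode k x"] by (simp only: sum_distrib_left of_real_mult mult.assoc)
  finally have *: "complex_of_real ((cmod (\<Sum>i\<le>N. mode (int i) x))\<^sup>2) = of_real (real N + 1) * (\<Sum>k\<in>{- int N..int N}. of_real (fejer N k) * mode k x)" .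
  have "complex_of_real (fejer_kernel N x) = complex_of_real ((cmod (\<Sum>i\<le>N. mode (int i) x))\<^sup>2) / of_real (real N + 1)"
    unfolding fejer_kernel_def by (rule of_real_divide)
  also have "\<dots> = (\<Sum>k\<in>{- int N..int N}. of_real (fejer N k) * mode k x)"
    unfolding * by (rule nonzero_mult_div_cancel_left) (unfold of_real_eq_0_iff, linarith)
  finally show ?thesis .
qed

lemma fejer_kernel_nonneg: "0 \<le> fejer_kernel N x"
  by (simp add: fejer_kernel_def)

lemma measurable_fejer_kernel [measurable]: "fejer_kernel N \<in> borel_measurable borel"
  unfolding fejer_kernel_def[abs_def] by measurable

lemma fejer_kernel_le: "fejer_kernel N x \<le> real N + 1"
proof -
  have "(cmod (\<Sum>i\<le>N. mode (int i) x))\<^sup>2 \<le> (real N + 1)\<^sup>2"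
    by (intro power_mono order_trans[OF norm_sum]) auto
  then show ?thesis by (simp add: fejer_kernel_def divide_le_eq power2_eq_square)
qed

definition fejer_mean :: "nat \<Rightarrow> (real \<Rightarrow> complex) \<Rightarrow> real \<Rightarrow> complex" where
  "fejer_mean N f x = (\<Sum>k\<in>{- int N..int N}. of_real (fejer N k) * fourier_coeff f k * mode k x)"

lemma mode_diff: "mode k (x - y) = mode k x * cnj (mode k y)"
  by (simp add: mode_def cis_cnj cis_mult algebra_simps)

lemma integral_fejer_kernel: "(LINT y|torus. fejer_kernel N (x - y)) = 2 * pi"
proof -
  have i: "integrable torus (\<lambda>y. mode k (x - y))" for k
    by (rule torus.integrable_const_bound[where B = 1]) auto
  have cnj_mode: "cnj (mode k y) = mode (- k) y" for k y by (simp add: mode_def cis_cnj)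
  have "complex_of_real (LINT y|torus. fejer_kernel N (x - y)) = (LINT y|torus. complex_of_real (fejer_kernel N (x - y)))"
    by simp
  also have "\<dots> = (\<Sum>k\<in>{- int N..int N}. of_real (fejer N k) * (LINT y|torus. mode k (x - y)))"
    unfolding fejer_kernel_eq using i by (simp add: Bochner_Integration.integral_sum)
  also have "\<dots> = (\<Sum>k\<in>{- int N..int N}. if k = 0 then of_real (2 * pi) else 0)"
    by (intro sum.cong refl) (auto simp: mode_diff cnj_mode integral_mode fejer_def mode_def[of 0])
  also have "\<dots> = of_real (2 * pi)" by simp
  finally show ?thesis by (simp only: of_real_eq_iff)
qed

lemma fejer_mean_eq:
  assumes f: "integrable torus f"
  shows "fejer_mean N f x = (LINT y|torus. f y * of_real (fejer_kernel N (x - y))) / (2 * pi)"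
proof -
  have i: "integrable torus (\<lambda>y. f y * cnj (mode k y))" for k
    by (rule integrable_mult_bounded_complex[OF f, where K = 1]) auto
  have "(LINT y|torus. f y * of_real (fejer_kernel N (x - y))) =
     (LINT y|torus. (\<Sum>k\<in>{- int N..int N}. of_real (fejer N k) * mode k x * (f y * cnj (mode k y))))"
    by (intro Bochner_Integration.integral_cong refl) (simp add: fejer_kernel_eq mode_diff sum_distrib_left mult_ac)
  also have "\<dots> = (\<Sum>k\<in>{- int N..int N}. of_real (fejer N k) * mode k x * (LINT y|torus. f y * cnj (mode k y)))"
    using i by (subst Bochner_Integration.integral_sum) auto
  also have "\<dots> = (2 * pi) * fejer_mean N f x"
    by (simp add: fejer_mean_def fourier_coeff_eq sum_distrib_left mult_ac)
  finally show ?thesis by simp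
qed

text \<open>Jensen's inequality for the probability density K / (2 pi), by expanding the nonnegative
  variance of f around its mean m.\<close>

lemma cmod_fejer_mean_square_le:
  assumes f: "f \<in> L2_torus"
  shows "(cmod (fejer_mean N f x))\<^sup>2 \<le> (LINT y|torus. fejer_kernel N (x - y) * (cmod (f y))\<^sup>2) / (2 * pi)"
    and "integrable torus (\<lambda>y. fejer_kernel N (x - y) * (cmod (f y))\<^sup>2)"
proof -
  have fi: "integrable torus f" by (rule L2_torus_integrable[OF f])
  have f2: "integrable torus (\<lambda>y. (cmod (f y))\<^sup>2)" and [measurable]: "f \<in> borel_measurable torus"
    using f by (auto simp: L2_torus_def)
  let ?K = "\<lambda>y. fejer_kernel N (x - y)"
  have [measurable]: "?K \<in> borel_measurable torus" by measurable
  have Kb: "norm (?K y * g) \<le> norm ((real N + 1) * g)" for y and g :: real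
    using fejer_kernel_nonneg[of N "x - y"] fejer_kernel_le[of N "x - y"] by (simp add: abs_mult mult_right_mono)
  show iK2: "integrable torus (\<lambda>y. ?K y * (cmod (f y))\<^sup>2)"
    by (rule Bochner_Integration.integrable_bound[OF integrable_mult_right[OF f2, of "real N + 1"]])
      (auto intro: Kb simp del: real_norm_def)
  have iK: "integrable torus ?K"
    by (rule torus.integrable_const_bound[where B = "real N + 1"]) (auto simp: fejer_kernel_nonneg fejer_kernel_le)
  have iKf: "integrable torus (\<lambda>y. f y * of_real (?K y))"
    by (rule integrable_mult_bounded_complex[OF fi, where K = "real N + 1"]) (auto simp: fejer_kernel_nonneg fejer_kernel_le)
  define m where "m = fejer_mean N f x"
  have Kf: "(LINT y|torus. f y * of_real (?K y)) = 2 * pi * m"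
    unfolding m_def fejer_mean_eq[OF fi] by simp
  have pt: "?K y * (cmod (f y - m))\<^sup>2 = ?K y * (cmod (f y))\<^sup>2 - 2 * Re (cnj m * (f y * of_real (?K y))) + (cmod m)\<^sup>2 * ?K y" for y
    unfolding cmod_power2 by (simp add: power2_eq_square algebra_simps)
  have "0 \<le> (LINT y|torus. ?K y * (cmod (f y - m))\<^sup>2)"
    by (intro Bochner_Integration.integral_nonneg mult_nonneg_nonneg fejer_kernel_nonneg) auto
  also have "\<dots> = (LINT y|torus. ?K y * (cmod (f y))\<^sup>2) - 2 * (LINT y|torus. Re (cnj m * (f y * of_real (?K y)))) + (cmod m)\<^sup>2 * (LINT y|torus. ?K y)"
    unfolding pt using iK iK2 integrable_Re[OF integrable_mult_right[OF iKf, of "cnj m"]]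
    by (simp del: times_complex.simps)
  also have "(LINT y|torus. Re (cnj m * (f y * of_real (?K y)))) = Re (cnj m * (2 * pi * m))"
    using integral_Re[OF integrable_mult_right[OF iKf, of "cnj m"]] by (simp only: integral_mult_right_zero Kf)
  also have "cnj m * (2 * pi * m) = of_real (2 * pi * (cmod m)\<^sup>2)"
    unfolding of_real_mult complex_norm_square by (simp add: mult_ac)
  also have "Re (of_real (2 * pi * (cmod m)\<^sup>2)) = 2 * pi * (cmod m)\<^sup>2"
    by (rule Re_complex_of_real)
  also have "(LINT y|torus. ?K y) = 2 * pi" by (rule integral_fejer_kernel)
  finally show "(cmod (fejer_mean N f x))\<^sup>2 \<le> (LINT y|torus. ?K y * (cmod (f y))\<^sup>2) / (2 * pi)"
    by (simp add: m_def[symmetric] field_simps)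
qed

text \<open>Dominated convergence for series: beyond a fixed K the weights are at most 1 and the
  tail of c is small; up to K there are finitely many terms, each tending to 0.\<close>

lemma LIMSEQ_weighted_sums:
  fixes c :: "int \<Rightarrow> real" and w :: "nat \<Rightarrow> int \<Rightarrow> real"
  assumes c: "\<And>k. c k \<ge> 0" and lim: "(\<lambda>N. \<Sum>k\<in>{- int N..int N}. c k) \<longlonglongrightarrow> L"
    and w: "\<And>N k. k \<in> {- int N..int N} \<Longrightarrow> \<bar>w N k\<bar> \<le> 1" "\<And>k. (\<lambda>N. w N k) \<longlonglongrightarrow> 0"
  shows "(\<lambda>N. \<Sum>k\<in>{- int N..int N}. w N k * c k) \<longlonglongrightarrow> 0"
proof (rule LIMSEQ_I)
  fix e :: real assume e: "e > 0"
  let ?S = "\<lambda>N. \<Sum>k\<in>{- int N..int N}. c k"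
  have mono: "?S n \<le> ?S N" if "n \<le> N" for n N
    using that c by (intro sum_mono2) auto
  have le_L: "?S n \<le> L" for n
    by (rule LIMSEQ_le_const[OF lim]) (use mono in blast)
  obtain K where K: "\<bar>?S K - L\<bar> < e / 2"
    using LIMSEQ_D[OF lim half_gt_zero[OF e]] unfolding real_norm_def by blast
  have "(\<lambda>N. \<Sum>k\<in>{- int K..int K}. \<bar>w N k\<bar> * c k) \<longlonglongrightarrow> (\<Sum>k\<in>{- int K..int K}. \<bar>0\<bar> * c k)"
    by (intro tendsto_intros w)
  then have "(\<lambda>N. \<Sum>k\<in>{- int K..int K}. \<bar>w N k\<bar> * c k) \<longlonglongrightarrow> 0" by simp
  from LIMSEQ_D[OF this half_gt_zero[OF e]]
  obtain N\<^sub>0 where N0: "\<And>N. N \<ge> N\<^sub>0 \<Longrightarrow> \<bar>\<Sum>k\<in>{- int K..int K}. \<bar>w N k\<bar> * c k\<bar> < e / 2"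
    unfolding diff_zero real_norm_def by blast
  have "norm ((\<Sum>k\<in>{- int N..int N}. w N k * c k) - 0) < e" if N: "N \<ge> max N\<^sub>0 K" for N
  proof -
    have "norm ((\<Sum>k\<in>{- int N..int N}. w N k * c k) - 0) \<le> (\<Sum>k\<in>{- int N..int N}. \<bar>w N k\<bar> * c k)"
      using c by (auto intro!: order_trans[OF sum_abs] sum_mono simp: abs_mult)
    also have "\<dots> = (\<Sum>k\<in>{- int K..int K}. \<bar>w N k\<bar> * c k) + (\<Sum>k\<in>{- int N..int N} - {- int K..int K}. \<bar>w N k\<bar> * c k)"
      using N by (subst sum.subset_diff[of "{- int K..int K}"]) auto
    also have "(\<Sum>k\<in>{- int N..int N} - {- int K..int K}. \<bar>w N k\<bar> * c k) \<le> (\<Sum>k\<in>{- int N..int N} - {- int K..int K}. c k)"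
      using w(1) c by (intro sum_mono) (auto intro: mult_left_le_one_le)
    also have "\<dots> = ?S N - ?S K"
      using N by (subst sum_diff) auto
    also have "(\<Sum>k\<in>{- int K..int K}. \<bar>w N k\<bar> * c k) + (?S N - ?S K) < e / 2 + e / 2"
    proof (rule add_less_le_mono)
      show "(\<Sum>k\<in>{- int K..int K}. \<bar>w N k\<bar> * c k) < e / 2" using N0[of N] N by auto
      show "?S N - ?S K \<le> e / 2" using K le_L[of N] by linarith
    qed
    finally show ?thesis by simp
  qed
  then show "\<exists>no. \<forall>N\<ge>no. norm ((\<Sum>k\<in>{- int N..int N}. w N k * c k) - 0) < e" by blast
qed

lemma LIMSEQ_fejer_weight: "(\<lambda>N. 1 - fejer N k) \<longlonglongrightarrow> 0"
proof -
  have "(\<lambda>N. \<bar>real_of_int k\<bar> * inverse (real (Suc N))) \<longlonglongrightarrow> \<bar>real_of_int k\<bar> * 0"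
    by (intro tendsto_intros LIMSEQ_inverse_real_of_nat)
  then show ?thesis by (simp add: fejer_def field_simps)
qed

lemma LIMSEQ_fejer_energy:
  assumes f: "f \<in> L2_torus"
  shows "(\<lambda>N. 2 * pi * (\<Sum>k\<in>{- int N..int N}. fejer N k * (cmod (fourier_coeff f k))\<^sup>2)) \<longlonglongrightarrow> (L2_norm_torus f)\<^sup>2"
proof -
  have lim: "(\<lambda>N. \<Sum>k\<in>{- int N..int N}. (cmod (fourier_coeff f k))\<^sup>2) \<longlonglongrightarrow> (L2_norm_torus f)\<^sup>2 / (2 * pi)"
    using tendsto_divide[OF parseval_torus[OF f] tendsto_const[of "2 * pi"]] by simp
  have "(\<lambda>N. \<Sum>k\<in>{- int N..int N}. (1 - fejer N k) * (cmod (fourier_coeff f k))\<^sup>2) \<longlonglongrightarrow> 0"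
    by (rule LIMSEQ_weighted_sums[OF _ lim]) (use fejer_bounds LIMSEQ_fejer_weight in \<open>force+\<close>)
  then have "(\<lambda>N. 2 * pi * ((\<Sum>k\<in>{- int N..int N}. (cmod (fourier_coeff f k))\<^sup>2) -
     (\<Sum>k\<in>{- int N..int N}. (1 - fejer N k) * (cmod (fourier_coeff f k))\<^sup>2))) \<longlonglongrightarrow> 2 * pi * ((L2_norm_torus f)\<^sup>2 / (2 * pi) - 0)"
    using lim by (intro tendsto_intros)
  then show ?thesis by (simp add: algebra_simps sum_subtractf[symmetric])
qed

text \<open>The crude second bound is there to dominate the error when its limit is later integrated
  in t.\<close>

lemma fejer_mean_error:
  assumes f: "f \<in> L2_torus"
  shows "integrable torus (\<lambda>x. (cmod (f x - fejer_mean N f x))\<^sup>2)"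
    and "(LINT x|torus. (cmod (f x - fejer_mean N f x))\<^sup>2) \<le> 2 * (L2_norm_torus f)\<^sup>2"
    and "(\<lambda>N. LINT x|torus. (cmod (f x - fejer_mean N f x))\<^sup>2) \<longlonglongrightarrow> 0"
proof -
  let ?c = "\<lambda>k. (cmod (fourier_coeff f k))\<^sup>2"
  note * = integral_cmod_square_diff_trig[OF f, of "{- int N..int N}" "\<lambda>k. of_real (fejer N k) * fourier_coeff f k" for N]
  show "integrable torus (\<lambda>x. (cmod (f x - fejer_mean N f x))\<^sup>2)"
    unfolding fejer_mean_def by (rule *(1)) simp
  have diff: "(cmod (fourier_coeff f k - of_real (fejer N k) * fourier_coeff f k))\<^sup>2 = (1 - fejer N k)\<^sup>2 * ?c k" for N k
  proof -
    have "fourier_coeff f k - of_real (fejer N k) * fourier_coeff f k = of_real (1 - fejer N k) * fourier_coeff f k"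
      by (simp add: algebra_simps)
    then show ?thesis by (simp only: norm_mult power_mult_distrib norm_of_real power2_abs)
  qed
  have val: "(LINT x|torus. (cmod (f x - fejer_mean N f x))\<^sup>2) = (L2_norm_torus f)\<^sup>2 - 2 * pi * (\<Sum>k\<in>{- int N..int N}. ?c k)
     + 2 * pi * (\<Sum>k\<in>{- int N..int N}. (1 - fejer N k)\<^sup>2 * ?c k)" for N
    unfolding fejer_mean_def by (subst *(2)) (simp_all only: diff finite_atLeastAtMost_int)
  have sq: "(1 - fejer N k)\<^sup>2 \<le> 1" if "k \<in> {- int N..int N}" for N k
    using fejer_bounds(1)[OF that] fejer_bounds(2)[of N k] by (intro power_le_one) auto
  have "(\<Sum>k\<in>{- int N..int N}. (1 - fejer N k)\<^sup>2 * ?c k) \<le> (\<Sum>k\<in>{- int N..int N}. ?c k)"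
    using sq by (intro sum_mono mult_left_le_one_le) auto
  then have "2 * pi * (\<Sum>k\<in>{- int N..int N}. (1 - fejer N k)\<^sup>2 * ?c k) \<le> 2 * pi * (\<Sum>k\<in>{- int N..int N}. ?c k)"
    by (intro mult_left_mono) auto
  then show "(LINT x|torus. (cmod (f x - fejer_mean N f x))\<^sup>2) \<le> 2 * (L2_norm_torus f)\<^sup>2"
    unfolding val using zero_le_power2[of "L2_norm_torus f"] by linarith
  have lim: "(\<lambda>N. \<Sum>k\<in>{- int N..int N}. ?c k) \<longlonglongrightarrow> (L2_norm_torus f)\<^sup>2 / (2 * pi)"
    using tendsto_divide[OF parseval_torus[OF f] tendsto_const[of "2 * pi"]] by simp
  have "(\<lambda>N. \<Sum>k\<in>{- int N..int N}. (1 - fejer N k)\<^sup>2 * ?c k) \<longlonglongrightarrow> 0"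
  proof (rule LIMSEQ_weighted_sums[OF _ lim])
    show "(\<lambda>N. (1 - fejer N k)\<^sup>2) \<longlonglongrightarrow> 0" for k
      using tendsto_power[OF LIMSEQ_fejer_weight[of k], of 2] by simp
  qed (use sq in auto)
  then have "(\<lambda>N. (L2_norm_torus f)\<^sup>2 - 2 * pi * (\<Sum>k\<in>{- int N..int N}. ?c k) + 2 * pi * (\<Sum>k\<in>{- int N..int N}. (1 - fejer N k)\<^sup>2 * ?c k))
    \<longlonglongrightarrow> (L2_norm_torus f)\<^sup>2 - (L2_norm_torus f)\<^sup>2 + 2 * pi * 0"
    by (intro tendsto_intros parseval_torus f)
  then show "(\<lambda>N. LINT x|torus. (cmod (f x - fejer_mean N f x))\<^sup>2) \<longlonglongrightarrow> 0"
    unfolding val by simp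
qed

section \<open>The energy inequality\<close>

text \<open>A solution on one bounded window, with Duhamel's formula started at \<open>u 0\<close>.
  These data survive restriction to shorter windows and translation in time, so one contraction
  statement serves all windows. M bounds the squared norm in L^inf_x L^2_t; it varies with the
  solution and must stay out of the decay constants.\<close>

locale damped_solution =
  fixes p :: "int poly" and a :: "real \<Rightarrow> real \<Rightarrow> real" and u :: "real \<Rightarrow> real \<Rightarrow> complex" and T M :: real
  assumes T: "0 \<le> T"
    and a_measurable: "(\<lambda>(t, x). a t x) \<in> borel_measurable (slab {0..T})"
    and a_nonneg: "AE z in slab {0..T}. 0 \<le> a (fst z) (snd z)"
    and a_finite: "norm_L1x_Linft {0..T} a < \<infinity>"
    and u_measurable: "(\<lambda>(t, x). u t x) \<in> borel_measurable (slab {0..T})"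
    and u_L2: "\<And>t. t \<in> {0..T} \<Longrightarrow> u t \<in> L2_torus"
    and M: "0 \<le> M"
    and u_bound: "AE x in torus. (\<integral>\<^sup>+ t. ennreal ((cmod (u t x))\<^sup>2) \<partial>time {0..T}) \<le> ennreal M"
    and duhamel: "\<And>t k. t \<in> {0..T} \<Longrightarrow> fourier_coeff (u t) k = propagator p t (fourier_coeff (u 0)) k -
        (LINT s:{0..t}|lborel. propagator p (t - s) (fourier_coeff (\<lambda>x. complex_of_real (a s x) * u s x)) k)"
begin

abbreviation "I \<equiv> {0..T}"
abbreviation "A z \<equiv> a (fst z) (snd z)"
abbreviation "W z \<equiv> u (fst z) (snd z)"
abbreviation "G z \<equiv> complex_of_real (A z) * W z"

lemma A_measurable [measurable]: "(\<lambda>z. A z) \<in> borel_measurable (slab I)"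
  using a_measurable by (simp add: split_beta')

lemma W_measurable [measurable]: "(\<lambda>z. W z) \<in> borel_measurable (slab I)"
  using u_measurable by (simp add: split_beta')

lemma slab_eq: "time I \<Otimes>\<^sub>M torus = slab I"
  by (rule time_torus_eq_slab) simp

lemma finite_time: "finite_measure (time I)"
  by (rule finite_measure_time) (auto intro: bounded_closed_interval)

lemma pair_sigma_finite_slab: "pair_sigma_finite (time I) torus"
proof -
  interpret t: finite_measure "time I" by (rule finite_time)
  show ?thesis ..
qed

lemma nn_integral_weighted_le:
  assumes "f \<in> borel_measurable (slab I)" and "\<And>x. x \<in> space torus \<Longrightarrow> (\<integral>\<^sup>+ t. f (t, x) \<partial>time I) \<le> K"
  shows "(\<integral>\<^sup>+ z. ennreal \<bar>A z\<bar> * f z \<partial>slab I) \<le> norm_L1x_Linft I a * K"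
  by (rule holder_L1x_Linft[OF _ a_measurable]) (use assms in \<open>auto intro!: AE_I2\<close>)

lemma integrable_a: "integrable (slab I) (\<lambda>z. \<bar>A z\<bar>)"
proof -
  have "(\<integral>\<^sup>+ z. ennreal \<bar>A z\<bar> * 1 \<partial>slab I) \<le> norm_L1x_Linft I a * ennreal T"
    by (rule nn_integral_weighted_le) (use T in \<open>auto simp: emeasure_restrict_space space_restrict_space\<close>)
  also have "\<dots> < \<infinity>" using a_finite by (simp add: ennreal_mult_less_top)
  finally show ?thesis by (intro integrableI_bounded) auto
qed

lemma integrable_W2: "integrable (slab I) (\<lambda>z. (cmod (W z))\<^sup>2)"
proof -
  have "(\<integral>\<^sup>+ z. ennreal ((cmod (W z))\<^sup>2) \<partial>slab I) = (\<integral>\<^sup>+ x. \<integral>\<^sup>+ t. ennreal ((cmod (u t x))\<^sup>2) \<partial>time I \<partial>torus)"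
    by (subst nn_integral_slab(1)) auto
  also have "\<dots> \<le> (\<integral>\<^sup>+ x. ennreal M \<partial>torus)"
    by (rule nn_integral_mono_AE[OF u_bound])
  also have "\<dots> < \<infinity>" by (simp add: ennreal_mult_less_top)
  finally show ?thesis by (intro integrableI_bounded) auto
qed

lemma integrable_aW2: "integrable (slab I) (\<lambda>z. \<bar>A z\<bar> * (cmod (W z))\<^sup>2)"
proof -
  have "(\<integral>\<^sup>+ z. ennreal \<bar>A z\<bar> * ennreal ((cmod (W z))\<^sup>2) \<partial>slab I) \<le> norm_L1x_Linft I a * ennreal M"
    by (rule holder_L1x_Linft[OF _ a_measurable _]) (use u_bound in auto)
  also have "\<dots> < \<infinity>" using a_finite by (simp add: ennreal_mult_less_top)
  finally show ?thesis by (intro integrableI_bounded) (auto simp: ennreal_mult)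
qed

definition dissipation :: real where
  "dissipation = (LINT z|slab I. \<bar>A z\<bar> * (cmod (W z))\<^sup>2)"

lemma dissipation_nonneg: "0 \<le> dissipation"
  unfolding dissipation_def by simp

text \<open>Since |u| is at most 1 + |u|^2, the integrable functions |a| and |a| |u|^2 dominate the
  source.\<close>

lemma integrable_G: "integrable (slab I) (\<lambda>z. G z)"
proof (rule Bochner_Integration.integrable_bound)
  show "integrable (slab I) (\<lambda>z. \<bar>A z\<bar> + \<bar>A z\<bar> * (cmod (W z))\<^sup>2)"
    using integrable_a integrable_aW2 by simp
  show "AE z in slab I. norm (G z) \<le> norm (\<bar>A z\<bar> + \<bar>A z\<bar> * (cmod (W z))\<^sup>2)"
  proof (rule AE_I2)
    fix z
    have "0 \<le> (1 - cmod (W z))\<^sup>2" by simp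
    also have "\<dots> = 1 + (cmod (W z))\<^sup>2 - 2 * cmod (W z)" by (simp add: power2_diff)
    finally have "cmod (W z) \<le> 1 + (cmod (W z))\<^sup>2" using norm_ge_zero[of "W z"] by linarith
    then have "\<bar>A z\<bar> * cmod (W z) \<le> \<bar>A z\<bar> * (1 + (cmod (W z))\<^sup>2)" by (intro mult_left_mono) auto
    then show "norm (G z) \<le> norm (\<bar>A z\<bar> + \<bar>A z\<bar> * (cmod (W z))\<^sup>2)"
      by (simp add: norm_mult algebra_simps)
  qed
qed measurable

definition coef :: "int \<Rightarrow> real \<Rightarrow> complex" where
  "coef k s = fourier_coeff (u s) k"

definition src :: "int \<Rightarrow> real \<Rightarrow> complex" where
  "src k s = fourier_coeff (\<lambda>x. complex_of_real (a s x) * u s x) k"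

lemma measurable_fst_slab [measurable]:
  "f \<in> borel_measurable (time I) \<Longrightarrow> (\<lambda>z. f (fst z)) \<in> borel_measurable (slab I)"
  unfolding slab_eq[symmetric] by (rule measurable_compose[OF measurable_fst])

lemma measurable_snd_slab [measurable]:
  "f \<in> borel_measurable borel \<Longrightarrow> (\<lambda>z. f (snd z)) \<in> borel_measurable (slab I)"
  unfolding slab_eq[symmetric]
  by (rule measurable_compose[OF measurable_snd]) (rule borel_measurable_torus)

lemma measurable_coef [measurable]: "coef k \<in> borel_measurable (time I)"
proof -
  have "(\<lambda>z. W z * cnj (mode k (snd z))) \<in> borel_measurable (time I \<Otimes>\<^sub>M torus)"
    unfolding slab_eq by measurable
  then have "(\<lambda>s. LINT x|torus. u s x * cnj (mode k x)) \<in> borel_measurable (time I)"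
    by (intro torus.borel_measurable_lebesgue_integral) (simp add: split_beta')
  then show ?thesis
    unfolding coef_def[abs_def] fourier_coeff_eq by measurable
qed

lemma integrable_G_mode: "integrable (slab I) (\<lambda>z. G z * cnj (mode k (snd z)))"
  by (rule integrable_mult_bounded_complex[OF integrable_G, where K = 1]) auto

lemma integrable_src: "integrable (time I) (src k)"
proof -
  interpret pair_sigma_finite "time I" torus by (rule pair_sigma_finite_slab)
  have "integrable (time I) (\<lambda>s. LINT x|torus. complex_of_real (a s x) * u s x * cnj (mode k x))"
    using integrable_fst'[OF integrable_G_mode[unfolded slab_eq[symmetric], of k]] by simp
  then show ?thesis
    unfolding src_def[abs_def] fourier_coeff_eq by simp
qed

text \<open>The source in the interaction picture: the free rotation is undone, so each coefficient
  becomes a rotated primitive of one integrable function. It is 0 off the window, so that integrals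
  can run over the whole line.\<close>

definition rot :: "int \<Rightarrow> real \<Rightarrow> complex" where
  "rot k s = indicator I s *\<^sub>R (cis (- (s * of_int (poly p k))) * src k s)"

lemma integrable_rot: "integrable lborel (rot k)"
proof -
  have "integrable (time I) (\<lambda>s. src k s * cis (- (s * of_int (poly p k))))"
    by (rule integrable_mult_bounded_complex[OF integrable_src, where K = 1])
      (auto intro!: measurable_restrict_space1 borel_measurable_continuous_onI continuous_intros)
  then have "integrable lborel (\<lambda>s. indicator I s *\<^sub>R (src k s * cis (- (s * of_int (poly p k)))))"
    by (subst (asm) integrable_restrict_space) auto
  then show ?thesis
    by (simp add: rot_def[abs_def] mult.commute)
qed

lemma coef_eq:
  assumes t: "t \<in> I"
  shows "coef k t = cis (t * of_int (poly p k)) * (coef k 0 - (LINT r|lborel. indicator {..t} r *\<^sub>R rot k r))"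
proof -
  let ?q = "of_int (poly p k) :: real"
  have "(LINT s:{0..t}|lborel. propagator p (t - s) (fourier_coeff (\<lambda>x. complex_of_real (a s x) * u s x)) k) =
     (LINT s|lborel. cis (t * ?q) * (indicator {..t} s *\<^sub>R rot k s))"
    unfolding set_lebesgue_integral_def
  proof (intro Bochner_Integration.integral_cong refl)
    fix s
    have "cis ((t - s) * ?q) = cis (t * ?q) * cis (- (s * ?q))"
      by (simp add: cis_mult algebra_simps)
    then show "indicator {0..t} s *\<^sub>R propagator p (t - s) (fourier_coeff (\<lambda>x. complex_of_real (a s x) * u s x)) k =
      cis (t * ?q) * (indicator {..t} s *\<^sub>R rot k s)"
      using t by (auto simp: propagator_def rot_def src_def indicator_def)
  qed
  also have "\<dots> = cis (t * ?q) * (LINT s|lborel. indicator {..t} s *\<^sub>R rot k s)"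
    by (rule integral_mult_right_zero)
  finally show ?thesis
    using duhamel[OF t, of k] by (simp add: coef_def propagator_def right_diff_distrib)
qed

text \<open>Uniform in t, so that multiplying the source by a coefficient keeps it
  integrable.\<close>

lemma cmod_coef_le:
  assumes t: "t \<in> I"
  shows "cmod (coef k t) \<le> cmod (coef k 0) + (LINT r|lborel. cmod (rot k r))"
proof -
  have int: "integrable lborel (\<lambda>r. indicator {..t} r *\<^sub>R rot k r)"
    using integrable_rot by (rule integrable_mult_indicator[rotated]) simp
  have "cmod (coef k t) \<le> cmod (coef k 0) + cmod (LINT r|lborel. indicator {..t} r *\<^sub>R rot k r)"
    unfolding coef_eq[OF t, of k] norm_mult norm_cis mult_1 by (rule norm_triangle_ineq4)
  also have "cmod (LINT r|lborel. indicator {..t} r *\<^sub>R rot k r) \<le> (LINT r|lborel. cmod (indicator {..t} r *\<^sub>R rot k r))"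
    by (rule integral_norm_bound)
  also have "\<dots> \<le> (LINT r|lborel. cmod (rot k r))"
    using integrable_norm[OF int] integrable_norm[OF integrable_rot]
    by (intro integral_mono) (auto simp: indicator_def simp del: norm_scaleR)
  finally show ?thesis by simp
qed

lemma integrable_G_coef_mode: "integrable (slab I) (\<lambda>z. G z * cnj (coef k (fst z) * mode k (snd z)))"
  by (rule integrable_mult_bounded_complex[OF integrable_G, where K = "cmod (coef k 0) + (LINT r|lborel. cmod (rot k r))"])
    (auto simp: norm_mult cmod_coef_le)

text \<open>After undoing the rotation the coefficient is c - g(s), where g is the primitive of
  \<open>rot k\<close>. The identity for the square of an integral yields |c - F|^2 = |c|^2 - 2 Re
  of the integral of f conj (c - g) without differentiating the coefficient, and in f conj (c - g)
  the rotations cancel.\<close>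

lemma energy_mode:
  "2 * pi * (cmod (coef k T))\<^sup>2 = 2 * pi * (cmod (coef k 0))\<^sup>2
     - 2 * Re (LINT z|slab I. G z * cnj (coef k (fst z) * mode k (snd z)))"
proof -
  interpret pair_sigma_finite "time I" torus by (rule pair_sigma_finite_slab)
  let ?f = "rot k" and ?c = "coef k 0"
  define g where "g s = (LINT r|lborel. indicator {..s} r *\<^sub>R ?f r)" for s
  define F where "F = (LINT s|lborel. ?f s)"
  note sq = cmod_square_integral_eq[OF integrable_rot[of k], folded g_def, folded F_def]
  have "(LINT r|lborel. indicator {..T} r *\<^sub>R ?f r) = F"
    unfolding F_def by (intro Bochner_Integration.integral_cong) (auto simp: rot_def indicator_def)
  then have "cmod (coef k T) = cmod (?c - F)"
    using coef_eq[of T k] T by (simp add: norm_mult)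
  then have "(cmod (coef k T))\<^sup>2 = (cmod (?c - F))\<^sup>2" by simp
  also have "\<dots> = (cmod ?c)\<^sup>2 - 2 * Re (F * cnj ?c) + (cmod F)\<^sup>2"
    unfolding cmod_power2 by (simp add: power2_eq_square algebra_simps)
  also have "F * cnj ?c = (LINT s|lborel. ?f s * cnj ?c)"
    by (simp add: F_def)
  also have "(cmod F)\<^sup>2 = 2 * Re (LINT s|lborel. ?f s * cnj (g s))"
    by (rule sq(2))
  finally have main: "(cmod (coef k T))\<^sup>2 = (cmod ?c)\<^sup>2 - 2 * Re ((LINT s|lborel. ?f s * cnj ?c) - (LINT s|lborel. ?f s * cnj (g s)))"
    by simp
  have "(LINT s|lborel. ?f s * cnj ?c) - (LINT s|lborel. ?f s * cnj (g s)) = (LINT s|lborel. ?f s * cnj ?c - ?f s * cnj (g s))"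
    using integrable_rot sq(1) by (intro Bochner_Integration.integral_diff[symmetric]) auto
  also have "\<dots> = (LINT s|lborel. indicator I s *\<^sub>R (src k s * cnj (coef k s)))"
  proof (intro Bochner_Integration.integral_cong refl)
    fix s
    show "?f s * cnj ?c - ?f s * cnj (g s) = indicator I s *\<^sub>R (src k s * cnj (coef k s))"
    proof (cases "s \<in> I")
      case True
      have "coef k s = cis (s * of_int (poly p k)) * (?c - g s)"
        unfolding g_def by (rule coef_eq[OF True])
      then have "cnj ?c - cnj (g s) = cis (s * of_int (poly p k)) * cnj (coef k s)"
        by (simp add: cis_cnj cis_mult flip: mult.assoc)
      then have "?f s * cnj ?c - ?f s * cnj (g s) =
          (cis (- (s * of_int (poly p k))) * cis (s * of_int (poly p k))) * (src k s * cnj (coef k s))"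
        unfolding right_diff_distrib[symmetric] using True by (simp only: rot_def) (simp add: mult_ac)
      then show ?thesis
        using True by (simp add: cis_mult)
    qed (simp add: rot_def)
  qed
  also have "\<dots> = (LINT s|time I. src k s * cnj (coef k s))"
    by (subst integral_restrict_space) (auto simp: set_lebesgue_integral_def)
  also have "\<dots> = (LINT s|time I. (LINT x|torus. G (s, x) * cnj (coef k (fst (s, x)) * mode k (snd (s, x)))) / (2 * pi))"
  proof (intro Bochner_Integration.integral_cong refl)
    fix s
    have "(LINT x|torus. G (s, x) * cnj (coef k (fst (s, x)) * mode k (snd (s, x)))) =
      (LINT x|torus. complex_of_real (a s x) * u s x * cnj (mode k x)) * cnj (coef k s)"
      by (subst integral_mult_left_zero[symmetric]) (simp add: mult_ac)
    then show "src k s * cnj (coef k s) = (LINT x|torus. G (s, x) * cnj (coef k (fst (s, x)) * mode k (snd (s, x)))) / (2 * pi)"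
      by (simp add: src_def fourier_coeff_eq)
  qed
  also have "\<dots> = (LINT z|slab I. G z * cnj (coef k (fst z) * mode k (snd z))) / (2 * pi)"
    using integral_fst'[OF integrable_G_coef_mode[of k, unfolded slab_eq[symmetric]]] by (simp add: slab_eq)
  finally have "(LINT s|lborel. ?f s * cnj ?c) - (LINT s|lborel. ?f s * cnj (g s)) =
    (LINT z|slab I. G z * cnj (coef k (fst z) * mode k (snd z))) / of_real (2 * pi)" by simp
  then show ?thesis
    unfolding main by (simp only: Re_divide_of_real) (simp add: field_simps)
qed

lemma energy_multiplier:
  assumes F: "finite F"
  shows "2 * pi * (\<Sum>k\<in>F. \<phi> k * (cmod (coef k T))\<^sup>2) = 2 * pi * (\<Sum>k\<in>F. \<phi> k * (cmod (coef k 0))\<^sup>2)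
     - 2 * Re (LINT z|slab I. G z * cnj (\<Sum>k\<in>F. of_real (\<phi> k) * coef k (fst z) * mode k (snd z)))"
proof -
  have "(LINT z|slab I. G z * cnj (\<Sum>k\<in>F. of_real (\<phi> k) * coef k (fst z) * mode k (snd z))) =
     (LINT z|slab I. (\<Sum>k\<in>F. of_real (\<phi> k) * (G z * cnj (coef k (fst z) * mode k (snd z)))))"
    by (intro Bochner_Integration.integral_cong refl) (simp add: sum_distrib_left mult_ac)
  also have "\<dots> = (\<Sum>k\<in>F. of_real (\<phi> k) * (LINT z|slab I. G z * cnj (coef k (fst z) * mode k (snd z))))"
    using integrable_G_coef_mode by (subst Bochner_Integration.integral_sum) auto
  finally have "2 * Re (LINT z|slab I. G z * cnj (\<Sum>k\<in>F. of_real (\<phi> k) * coef k (fst z) * mode k (snd z))) =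
      (\<Sum>k\<in>F. \<phi> k * (2 * Re (LINT z|slab I. G z * cnj (coef k (fst z) * mode k (snd z)))))"
    unfolding Re_sum by (simp only: Re_sum sum_distrib_left) (simp add: mult.left_commute)
  also have "\<dots> = (\<Sum>k\<in>F. \<phi> k * (2 * pi * (cmod (coef k 0))\<^sup>2 - 2 * pi * (cmod (coef k T))\<^sup>2))"
  proof (intro sum.cong refl)
    fix k
    show "\<phi> k * (2 * Re (LINT z|slab I. G z * cnj (coef k (fst z) * mode k (snd z)))) =
      \<phi> k * (2 * pi * (cmod (coef k 0))\<^sup>2 - 2 * pi * (cmod (coef k T))\<^sup>2)"
      using energy_mode[of k] by simp
  qed
  finally show ?thesis
    by (simp add: sum_distrib_left algebra_simps sum_subtractf)
qed


section \<open>Testing the equation with Fejer means\<close>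

definition \<sigma> :: "nat \<Rightarrow> real \<times> real \<Rightarrow> complex" where
  "\<sigma> N z = fejer_mean N (u (fst z)) (snd z)"

lemma \<sigma>_eq: "\<sigma> N z = (\<Sum>k\<in>{- int N..int N}. of_real (fejer N k) * coef k (fst z) * mode k (snd z))"
  by (simp add: \<sigma>_def fejer_mean_def coef_def)

lemma measurable_\<sigma> [measurable]: "\<sigma> N \<in> borel_measurable (slab I)"
  unfolding \<sigma>_eq[abs_def] by measurable

text \<open>Positivity of the Fejer kernel preserves the \<open>L\<^sup>\<infinity>_x L\<^sup>2_t\<close> bound.\<close>

lemma \<sigma>_bound: "(\<integral>\<^sup>+ t. ennreal ((cmod (\<sigma> N (t, x)))\<^sup>2) \<partial>time I) \<le> ennreal M"
proof -
  define K where "K y = fejer_kernel N (x - y) / (2 * pi)" for y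
  have K0: "0 \<le> K y" for y by (simp add: fejer_kernel_nonneg K_def)
  have [measurable]: "K \<in> borel_measurable borel" unfolding K_def by measurable
  have "(\<integral>\<^sup>+ t. ennreal ((cmod (\<sigma> N (t, x)))\<^sup>2) \<partial>time I) \<le>
     (\<integral>\<^sup>+ t. \<integral>\<^sup>+ y. ennreal (K y) * ennreal ((cmod (u t y))\<^sup>2) \<partial>torus \<partial>time I)"
  proof (rule nn_integral_mono)
    fix t assume "t \<in> space (time I)"
    then have t: "u t \<in> L2_torus" by (intro u_L2) (simp add: space_restrict_space)
    note * = cmod_fejer_mean_square_le[OF t, where N = N and x = x]
    have "ennreal ((cmod (\<sigma> N (t, x)))\<^sup>2) \<le> ennreal (LINT y|torus. K y * (cmod (u t y))\<^sup>2)"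
      using *(1) by (intro ennreal_leI) (simp add: \<sigma>_def K_def)
    also have "\<dots> = (\<integral>\<^sup>+ y. ennreal (K y * (cmod (u t y))\<^sup>2) \<partial>torus)"
    proof (rule nn_integral_eq_integral[symmetric])
      show "integrable torus (\<lambda>y. K y * (cmod (u t y))\<^sup>2)"
        using integrable_mult_left[OF *(2), of "inverse (2 * pi)"] by (simp add: K_def field_simps)
      show "AE y in torus. 0 \<le> K y * (cmod (u t y))\<^sup>2"
        by (intro AE_I2 mult_nonneg_nonneg K0) simp
    qed
    also have "\<dots> = (\<integral>\<^sup>+ y. ennreal (K y) * ennreal ((cmod (u t y))\<^sup>2) \<partial>torus)"
      by (intro nn_integral_cong ennreal_mult K0) simp
    finally show "ennreal ((cmod (\<sigma> N (t, x)))\<^sup>2) \<le> (\<integral>\<^sup>+ y. ennreal (K y) * ennreal ((cmod (u t y))\<^sup>2) \<partial>torus)" .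
  qed
  also have "\<dots> = (\<integral>\<^sup>+ z. ennreal (K (snd z)) * ennreal ((cmod (W z))\<^sup>2) \<partial>slab I)"
  proof -
    have "(\<lambda>z. ennreal (K (snd z)) * ennreal ((cmod (W z))\<^sup>2)) \<in> borel_measurable (slab I)"
      by measurable
    from nn_integral_slab(2)[OF _ this] show ?thesis by simp
  qed
  also have "\<dots> = (\<integral>\<^sup>+ y. \<integral>\<^sup>+ t. ennreal (K y) * ennreal ((cmod (u t y))\<^sup>2) \<partial>time I \<partial>torus)"
  proof -
    have "(\<lambda>z. ennreal (K (snd z)) * ennreal ((cmod (W z))\<^sup>2)) \<in> borel_measurable (slab I)"
      by measurable
    from nn_integral_slab(1)[OF _ this] show ?thesis by simp
  qed
  also have "\<dots> \<le> (\<integral>\<^sup>+ y. ennreal (K y) * ennreal M \<partial>torus)"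
  proof (rule nn_integral_mono_AE)
    show "AE y in torus. (\<integral>\<^sup>+ t. ennreal (K y) * ennreal ((cmod (u t y))\<^sup>2) \<partial>time I) \<le> ennreal (K y) * ennreal M"
      using u_bound AE_space
    proof eventually_elim
      case (elim y)
      have "(\<lambda>t. ennreal ((cmod (u t y))\<^sup>2)) \<in> borel_measurable (time I)"
        using measurable_slab_section[OF _ W_measurable elim(2)] by simp
      then show ?case using elim(1) by (simp add: nn_integral_cmult mult_left_mono)
    qed
  qed
  also have "\<dots> = (\<integral>\<^sup>+ y. ennreal (K y) \<partial>torus) * ennreal M"
    by (rule nn_integral_multc) measurable
  also have "(\<integral>\<^sup>+ y. ennreal (K y) \<partial>torus) = 1"
  proof -
    have "integrable torus (\<lambda>y. fejer_kernel N (x - y))"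
      by (rule torus.integrable_const_bound[where B = "real N + 1"]) (auto simp: fejer_kernel_nonneg fejer_kernel_le)
    then have "(\<integral>\<^sup>+ y. ennreal (K y) \<partial>torus) = ennreal (LINT y|torus. K y)"
      unfolding K_def by (intro nn_integral_eq_integral integrable_divide AE_I2) (auto simp: fejer_kernel_nonneg)
    then show ?thesis by (simp add: integral_fejer_kernel K_def)
  qed
  finally show ?thesis by simp
qed

text \<open>Dominated convergence in t: at each time the means converge in x, with error at most
  twice the energy at that time.\<close>

lemma LIMSEQ_\<sigma>_L2: "(\<lambda>N. \<integral>\<^sup>+ z. ennreal ((cmod (W z - \<sigma> N z))\<^sup>2) \<partial>slab I) \<longlonglongrightarrow> 0"
proof -
  let ?d = "\<lambda>N t. LINT x|torus. (cmod (u t x - fejer_mean N (u t) x))\<^sup>2"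
  have eq: "(\<integral>\<^sup>+ x. ennreal ((cmod (u t x - \<sigma> N (t, x)))\<^sup>2) \<partial>torus) = ennreal (?d N t)" if "t \<in> I" for N t
    using fejer_mean_error(1)[OF u_L2[OF that], of N]
    by (subst nn_integral_eq_integral[symmetric]) (auto simp: \<sigma>_def)
  have m1: "(\<lambda>t. \<integral>\<^sup>+ x. ennreal ((cmod (u t x - \<sigma> N (t, x)))\<^sup>2) \<partial>torus) \<in> borel_measurable (time I)" for N
    using measurable_nn_integral_slab(2)[of I "\<lambda>z. ennreal ((cmod (W z - \<sigma> N z))\<^sup>2)"] by simp
  have m2: "(\<lambda>t. \<integral>\<^sup>+ x. ennreal ((cmod (u t x))\<^sup>2) \<partial>torus) \<in> borel_measurable (time I)"
    using measurable_nn_integral_slab(2)[of I "\<lambda>z. ennreal ((cmod (W z))\<^sup>2)"] by simp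
  have "(\<lambda>N. \<integral>\<^sup>+ t. \<integral>\<^sup>+ x. ennreal ((cmod (u t x - \<sigma> N (t, x)))\<^sup>2) \<partial>torus \<partial>time I) \<longlonglongrightarrow> (\<integral>\<^sup>+ t. 0 \<partial>time I)"
  proof (rule nn_integral_dominated_convergence[where w = "\<lambda>t. 2 * (\<integral>\<^sup>+ x. ennreal ((cmod (u t x))\<^sup>2) \<partial>torus)"])
    show "AE t in time I. (\<integral>\<^sup>+ x. ennreal ((cmod (u t x - \<sigma> N (t, x)))\<^sup>2) \<partial>torus) \<le> 2 * (\<integral>\<^sup>+ x. ennreal ((cmod (u t x))\<^sup>2) \<partial>torus)" for N
    proof (rule AE_I2)
      fix t assume "t \<in> space (time I)"
      then have t: "t \<in> I" by (simp add: space_restrict_space)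
      have "(\<integral>\<^sup>+ x. ennreal ((cmod (u t x))\<^sup>2) \<partial>torus) = ennreal ((L2_norm_torus (u t))\<^sup>2)"
        using u_L2[OF t] by (subst nn_integral_eq_integral) (auto simp: L2_torus_def L2_norm_torus_def)
      then have "2 * (\<integral>\<^sup>+ x. ennreal ((cmod (u t x))\<^sup>2) \<partial>torus) = ennreal (2 * (L2_norm_torus (u t))\<^sup>2)"
        by (simp add: ennreal_mult)
      then show "(\<integral>\<^sup>+ x. ennreal ((cmod (u t x - \<sigma> N (t, x)))\<^sup>2) \<partial>torus) \<le> 2 * (\<integral>\<^sup>+ x. ennreal ((cmod (u t x))\<^sup>2) \<partial>torus)"
        unfolding eq[OF t] using fejer_mean_error(2)[OF u_L2[OF t]] by (auto intro: ennreal_leI)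
    qed
    have "(\<integral>\<^sup>+ t. 2 * (\<integral>\<^sup>+ x. ennreal ((cmod (u t x))\<^sup>2) \<partial>torus) \<partial>time I) = 2 * (\<integral>\<^sup>+ z. ennreal ((cmod (W z))\<^sup>2) \<partial>slab I)"
      using m2 by (subst nn_integral_slab(2)) (auto simp: nn_integral_cmult)
    also have "\<dots> < \<infinity>"
      using integrable_W2 by (auto simp: integrable_iff_bounded ennreal_mult_less_top)
    finally show "(\<integral>\<^sup>+ t. 2 * (\<integral>\<^sup>+ x. ennreal ((cmod (u t x))\<^sup>2) \<partial>torus) \<partial>time I) < \<infinity>" .
    show "AE t in time I. (\<lambda>N. \<integral>\<^sup>+ x. ennreal ((cmod (u t x - \<sigma> N (t, x)))\<^sup>2) \<partial>torus) \<longlonglongrightarrow> 0"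
    proof (rule AE_I2)
      fix t assume "t \<in> space (time I)"
      then have t: "t \<in> I" by (simp add: space_restrict_space)
      have "(\<lambda>N. ennreal (?d N t)) \<longlonglongrightarrow> ennreal 0"
        by (intro tendsto_ennrealI fejer_mean_error(3) u_L2 t)
      then show "(\<lambda>N. \<integral>\<^sup>+ x. ennreal ((cmod (u t x - \<sigma> N (t, x)))\<^sup>2) \<partial>torus) \<longlonglongrightarrow> 0"
        unfolding eq[OF t] by simp
    qed
  qed (use m1 m2 in auto)
  moreover have "(\<integral>\<^sup>+ z. ennreal ((cmod (W z - \<sigma> N z))\<^sup>2) \<partial>slab I) =
    (\<integral>\<^sup>+ t. \<integral>\<^sup>+ x. ennreal ((cmod (u t x - \<sigma> N (t, x)))\<^sup>2) \<partial>torus \<partial>time I)" for N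
    by (subst nn_integral_slab(2)) auto
  ultimately show ?thesis by simp
qed

text \<open>Truncation in height is possible because the essential supremum in \<open>t\<close> is taken for fixed \<open>x\<close>:
  where it is at most \<open>n\<close>, nothing is cut off.\<close>

definition a_above :: "nat \<Rightarrow> real \<Rightarrow> real \<Rightarrow> real" where
  "a_above n t x = (if \<bar>a t x\<bar> > real n then a t x else 0)"

lemma measurable_a_above: "(\<lambda>(t, x). a_above n t x) \<in> borel_measurable (slab I)"
proof -
  have "(\<lambda>z. if \<bar>A z\<bar> > real n then A z else 0) \<in> borel_measurable (slab I)" by measurable
  then show ?thesis by (simp add: a_above_def split_beta')
qed

lemma LIMSEQ_a_above: "(\<lambda>n. norm_L1x_Linft I (a_above n)) \<longlonglongrightarrow> 0"
proof -
  let ?L = "linft_t I a"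
  have Lm: "?L \<in> borel_measurable torus" by (rule measurable_linft_t[OF _ a_measurable]) simp
  have secm: "(\<lambda>t. ennreal \<bar>a_above n t x\<bar>) \<in> borel_measurable (time I)" if "x \<in> space torus" for n x
    using measurable_slab_section[OF _ measurable_a_above that, of n] by simp
  have le: "linft_t I (a_above n) x \<le> ?L x" if "x \<in> space torus" for n x
    unfolding linft_t_def[of I "a_above n"]
    by (rule esssup_I[OF secm[OF that]]) (use AE_linft_t[where I = I and f = a and x = x] in \<open>auto simp: a_above_def elim: eventually_mono\<close>)
  have zero: "linft_t I (a_above n) x = 0" if x: "x \<in> space torus" and n: "?L x \<le> ennreal (real n)" for n x
  proof -
    have "linft_t I (a_above n) x \<le> 0"
      unfolding linft_t_def[of I "a_above n"]
    proof (rule esssup_I[OF secm[OF x]])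
      show "AE t in time I. ennreal \<bar>a_above n t x\<bar> \<le> 0"
        using AE_linft_t[where I = I and f = a and x = x]
      proof eventually_elim
        case (elim t)
        then have "ennreal \<bar>a t x\<bar> \<le> ennreal (real n)" using n by (rule order_trans)
        then show ?case by (simp add: a_above_def)
      qed
    qed
    then show ?thesis by simp
  qed
  have "(\<lambda>n. \<integral>\<^sup>+ x. linft_t I (a_above n) x \<partial>torus) \<longlonglongrightarrow> (\<integral>\<^sup>+ x. 0 \<partial>torus)"
  \<comment> \<open>For almost every x the essential supremum is finite, so the truncated part
    vanishes at x once n exceeds it.\<close>
  proof (rule nn_integral_dominated_convergence[where w = ?L])
    show "(\<integral>\<^sup>+ x. ?L x \<partial>torus) < \<infinity>" using a_finite by (simp add: norm_L1x_Linft_eq)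
    then have "AE x in torus. ?L x \<noteq> \<infinity>" using Lm by (intro nn_integral_PInf_AE) auto
    then show "AE x in torus. (\<lambda>n. linft_t I (a_above n) x) \<longlonglongrightarrow> 0"
      using AE_space
    proof eventually_elim
      case (elim x)
      then obtain r where r: "?L x = ennreal r" "r \<ge> 0" by (cases "?L x") auto
      obtain n\<^sub>0 :: nat where "r \<le> real n\<^sub>0" using real_arch_simple by blast
      then have "linft_t I (a_above n) x = 0" if "n \<ge> n\<^sub>0" for n
        using that r by (intro zero elim(2)) (auto intro!: ennreal_leI)
      then have "eventually (\<lambda>n. linft_t I (a_above n) x = 0) sequentially"
        by (auto simp: eventually_sequentially)
      then show ?case by (rule tendsto_eventually)
    qed
    show "AE x in torus. linft_t I (a_above n) x \<le> ?L x" for n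
      by (rule AE_I2) (rule le)
  qed (use Lm measurable_linft_t[OF _ measurable_a_above] in auto)
  then show ?thesis by (simp add: norm_L1x_Linft_eq)
qed

text \<open>Convergence in space-time L^2 does not pass to an unbounded weight. The part of
  \<open>a\<close> of height at most n is handled by that convergence; the rest is small in L^1_x
  L^inf_t and meets an error that is bounded in L^inf_x L^2_t uniformly in N. So n is fixed before
  N.\<close>

lemma LIMSEQ_\<sigma>_weighted: "(\<lambda>N. \<integral>\<^sup>+ z. ennreal \<bar>A z\<bar> * ennreal ((cmod (W z - \<sigma> N z))\<^sup>2) \<partial>slab I) \<longlonglongrightarrow> 0"
proof (rule order_tendstoI)
  fix e :: ennreal assume "0 < e"
  \<comment> \<open>The bound e may be infinite, so a positive real number below it is fixed
    first.\<close>
  then obtain e' where e': "0 < e'" "ennreal e' < e"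
  proof -
    obtain y where y: "0 < y" "y < e" using dense[OF \<open>0 < e\<close>] by blast
    then have "y < top" by (meson less_trans less_top top.not_eq_extremum order_less_le_trans top_greatest)
    then have "ennreal (enn2real y) = y" by (rule ennreal_enn2real)
    then show ?thesis using y by (intro that[of "enn2real y"]) (simp_all add: enn2real_positive_iff \<open>y < top\<close>)
  qed
  let ?E = "\<lambda>N z. ennreal ((cmod (W z - \<sigma> N z))\<^sup>2)"
  have bound: "AE x in torus. (\<integral>\<^sup>+ t. ?E N (t, x) \<partial>time I) \<le> ennreal (4 * M)" for N
    using u_bound AE_space
  proof eventually_elim
    case (elim x)
    have m: "(\<lambda>t. ennreal ((cmod (u t x))\<^sup>2)) \<in> borel_measurable (time I)"
      "(\<lambda>t. ennreal ((cmod (\<sigma> N (t, x)))\<^sup>2)) \<in> borel_measurable (time I)"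
      using measurable_slab_section[OF _ W_measurable elim(2)] measurable_slab_section[OF _ measurable_\<sigma> elim(2), of N] by simp_all
    have "(\<integral>\<^sup>+ t. ?E N (t, x) \<partial>time I) \<le> (\<integral>\<^sup>+ t. 2 * ennreal ((cmod (u t x))\<^sup>2) + 2 * ennreal ((cmod (\<sigma> N (t, x)))\<^sup>2) \<partial>time I)"
    proof (rule nn_integral_mono)
      fix t
      have "?E N (t, x) \<le> ennreal (2 * (cmod (u t x))\<^sup>2 + 2 * (cmod (\<sigma> N (t, x)))\<^sup>2)"
        using cmod_diff_square_le[of "u t x" "\<sigma> N (t, x)"] by (intro ennreal_leI) simp
      also have "\<dots> = 2 * ennreal ((cmod (u t x))\<^sup>2) + 2 * ennreal ((cmod (\<sigma> N (t, x)))\<^sup>2)"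
        by (simp add: ennreal_plus ennreal_mult)
      finally show "?E N (t, x) \<le> 2 * ennreal ((cmod (u t x))\<^sup>2) + 2 * ennreal ((cmod (\<sigma> N (t, x)))\<^sup>2)" .
    qed
    also have "\<dots> = 2 * (\<integral>\<^sup>+ t. ennreal ((cmod (u t x))\<^sup>2) \<partial>time I) + 2 * (\<integral>\<^sup>+ t. ennreal ((cmod (\<sigma> N (t, x)))\<^sup>2) \<partial>time I)"
      using m by (simp add: nn_integral_add nn_integral_cmult)
    also have "\<dots> \<le> 2 * ennreal M + 2 * ennreal M"
      using elim(1) \<sigma>_bound by (intro add_mono mult_left_mono) auto
    also have "\<dots> = ennreal (2 * M) + ennreal (2 * M)"
      using M by (simp add: ennreal_mult)
    also have "\<dots> = ennreal (4 * M)"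
      using M by (subst ennreal_plus[symmetric]) auto
    finally show ?case .
  qed
  \<comment> \<open>The tall part of \<open>a\<close> may use half of e'; the added 1 covers M =
    0.\<close>
  define \<delta> where "\<delta> = e' / 2 / (4 * M + 1)"
  have \<delta>: "\<delta> > 0" "\<delta> * (4 * M) \<le> e' / 2"
    using e' M by (auto simp: \<delta>_def field_simps)
  have "eventually (\<lambda>n. norm_L1x_Linft I (a_above n) < ennreal \<delta>) sequentially"
    using LIMSEQ_a_above by (rule order_tendstoD(2)) (use \<delta> in simp)
  then obtain n where n: "norm_L1x_Linft I (a_above n) < ennreal \<delta>"
    by (auto simp: eventually_sequentially)
  \<comment> \<open>The other half of e' is for the part of height at most n; the added 1 covers n =
    0.\<close>
  define \<eta> where "\<eta> = e' / 2 / (real n + 1)"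
  have \<eta>: "\<eta> > 0" "real n * \<eta> \<le> e' / 2"
    using e' by (auto simp: \<eta>_def field_simps)
  have "eventually (\<lambda>N. (\<integral>\<^sup>+ z. ?E N z \<partial>slab I) < ennreal \<eta>) sequentially"
    using LIMSEQ_\<sigma>_L2 by (rule order_tendstoD(2)) (use \<eta> in simp)
  then show "eventually (\<lambda>N. (\<integral>\<^sup>+ z. ennreal \<bar>A z\<bar> * ?E N z \<partial>slab I) < e) sequentially"
  proof eventually_elim
    case (elim N)
    have am [measurable]: "(\<lambda>z. a_above n (fst z) (snd z)) \<in> borel_measurable (slab I)"
      using measurable_a_above by (simp add: split_beta')
    have "(\<integral>\<^sup>+ z. ennreal \<bar>A z\<bar> * ?E N z \<partial>slab I) \<le>
      (\<integral>\<^sup>+ z. ennreal (real n) * ?E N z + ennreal \<bar>a_above n (fst z) (snd z)\<bar> * ?E N z \<partial>slab I)"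
    proof (rule nn_integral_mono)
      fix z
      have "ennreal \<bar>A z\<bar> \<le> ennreal (real n + \<bar>a_above n (fst z) (snd z)\<bar>)"
        by (intro ennreal_leI) (auto simp: a_above_def)
      also have "\<dots> = ennreal (real n) + ennreal \<bar>a_above n (fst z) (snd z)\<bar>"
        by (rule ennreal_plus) auto
      finally have "ennreal \<bar>A z\<bar> * ?E N z \<le> (ennreal (real n) + ennreal \<bar>a_above n (fst z) (snd z)\<bar>) * ?E N z"
        by (rule mult_right_mono) simp
      then show "ennreal \<bar>A z\<bar> * ?E N z \<le> ennreal (real n) * ?E N z + ennreal \<bar>a_above n (fst z) (snd z)\<bar> * ?E N z"
        by (simp only: distrib_right)
    qed
    also have "\<dots> = ennreal (real n) * (\<integral>\<^sup>+ z. ?E N z \<partial>slab I) + (\<integral>\<^sup>+ z. ennreal \<bar>a_above n (fst z) (snd z)\<bar> * ?E N z \<partial>slab I)"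
      by (subst nn_integral_add) (auto simp: nn_integral_cmult)
    also have "\<dots> \<le> ennreal (real n) * ennreal \<eta> + norm_L1x_Linft I (a_above n) * ennreal (4 * M)"
      using elim bound by (intro add_mono mult_left_mono holder_L1x_Linft measurable_a_above) auto
    also have "\<dots> \<le> ennreal (real n) * ennreal \<eta> + ennreal \<delta> * ennreal (4 * M)"
      using n by (intro add_mono mult_right_mono) auto
    also have "\<dots> = ennreal (real n * \<eta> + \<delta> * (4 * M))"
      using \<eta> \<delta> M by (simp add: ennreal_plus ennreal_mult)
    also have "\<dots> \<le> ennreal e'"
      using \<eta> \<delta> by (intro ennreal_leI) linarith
    also have "\<dots> < e" by (rule e')
    finally show ?case .
  qed
qed simp

text \<open>Testing with the Fejer mean gives the exact law for the weighted coefficients. Replacing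
  the mean by u itself costs a |u| |u - \<sigma>|, which Young's inequality splits with a parameter
  l. Letting N tend to infinity at fixed l removes the error, and then l tends to 0.\<close>

theorem energy_inequality: "(L2_norm_torus (u T))\<^sup>2 + 2 * dissipation \<le> (L2_norm_torus (u 0))\<^sup>2"
proof -
  have L2: "u T \<in> L2_torus" "u 0 \<in> L2_torus" using u_L2 T by auto
  let ?X = "\<lambda>N. LINT z|slab I. \<bar>A z\<bar> * (cmod (W z - \<sigma> N z))\<^sup>2"
  have iX: "integrable (slab I) (\<lambda>z. \<bar>A z\<bar> * (cmod (W z - \<sigma> N z))\<^sup>2)" for N
  proof (rule Bochner_Integration.integrable_bound)
    have i\<sigma>: "integrable (slab I) (\<lambda>z. \<bar>A z\<bar> * (cmod (\<sigma> N z))\<^sup>2)"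
    proof -
      have "(\<integral>\<^sup>+ z. ennreal \<bar>A z\<bar> * ennreal ((cmod (\<sigma> N z))\<^sup>2) \<partial>slab I) \<le> norm_L1x_Linft I a * ennreal M"
        by (rule nn_integral_weighted_le) (use \<sigma>_bound in auto)
      also have "\<dots> < \<infinity>" using a_finite by (simp add: ennreal_mult_less_top)
      finally show ?thesis by (intro integrableI_bounded) (auto simp: ennreal_mult)
    qed
    show "integrable (slab I) (\<lambda>z. 2 * (\<bar>A z\<bar> * (cmod (W z))\<^sup>2) + 2 * (\<bar>A z\<bar> * (cmod (\<sigma> N z))\<^sup>2))"
      using i\<sigma> integrable_aW2 by simp
    show "AE z in slab I. norm (\<bar>A z\<bar> * (cmod (W z - \<sigma> N z))\<^sup>2) \<le> norm (2 * (\<bar>A z\<bar> * (cmod (W z))\<^sup>2) + 2 * (\<bar>A z\<bar> * (cmod (\<sigma> N z))\<^sup>2))"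
    proof (rule AE_I2)
      fix z
      have "\<bar>A z\<bar> * (cmod (W z - \<sigma> N z))\<^sup>2 \<le> \<bar>A z\<bar> * (2 * (cmod (W z))\<^sup>2 + 2 * (cmod (\<sigma> N z))\<^sup>2)"
        by (intro mult_left_mono cmod_diff_square_le) auto
      then show "norm (\<bar>A z\<bar> * (cmod (W z - \<sigma> N z))\<^sup>2) \<le> norm (2 * (\<bar>A z\<bar> * (cmod (W z))\<^sup>2) + 2 * (\<bar>A z\<bar> * (cmod (\<sigma> N z))\<^sup>2))"
        by (simp add: algebra_simps)
    qed
  qed measurable
  have "(\<lambda>N. enn2real (\<integral>\<^sup>+ z. ennreal \<bar>A z\<bar> * ennreal ((cmod (W z - \<sigma> N z))\<^sup>2) \<partial>slab I)) \<longlonglongrightarrow> 0"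
    by (rule tendsto_enn2real) (use LIMSEQ_\<sigma>_weighted in simp_all)
  moreover have "enn2real (\<integral>\<^sup>+ z. ennreal \<bar>A z\<bar> * ennreal ((cmod (W z - \<sigma> N z))\<^sup>2) \<partial>slab I) = ?X N" for N
    by (subst integral_eq_nn_integral) (auto simp: ennreal_mult)
  ultimately have X0: "?X \<longlonglongrightarrow> 0" by simp
  have step: "2 * pi * (\<Sum>k\<in>{- int N..int N}. fejer N k * (cmod (coef k T))\<^sup>2) \<le>
      (L2_norm_torus (u 0))\<^sup>2 - 2 * dissipation + l * dissipation + ?X N / l" if l: "l > 0" for N l
  proof -
    let ?F = "{- int N..int N}"
    have i\<sigma>: "integrable (slab I) (\<lambda>z. G z * cnj (\<sigma> N z))"
    proof -
      have "integrable (slab I) (\<lambda>z. \<Sum>k\<in>?F. of_real (fejer N k) * (G z * cnj (coef k (fst z) * mode k (snd z))))"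
        by (intro Bochner_Integration.integrable_sum integrable_mult_right integrable_G_coef_mode)
      then show ?thesis by (simp add: \<sigma>_eq sum_distrib_left mult_ac)
    qed
    have "dissipation - (l / 2 * dissipation + ?X N / (2 * l)) =
      (LINT z|slab I. \<bar>A z\<bar> * (cmod (W z))\<^sup>2 - (l / 2 * (\<bar>A z\<bar> * (cmod (W z))\<^sup>2) + \<bar>A z\<bar> * (cmod (W z - \<sigma> N z))\<^sup>2 / (2 * l)))"
      unfolding dissipation_def using integrable_aW2 iX[of N] by simp
    also have "\<dots> \<le> (LINT z|slab I. Re (G z * cnj (\<sigma> N z)))"
    proof (rule integral_mono_AE)
      show "integrable (slab I) (\<lambda>z. \<bar>A z\<bar> * (cmod (W z))\<^sup>2 - (l / 2 * (\<bar>A z\<bar> * (cmod (W z))\<^sup>2) + \<bar>A z\<bar> * (cmod (W z - \<sigma> N z))\<^sup>2 / (2 * l)))"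
        using integrable_aW2 iX[of N] by simp
      show "integrable (slab I) (\<lambda>z. Re (G z * cnj (\<sigma> N z)))" using i\<sigma> by (rule integrable_Re)
      show "AE z in slab I. \<bar>A z\<bar> * (cmod (W z))\<^sup>2 - (l / 2 * (\<bar>A z\<bar> * (cmod (W z))\<^sup>2) + \<bar>A z\<bar> * (cmod (W z - \<sigma> N z))\<^sup>2 / (2 * l)) \<le> Re (G z * cnj (\<sigma> N z))"
        using a_nonneg
      proof eventually_elim
        case (elim z)
        let ?w = "W z" and ?d = "W z - \<sigma> N z"
        have "Re (?w * cnj ?d) \<le> cmod ?w * cmod ?d"
          by (metis complex_Re_le_cmod norm_mult complex_mod_cnj)
        also have "\<dots> \<le> l / 2 * (cmod ?w)\<^sup>2 + (cmod ?d)\<^sup>2 / (2 * l)"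
        proof -
          have "0 \<le> (l * cmod ?w - cmod ?d)\<^sup>2" by simp
          also have "\<dots> = 2 * l * (l / 2 * (cmod ?w)\<^sup>2 + (cmod ?d)\<^sup>2 / (2 * l) - cmod ?w * cmod ?d)"
            using l by (simp add: power2_diff field_simps power2_eq_square)
          finally show ?thesis using l by (simp add: zero_le_mult_iff)
        qed
        finally have "(cmod ?w)\<^sup>2 - (l / 2 * (cmod ?w)\<^sup>2 + (cmod ?d)\<^sup>2 / (2 * l)) \<le> (cmod ?w)\<^sup>2 - Re (?w * cnj ?d)"
          by simp
        also have "\<dots> = Re (?w * cnj (\<sigma> N z))"
          unfolding cmod_power2 by (simp add: power2_eq_square algebra_simps)
        finally have "A z * ((cmod ?w)\<^sup>2 - (l / 2 * (cmod ?w)\<^sup>2 + (cmod ?d)\<^sup>2 / (2 * l))) \<le> A z * Re (?w * cnj (\<sigma> N z))"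
          using elim by (rule mult_left_mono)
        then show ?case using elim by (simp add: algebra_simps)
      qed
    qed
    also have "\<dots> = Re (LINT z|slab I. G z * cnj (\<sigma> N z))"
      using i\<sigma> by (rule integral_Re)
    finally have E: "dissipation - (l / 2 * dissipation + ?X N / (2 * l)) \<le> Re (LINT z|slab I. G z * cnj (\<sigma> N z))" .
    have "(\<Sum>k\<in>?F. fejer N k * (cmod (coef k 0))\<^sup>2) \<le> (\<Sum>k\<in>?F. (cmod (coef k 0))\<^sup>2)"
      using fejer_bounds by (intro sum_mono mult_left_le_one_le) auto
    then have "2 * pi * (\<Sum>k\<in>?F. fejer N k * (cmod (coef k 0))\<^sup>2) \<le> 2 * pi * (\<Sum>k\<in>?F. (cmod (coef k 0))\<^sup>2)"
      by (intro mult_left_mono) auto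
    also have "\<dots> \<le> (L2_norm_torus (u 0))\<^sup>2"
      unfolding coef_def by (rule sum_fourier_coeff_le[OF L2(2)]) simp
    finally have "2 * pi * (\<Sum>k\<in>?F. fejer N k * (cmod (coef k T))\<^sup>2) \<le> (L2_norm_torus (u 0))\<^sup>2 - 2 * Re (LINT z|slab I. G z * cnj (\<sigma> N z))"
      using energy_multiplier[of ?F "fejer N"] by (simp add: \<sigma>_eq)
    moreover have "?X N / (2 * l) = (?X N / l) / 2" by simp
    moreover have "l / 2 * dissipation = (l * dissipation) / 2" by simp
    ultimately show ?thesis using E by linarith
  qed
  have lim: "(L2_norm_torus (u T))\<^sup>2 \<le> (L2_norm_torus (u 0))\<^sup>2 - 2 * dissipation + l * dissipation" if l: "l > 0" for l
  proof (rule LIMSEQ_le)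
    show "(\<lambda>N. 2 * pi * (\<Sum>k\<in>{- int N..int N}. fejer N k * (cmod (coef k T))\<^sup>2)) \<longlonglongrightarrow> (L2_norm_torus (u T))\<^sup>2"
      unfolding coef_def by (rule LIMSEQ_fejer_energy[OF L2(1)])
    have "(\<lambda>N. (L2_norm_torus (u 0))\<^sup>2 - 2 * dissipation + l * dissipation + ?X N / l) \<longlonglongrightarrow> (L2_norm_torus (u 0))\<^sup>2 - 2 * dissipation + l * dissipation + 0 / l"
      using l by (intro tendsto_intros X0) auto
    then show "(\<lambda>N. (L2_norm_torus (u 0))\<^sup>2 - 2 * dissipation + l * dissipation + ?X N / l) \<longlonglongrightarrow> (L2_norm_torus (u 0))\<^sup>2 - 2 * dissipation + l * dissipation"
      by simp
    show "\<exists>N. \<forall>n\<ge>N. 2 * pi * (\<Sum>k\<in>{- int n..int n}. fejer n k * (cmod (coef k T))\<^sup>2) \<le> (L2_norm_torus (u 0))\<^sup>2 - 2 * dissipation + l * dissipation + ?X n / l"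
      using step[OF l] by blast
  qed
  have "(L2_norm_torus (u T))\<^sup>2 \<le> (L2_norm_torus (u 0))\<^sup>2 - 2 * dissipation"
  proof (rule field_le_epsilon)
    fix e :: real assume e: "e > 0"
    \<comment> \<open>The parameter l = e / (dissipation + 1) makes the loss at most e even if the
      dissipation is 0.\<close>
    have "e / (dissipation + 1) * dissipation \<le> e"
      using e dissipation_nonneg by (simp add: field_simps)
    then show "(L2_norm_torus (u T))\<^sup>2 \<le> (L2_norm_torus (u 0))\<^sup>2 - 2 * dissipation + e"
      using lim[of "e / (dissipation + 1)"] e dissipation_nonneg by simp
  qed
  then show ?thesis by simp
qed

end

section \<open>Decay of damped solutions\<close>

lemma box_sets: "I \<in> sets borel \<Longrightarrow> I \<times> {0..<2 * pi} \<in> sets (borel :: (real \<times> real) measure)"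
  unfolding borel_prod[symmetric] by auto

lemma AE_slab_iff:
  assumes "I \<in> sets borel"
  shows "(AE z in slab I. P z) \<longleftrightarrow> (AE z in lborel. z \<in> I \<times> {0..<2 * pi} \<longrightarrow> P z)"
  unfolding slab_def using box_sets[OF assms] by (subst AE_restrict_space_iff) auto

lemma AE_time_iff:
  assumes "I \<in> sets borel"
  shows "(AE t in time I. P t) \<longleftrightarrow> (AE t in lborel. t \<in> I \<longrightarrow> P t)"
  using assms by (subst AE_restrict_space_iff) auto

lemma measurable_slab_subset:
  assumes "f \<in> borel_measurable (slab J)" "I \<subseteq> J"
  shows "f \<in> borel_measurable (slab I)"
  using assms unfolding slab_def by (elim measurable_restrict_mono) auto

lemma norm_L1x_Linft_subset:
  assumes IJ: "I \<subseteq> J" "I \<in> sets borel" "J \<in> sets borel" and f: "(\<lambda>(t, x). f t x) \<in> borel_measurable (slab J)"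
  shows "norm_L1x_Linft I f \<le> norm_L1x_Linft J f"
  unfolding norm_L1x_Linft_eq
proof (rule nn_integral_mono)
  fix x assume x: "x \<in> space torus"
  have "(\<lambda>t. ennreal \<bar>f t x\<bar>) \<in> borel_measurable (time I)"
    using measurable_slab_section[OF IJ(2) measurable_slab_subset[OF f IJ(1)] x] by simp
  then show "linft_t I f x \<le> linft_t J f x"
    unfolding linft_t_def[of I]
  proof (rule esssup_I)
    show "AE t in time I. ennreal \<bar>f t x\<bar> \<le> linft_t J f x"
      using AE_linft_t[where I = J and f = f and x = x] IJ
      by (auto simp: AE_time_iff elim!: eventually_mono)
  qed
qed

lemma nn_integral_time_subset:
  assumes "I \<subseteq> J" "I \<in> sets borel" "J \<in> sets borel"
  shows "(\<integral>\<^sup>+ t. f t \<partial>time I) \<le> (\<integral>\<^sup>+ t. f t \<partial>time J)"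
  using assms by (subst (1 2) nn_integral_restrict_space) (auto intro!: nn_integral_mono simp: indicator_def)

section \<open>Restriction in time, distance from the free wave, observability of the damped
  flow\<close>

context damped_solution
begin

lemma restrict:
  assumes t: "0 \<le> t" "t \<le> T"
  shows "damped_solution p a u t M"
proof
  have sub: "{0..t} \<subseteq> I" using t by auto
  show "0 \<le> t" "0 \<le> M" using t M by auto
  show "(\<lambda>(t, x). a t x) \<in> borel_measurable (slab {0..t})" "(\<lambda>(t, x). u t x) \<in> borel_measurable (slab {0..t})"
    using a_measurable u_measurable by (auto intro: measurable_slab_subset[OF _ sub])
  show "AE z in slab {0..t}. 0 \<le> a (fst z) (snd z)"
    using a_nonneg sub by (auto simp: AE_slab_iff elim!: eventually_mono)
  show "norm_L1x_Linft {0..t} a < \<infinity>"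
    using norm_L1x_Linft_subset[OF sub _ _ a_measurable] a_finite by (auto intro: le_less_trans)
  show "u s \<in> L2_torus" if "s \<in> {0..t}" for s using that sub u_L2 by auto
  show "AE x in torus. (\<integral>\<^sup>+ s. ennreal ((cmod (u s x))\<^sup>2) \<partial>time {0..t}) \<le> ennreal M"
    using u_bound by eventually_elim (rule order_trans[OF nn_integral_time_subset[OF sub]]; simp)
  show "fourier_coeff (u s) k = propagator p s (fourier_coeff (u 0)) k -
        (LINT r:{0..s}|lborel. propagator p (s - r) (fourier_coeff (\<lambda>x. complex_of_real (a r x) * u r x)) k)"
    if "s \<in> {0..t}" for s k
    using that sub by (intro duhamel) auto
qed

lemma dissipation_restrict_le:
  assumes t: "0 \<le> t" "t \<le> T"
  shows "damped_solution.dissipation a u t \<le> dissipation"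
proof -
  interpret r: damped_solution p a u t M by (rule restrict[OF t])
  have "ennreal r.dissipation = (\<integral>\<^sup>+ z. ennreal (\<bar>A z\<bar> * (cmod (W z))\<^sup>2) \<partial>slab {0..t})"
    unfolding r.dissipation_def using r.integrable_aW2 by (intro nn_integral_eq_integral[symmetric]) auto
  also have "\<dots> \<le> (\<integral>\<^sup>+ z. ennreal (\<bar>A z\<bar> * (cmod (W z))\<^sup>2) \<partial>slab I)"
    unfolding slab_def using t box_sets[of "{0..t}"] box_sets[of I]
    by (subst (1 2) nn_integral_restrict_space) (auto intro!: nn_integral_mono simp: indicator_def)
  also have "\<dots> = ennreal dissipation"
    unfolding dissipation_def using integrable_aW2 by (intro nn_integral_eq_integral) auto
  finally show ?thesis using dissipation_nonneg by simp
qed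

lemma energy_decreasing:
  assumes "0 \<le> t" "t \<le> T"
  shows "L2_norm_torus (u t) \<le> L2_norm_torus (u 0)"
proof -
  interpret r: damped_solution p a u t M by (rule restrict[OF assms])
  have "(L2_norm_torus (u t))\<^sup>2 \<le> (L2_norm_torus (u 0))\<^sup>2"
    using r.energy_inequality r.dissipation_nonneg by simp
  moreover have "0 \<le> L2_norm_torus (u 0)" by (simp add: L2_norm_torus_def)
  ultimately show ?thesis by (rule power2_le_imp_le)
qed

text \<open>The source is tested against the free wave whose coefficients are those of the deviation itself.\<close>

lemma deviation_at_end:
  assumes p: "degree p > 0" and m: "T < 2 * pi * real m" and K: "norm_L1x_Linft I a \<le> ennreal K" "0 \<le> K" and S: "finite S"
  shows "(\<Sum>k\<in>S. (cmod (coef k T - cis (T * of_int (poly p k)) * coef k 0))\<^sup>2) \<le> (K * (2 * pi * m * degree p) + 1) / (4 * pi\<^sup>2) * dissipation"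
proof -
  interpret P: pair_sigma_finite "time I" torus by (rule pair_sigma_finite_slab)
  \<comment> \<open>Up to sign and a factor of modulus 1 this is the deviation of the k-th
    coefficient at time T.\<close>
  define F where "F k = (LINT s|lborel. rot k s)" for k
  define s where "s = (\<Sum>k\<in>S. (cmod (F k))\<^sup>2)"
  let ?V = "wavesum p S F"
  define B where "B = 2 * pi * m * degree p"
  have s0: "s \<ge> 0" and B0: "B \<ge> 0" by (auto simp: s_def B_def sum_nonneg)
  have dev: "cmod (coef k T - cis (T * of_int (poly p k)) * coef k 0) = cmod (F k)" for k
  proof -
    have "(LINT r|lborel. indicator {..T} r *\<^sub>R rot k r) = F k"
      unfolding F_def by (intro Bochner_Integration.integral_cong) (auto simp: rot_def indicator_def)
    then have "coef k T - cis (T * of_int (poly p k)) * coef k 0 = - (cis (T * of_int (poly p k)) * F k)"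
      using coef_eq[of T k] T by (simp add: algebra_simps)
    then show ?thesis by (simp add: norm_mult)
  qed
  have Gw: "integrable (slab I) (\<lambda>z. G z * cnj (wave p k z))" for k
    by (rule integrable_mult_bounded_complex[OF integrable_G, where K = 1]) auto
  have Fk: "2 * pi * F k = (LINT z|slab I. G z * cnj (wave p k z))" for k
  proof -
    have "F k = (LINT t|time I. cis (- (t * of_int (poly p k))) * src k t)"
      unfolding F_def rot_def by (subst integral_restrict_space) (auto simp: set_lebesgue_integral_def)
    also have "\<dots> = (LINT t|time I. (LINT x|torus. G (t, x) * cnj (wave p k (t, x))) / (2 * pi))"
    proof (intro Bochner_Integration.integral_cong refl)
      fix t
      have "cnj (wave p k (t, x)) = cis (- (t * of_int (poly p k))) * cnj (mode k x)" for x
        by (simp add: wave_def mode_def cis_cnj cis_mult algebra_simps)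
      then have "(LINT x|torus. G (t, x) * cnj (wave p k (t, x))) =
        (LINT x|torus. cis (- (t * of_int (poly p k))) * (complex_of_real (a t x) * u t x * cnj (mode k x)))"
        by (simp add: mult_ac)
      also have "\<dots> = cis (- (t * of_int (poly p k))) * (LINT x|torus. complex_of_real (a t x) * u t x * cnj (mode k x))"
        by (rule integral_mult_right_zero)
      finally show "cis (- (t * of_int (poly p k))) * src k t = (LINT x|torus. G (t, x) * cnj (wave p k (t, x))) / (2 * pi)"
        by (simp add: src_def fourier_coeff_eq)
    qed
    also have "\<dots> = (LINT z|slab I. G z * cnj (wave p k z)) / (2 * pi)"
      using P.integral_fst'[OF Gw[of k, unfolded slab_eq[symmetric]]] by (simp add: slab_eq)
    finally show ?thesis by simp
  qed
  have iV: "integrable (slab I) (\<lambda>z. G z * cnj (?V z))"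
  proof -
    have "integrable (slab I) (\<lambda>z. \<Sum>k\<in>S. cnj (F k) * (G z * cnj (wave p k z)))"
      by (intro Bochner_Integration.integrable_sum integrable_mult_right Gw)
    then show ?thesis by (simp add: wavesum_def sum_distrib_left mult_ac)
  qed
  have test: "2 * pi * s = Re (LINT z|slab I. G z * cnj (?V z))"
  proof -
    have "(LINT z|slab I. G z * cnj (?V z)) = (LINT z|slab I. (\<Sum>k\<in>S. cnj (F k) * (G z * cnj (wave p k z))))"
      by (intro Bochner_Integration.integral_cong refl) (simp add: wavesum_def sum_distrib_left mult_ac)
    also have "\<dots> = (\<Sum>k\<in>S. cnj (F k) * (LINT z|slab I. G z * cnj (wave p k z)))"
      using Gw by (subst Bochner_Integration.integral_sum) auto
    also have "\<dots> = (\<Sum>k\<in>S. of_real (2 * pi * (cmod (F k))\<^sup>2))"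
      unfolding Fk[symmetric] of_real_mult complex_norm_square by (intro sum.cong refl) (simp add: mult_ac)
    also have "\<dots> = of_real (2 * pi * s)"
      by (simp only: s_def sum_distrib_left of_real_sum)
    finally show ?thesis by (metis Re_complex_of_real)
  qed
  have aV: "(\<integral>\<^sup>+ z. ennreal (\<bar>A z\<bar> * (cmod (?V z))\<^sup>2) \<partial>slab I) \<le> ennreal (K * (B * s))"
  proof -
    have "(\<integral>\<^sup>+ z. ennreal (\<bar>A z\<bar> * (cmod (?V z))\<^sup>2) \<partial>slab I) = (\<integral>\<^sup>+ z. ennreal \<bar>A z\<bar> * ennreal ((cmod (?V z))\<^sup>2) \<partial>slab I)"
      by (simp add: ennreal_mult)
    also have "\<dots> \<le> norm_L1x_Linft I a * ennreal (B * s)"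
      using strichartz_weighted[OF p S m a_measurable] by (simp add: B_def s_def)
    also have "\<dots> \<le> ennreal K * ennreal (B * s)" by (intro mult_right_mono K) auto
    also have "\<dots> = ennreal (K * (B * s))" using K by (simp add: ennreal_mult')
    finally show ?thesis .
  qed
  have Vm [measurable]: "?V \<in> borel_measurable (slab I)" by measurable
  have iaV: "integrable (slab I) (\<lambda>z. \<bar>A z\<bar> * (cmod (?V z))\<^sup>2)"
    using le_less_trans[OF aV] by (intro integrableI_bounded) auto
  have vaV: "(LINT z|slab I. \<bar>A z\<bar> * (cmod (?V z))\<^sup>2) \<le> K * (B * s)"
    using aV K B0 s0 nn_integral_eq_integral[OF iaV] by simp
  \<comment> \<open>This value bounds the weighted energy of the test wave by pi s, half of the
    left-hand side 2 pi s, which absorbs it. The added 1 keeps the denominator positive.\<close>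
  define l where "l = 2 * pi / (K * B + 1)"
  have KB: "K * B + 1 > 0" using K B0 by (simp add: add_nonneg_pos)
  then have l: "l > 0" by (simp add: l_def)
  have "2 * pi * s \<le> (LINT z|slab I. (\<bar>A z\<bar> * (cmod (W z))\<^sup>2) / (2 * l) + l / 2 * (\<bar>A z\<bar> * (cmod (?V z))\<^sup>2))"
  proof -
    have "2 * pi * s = (LINT z|slab I. Re (G z * cnj (?V z)))"
      unfolding test by (rule integral_Re[OF iV, symmetric])
    also have "\<dots> \<le> (LINT z|slab I. (\<bar>A z\<bar> * (cmod (W z))\<^sup>2) / (2 * l) + l / 2 * (\<bar>A z\<bar> * (cmod (?V z))\<^sup>2))"
    proof (rule integral_mono)
      fix z
      have "Re (G z * cnj (?V z)) \<le> \<bar>A z\<bar> * (cmod (W z) * cmod (?V z))"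
        using complex_Re_le_cmod[of "G z * cnj (?V z)"] by (simp add: norm_mult mult_ac)
      also have "\<dots> \<le> \<bar>A z\<bar> * ((cmod (W z))\<^sup>2 / (2 * l) + l / 2 * (cmod (?V z))\<^sup>2)"
      proof (rule mult_left_mono)
        have "0 \<le> (cmod (W z) - l * cmod (?V z))\<^sup>2" by simp
        also have "\<dots> = 2 * l * ((cmod (W z))\<^sup>2 / (2 * l) + l / 2 * (cmod (?V z))\<^sup>2 - cmod (W z) * cmod (?V z))"
          using l by (simp add: power2_diff field_simps power2_eq_square)
        finally show "cmod (W z) * cmod (?V z) \<le> (cmod (W z))\<^sup>2 / (2 * l) + l / 2 * (cmod (?V z))\<^sup>2"
          using l by (simp add: zero_le_mult_iff)
      qed simp
      finally show "Re (G z * cnj (?V z)) \<le> (\<bar>A z\<bar> * (cmod (W z))\<^sup>2) / (2 * l) + l / 2 * (\<bar>A z\<bar> * (cmod (?V z))\<^sup>2)"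
        by (simp add: algebra_simps)
    next
      show "integrable (slab I) (\<lambda>z. Re (G z * cnj (?V z)))" by (rule integrable_Re[OF iV])
      show "integrable (slab I) (\<lambda>z. (\<bar>A z\<bar> * (cmod (W z))\<^sup>2) / (2 * l) + l / 2 * (\<bar>A z\<bar> * (cmod (?V z))\<^sup>2))"
        using integrable_aW2 iaV by simp
    qed
    finally show ?thesis .
  qed
  also have "\<dots> = dissipation / (2 * l) + l / 2 * (LINT z|slab I. \<bar>A z\<bar> * (cmod (?V z))\<^sup>2)"
    unfolding dissipation_def using integrable_aW2 iaV by simp
  also have "\<dots> \<le> dissipation / (2 * l) + l / 2 * (K * (B * s))"
    using vaV l by (intro add_left_mono mult_left_mono) auto
  also have "l / 2 * (K * (B * s)) \<le> pi * s"
  proof -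
    have "l / 2 = pi / (K * B + 1)" using KB by (simp add: l_def divide_eq_eq eq_divide_eq algebra_simps)
    then have "l / 2 * (K * (B * s)) = pi * s * (K * B / (K * B + 1))" by (simp only:) (simp only: times_divide_eq_left times_divide_eq_right mult_ac)
    also have "\<dots> \<le> pi * s * 1" using KB s0 by (intro mult_left_mono) (auto simp: divide_le_eq)
    finally show ?thesis by simp
  qed
  finally have "pi * s \<le> dissipation / (2 * l)" by simp
  also have "dissipation / (2 * l) = pi * ((K * B + 1) / (4 * pi\<^sup>2) * dissipation)"
    using KB by (simp add: l_def field_simps power2_eq_square)
  finally have "s \<le> (K * B + 1) / (4 * pi\<^sup>2) * dissipation"
    by (rule mult_left_le_imp_le) simp
  then show ?thesis by (simp add: s_def B_def dev)
qed

text \<open>The window is cut at t, where the preceding bound applies; both the norm of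
  \<open>a\<close> and the dissipation only decrease.\<close>

lemma deviation:
  assumes p: "degree p > 0" and m: "T < 2 * pi * real m" and K: "norm_L1x_Linft I a \<le> ennreal K" "0 \<le> K" and S: "finite S" and t: "t \<in> I"
  shows "(\<Sum>k\<in>S. (cmod (coef k t - cis (t * of_int (poly p k)) * coef k 0))\<^sup>2) \<le> (K * (2 * pi * m * degree p) + 1) / (4 * pi\<^sup>2) * dissipation"
proof -
  have t': "0 \<le> t" "t \<le> T" using t by auto
  interpret r: damped_solution p a u t M by (rule restrict[OF t'])
  have "norm_L1x_Linft {0..t} a \<le> ennreal K"
    using norm_L1x_Linft_subset[OF _ _ _ a_measurable, of "{0..t}"] t' K(1) by (auto intro: order_trans)
  then have "(\<Sum>k\<in>S. (cmod (coef k t - cis (t * of_int (poly p k)) * coef k 0))\<^sup>2) \<le> (K * (2 * pi * m * degree p) + 1) / (4 * pi\<^sup>2) * r.dissipation"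
    using r.deviation_at_end[OF p _ _ K(2) S, of m] m t' by (simp add: coef_def r.coef_def)
  also have "\<dots> \<le> (K * (2 * pi * m * degree p) + 1) / (4 * pi\<^sup>2) * dissipation"
    using K(2) by (intro mult_left_mono dissipation_restrict_le t') auto
  finally show ?thesis .
qed

text \<open>The wave with the initial coefficients is V = u - (u - V). In the part with u the capped
  weight is bounded by |a|, which yields the dissipation. In the part with u - V it is bounded by 1,
  so the unweighted deviation estimate applies, integrated over the window.\<close>

lemma damped_observability:
  assumes p: "degree p > 0" and m: "T < 2 * pi * real m" and K: "norm_L1x_Linft I a \<le> ennreal K" "0 \<le> K"
    and obs: "\<And>S c. finite S \<Longrightarrow> ennreal (\<kappa> * (\<Sum>k\<in>S. (cmod (c k))\<^sup>2)) \<le>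
      (\<integral>\<^sup>+ z. ennreal (min 1 \<bar>A z\<bar>) * ennreal ((cmod (wavesum p S c z))\<^sup>2) \<partial>slab I)"
    and \<kappa>: "\<kappa> > 0"
  shows "\<kappa> * (L2_norm_torus (u 0))\<^sup>2 \<le> 2 * pi * (2 + 4 * pi * T * ((K * (2 * pi * m * degree p) + 1) / (4 * pi\<^sup>2))) * dissipation"
proof -
  define C where "C = (K * (2 * pi * m * degree p) + 1) / (4 * pi\<^sup>2)"
  have C: "C \<ge> 0" using K by (simp add: C_def)
  interpret t: finite_measure "time I" by (rule finite_time)
  define V where "V N = wavesum p {- int N..int N} (\<lambda>k. coef k 0)" for N
  \<comment> \<open>The energy of \<open>u t\<close> above frequency N. The truncated wave
    \<open>V N\<close> has no such frequencies, so this energy belongs to the distance; its time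
    integral tends to 0 by Parseval and dominated convergence.\<close>
  define r where "r N t = (L2_norm_torus (u t))\<^sup>2 - 2 * pi * (\<Sum>k\<in>{- int N..int N}. (cmod (coef k t))\<^sup>2)" for N t
  have Vm [measurable]: "V N \<in> borel_measurable (slab I)" for N unfolding V_def by measurable
  have norm_eq: "(\<integral>\<^sup>+ x. ennreal ((cmod (u t x))\<^sup>2) \<partial>torus) = ennreal ((L2_norm_torus (u t))\<^sup>2)" if "t \<in> I" for t
    using u_L2[OF that] by (subst nn_integral_eq_integral) (auto simp: L2_torus_def L2_norm_torus_def)
  have normm [measurable]: "(\<lambda>t. (L2_norm_torus (u t))\<^sup>2) \<in> borel_measurable (time I)"
  proof -
    have "(\<lambda>t. enn2real (\<integral>\<^sup>+ x. ennreal ((cmod (u t x))\<^sup>2) \<partial>torus)) \<in> borel_measurable (time I)"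
      using measurable_nn_integral_slab(2)[of I "\<lambda>z. ennreal ((cmod (W z))\<^sup>2)"] by simp
    then show ?thesis
      by (rule measurable_cong[THEN iffD1, rotated]) (simp add: norm_eq space_restrict_space)
  qed
  have norm_int: "integrable (time I) (\<lambda>t. (L2_norm_torus (u t))\<^sup>2)"
  proof (rule integrableI_bounded)
    have "(\<integral>\<^sup>+ t. ennreal (norm ((L2_norm_torus (u t))\<^sup>2)) \<partial>time I) = (\<integral>\<^sup>+ t. \<integral>\<^sup>+ x. ennreal ((cmod (u t x))\<^sup>2) \<partial>torus \<partial>time I)"
      by (intro nn_integral_cong) (simp add: norm_eq space_restrict_space)
    also have "\<dots> = (\<integral>\<^sup>+ z. ennreal ((cmod (W z))\<^sup>2) \<partial>slab I)"
      by (subst nn_integral_slab(2)) auto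
    also have "\<dots> < \<infinity>" using integrable_W2 by (auto simp: integrable_iff_bounded)
    finally show "(\<integral>\<^sup>+ t. ennreal (norm ((L2_norm_torus (u t))\<^sup>2)) \<partial>time I) < \<infinity>" .
  qed measurable
  have r_bounds: "0 \<le> r N t" "r N t \<le> (L2_norm_torus (u t))\<^sup>2" if "t \<in> I" for N t
    using sum_fourier_coeff_le[OF u_L2[OF that], of "{- int N..int N}"] by (auto simp: r_def coef_def sum_nonneg)
  have rm [measurable]: "r N \<in> borel_measurable (time I)" for N
    unfolding r_def[abs_def] by measurable
  have r_int: "integrable (time I) (r N)" for N
    by (rule Bochner_Integration.integrable_bound[OF norm_int rm]) (use r_bounds in \<open>auto intro!: AE_I2 simp: space_restrict_space\<close>)
  have "(\<lambda>N. LINT t|time I. r N t) \<longlonglongrightarrow> (LINT t|time I. (0::real))"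
  proof (rule integral_dominated_convergence[OF _ _ norm_int])
    show "AE t in time I. (\<lambda>N. r N t) \<longlonglongrightarrow> 0"
    proof (rule AE_I2)
      fix t assume "t \<in> space (time I)"
      then have "t \<in> I" by (simp add: space_restrict_space)
      then have "(\<lambda>N. (L2_norm_torus (u t))\<^sup>2 - 2 * pi * (\<Sum>k\<in>{- int N..int N}. (cmod (fourier_coeff (u t) k))\<^sup>2)) \<longlonglongrightarrow> (L2_norm_torus (u t))\<^sup>2 - (L2_norm_torus (u t))\<^sup>2"
        by (intro tendsto_intros parseval_torus u_L2)
      then show "(\<lambda>N. r N t) \<longlonglongrightarrow> 0" by (simp add: r_def coef_def)
    qed
    show "AE t in time I. norm (r N t) \<le> (L2_norm_torus (u t))\<^sup>2" for N
      using r_bounds by (auto intro!: AE_I2 simp: space_restrict_space)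
  qed measurable
  then have r0: "(\<lambda>N. LINT t|time I. r N t) \<longlonglongrightarrow> 0" by simp
  have dist: "(\<integral>\<^sup>+ z. ennreal ((cmod (W z - V N z))\<^sup>2) \<partial>slab I) \<le> ennreal ((LINT t|time I. r N t) + 2 * pi * C * dissipation * T)" for N
  proof -
    let ?F = "{- int N..int N}"
    have "(\<integral>\<^sup>+ z. ennreal ((cmod (W z - V N z))\<^sup>2) \<partial>slab I) = (\<integral>\<^sup>+ t. \<integral>\<^sup>+ x. ennreal ((cmod (u t x - V N (t, x)))\<^sup>2) \<partial>torus \<partial>time I)"
      by (subst nn_integral_slab(2)) auto
    also have "\<dots> \<le> (\<integral>\<^sup>+ t. ennreal (r N t + 2 * pi * C * dissipation) \<partial>time I)"
    proof (rule nn_integral_mono)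
      fix t assume "t \<in> space (time I)"
      then have t: "t \<in> I" by (simp add: space_restrict_space)
      let ?d = "\<lambda>k. cis (t * of_int (poly p k)) * coef k 0"
      have V: "V N (t, x) = (\<Sum>k\<in>?F. ?d k * mode k x)" for x
        unfolding V_def wavesum_def by (intro sum.cong refl) (simp add: wave_def mode_def cis_mult algebra_simps flip: cis_mult)
      have "(\<integral>\<^sup>+ x. ennreal ((cmod (u t x - V N (t, x)))\<^sup>2) \<partial>torus) = ennreal (LINT x|torus. (cmod (u t x - (\<Sum>k\<in>?F. ?d k * mode k x)))\<^sup>2)"
        unfolding V using integral_cmod_square_diff_trig(1)[OF u_L2[OF t], of ?F ?d] by (intro nn_integral_eq_integral) auto
      also have "(LINT x|torus. (cmod (u t x - (\<Sum>k\<in>?F. ?d k * mode k x)))\<^sup>2) = r N t + 2 * pi * (\<Sum>k\<in>?F. (cmod (coef k t - ?d k))\<^sup>2)"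
        by (subst integral_cmod_square_diff_trig(2)[OF u_L2[OF t]]) (simp_all add: r_def coef_def)
      also have "\<dots> \<le> r N t + 2 * pi * (C * dissipation)"
        unfolding C_def by (intro add_left_mono mult_left_mono deviation[OF p m K _ t]) auto
      finally show "(\<integral>\<^sup>+ x. ennreal ((cmod (u t x - V N (t, x)))\<^sup>2) \<partial>torus) \<le> ennreal (r N t + 2 * pi * C * dissipation)"
        by (simp add: mult.assoc ennreal_leI)
    qed
    also have "\<dots> = ennreal (LINT t|time I. r N t + 2 * pi * C * dissipation)"
      using r_int[of N] r_bounds C dissipation_nonneg
      by (intro nn_integral_eq_integral) (auto intro!: AE_I2 add_nonneg_nonneg simp: space_restrict_space)
    also have "(LINT t|time I. r N t + 2 * pi * C * dissipation) = (LINT t|time I. r N t) + 2 * pi * C * dissipation * T"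
    proof -
      have "measure (time I) (space (time I)) = T"
        using T by (simp add: measure_restrict_space space_restrict_space)
      then show ?thesis using r_int[of N] by simp
    qed
    finally show ?thesis .
  qed
  have step: "\<kappa> * (\<Sum>k\<in>{- int N..int N}. (cmod (coef k 0))\<^sup>2) \<le> 2 * dissipation + 2 * ((LINT t|time I. r N t) + 2 * pi * C * dissipation * T)" for N
  proof -
    let ?R = "LINT t|time I. r N t"
    have R0: "0 \<le> ?R" using r_bounds by (intro Bochner_Integration.integral_nonneg) (auto simp: space_restrict_space)
    have "ennreal (\<kappa> * (\<Sum>k\<in>{- int N..int N}. (cmod (coef k 0))\<^sup>2)) \<le> (\<integral>\<^sup>+ z. ennreal (min 1 \<bar>A z\<bar>) * ennreal ((cmod (V N z))\<^sup>2) \<partial>slab I)"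
      unfolding V_def by (rule obs) simp
    also have "\<dots> \<le> (\<integral>\<^sup>+ z. 2 * ennreal (\<bar>A z\<bar> * (cmod (W z))\<^sup>2) + 2 * ennreal ((cmod (W z - V N z))\<^sup>2) \<partial>slab I)"
    proof (rule nn_integral_mono)
      fix z
      have "(cmod (V N z))\<^sup>2 \<le> 2 * (cmod (W z))\<^sup>2 + 2 * (cmod (W z - V N z))\<^sup>2"
        using cmod_diff_square_le[of "W z" "W z - V N z"] by simp
      then have "min 1 \<bar>A z\<bar> * (cmod (V N z))\<^sup>2 \<le> min 1 \<bar>A z\<bar> * (2 * (cmod (W z))\<^sup>2 + 2 * (cmod (W z - V N z))\<^sup>2)"
        by (intro mult_left_mono) auto
      also have "\<dots> = 2 * (min 1 \<bar>A z\<bar> * (cmod (W z))\<^sup>2) + 2 * (min 1 \<bar>A z\<bar> * (cmod (W z - V N z))\<^sup>2)"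
        by (simp add: algebra_simps)
      also have "\<dots> \<le> 2 * (\<bar>A z\<bar> * (cmod (W z))\<^sup>2) + 2 * (1 * (cmod (W z - V N z))\<^sup>2)"
        by (intro add_mono mult_left_mono mult_right_mono) auto
      finally have "ennreal (min 1 \<bar>A z\<bar> * (cmod (V N z))\<^sup>2) \<le> ennreal (2 * (\<bar>A z\<bar> * (cmod (W z))\<^sup>2) + 2 * (1 * (cmod (W z - V N z))\<^sup>2))"
        by (rule ennreal_leI)
      then show "ennreal (min 1 \<bar>A z\<bar>) * ennreal ((cmod (V N z))\<^sup>2) \<le> 2 * ennreal (\<bar>A z\<bar> * (cmod (W z))\<^sup>2) + 2 * ennreal ((cmod (W z - V N z))\<^sup>2)"
        by (simp add: ennreal_mult ennreal_plus)
    qed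
    also have "\<dots> = 2 * (\<integral>\<^sup>+ z. ennreal (\<bar>A z\<bar> * (cmod (W z))\<^sup>2) \<partial>slab I) + 2 * (\<integral>\<^sup>+ z. ennreal ((cmod (W z - V N z))\<^sup>2) \<partial>slab I)"
      by (subst nn_integral_add) (auto simp: nn_integral_cmult)
    also have "(\<integral>\<^sup>+ z. ennreal (\<bar>A z\<bar> * (cmod (W z))\<^sup>2) \<partial>slab I) = ennreal dissipation"
      unfolding dissipation_def using integrable_aW2 by (intro nn_integral_eq_integral) auto
    also have "2 * ennreal dissipation + 2 * (\<integral>\<^sup>+ z. ennreal ((cmod (W z - V N z))\<^sup>2) \<partial>slab I) \<le>
       2 * ennreal dissipation + 2 * ennreal (?R + 2 * pi * C * dissipation * T)"
      by (intro add_left_mono mult_left_mono dist) auto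
    also have "\<dots> = ennreal (2 * dissipation + 2 * (?R + 2 * pi * C * dissipation * T))"
    proof -
      have "2 * ennreal x + 2 * ennreal y = ennreal (2 * x + 2 * y)" if "0 \<le> x" "0 \<le> y" for x y
        using that by (simp add: ennreal_plus ennreal_mult)
      note double = this
      show ?thesis
        by (rule double) (use dissipation_nonneg R0 C T in simp_all)
    qed
    finally show ?thesis
      using dissipation_nonneg R0 C T by (subst (asm) ennreal_le_iff) auto
  qed
  have "\<kappa> * ((L2_norm_torus (u 0))\<^sup>2 / (2 * pi)) \<le> 2 * dissipation + 2 * (0 + 2 * pi * C * dissipation * T)"
  proof (rule LIMSEQ_le)
    have "(\<lambda>N. \<Sum>k\<in>{- int N..int N}. (cmod (coef k 0))\<^sup>2) \<longlonglongrightarrow> (L2_norm_torus (u 0))\<^sup>2 / (2 * pi)"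
      using tendsto_divide[OF parseval_torus[OF u_L2[of 0]] tendsto_const[of "2 * pi"]] T by (simp add: coef_def)
    then show "(\<lambda>N. \<kappa> * (\<Sum>k\<in>{- int N..int N}. (cmod (coef k 0))\<^sup>2)) \<longlonglongrightarrow> \<kappa> * ((L2_norm_torus (u 0))\<^sup>2 / (2 * pi))"
      by (intro tendsto_intros)
    show "(\<lambda>N. 2 * dissipation + 2 * ((LINT t|time I. r N t) + 2 * pi * C * dissipation * T)) \<longlonglongrightarrow> 2 * dissipation + 2 * (0 + 2 * pi * C * dissipation * T)"
      by (intro tendsto_intros r0)
  qed (use step in blast)
  then have "\<kappa> * (L2_norm_torus (u 0))\<^sup>2 \<le> 2 * pi * (2 + 4 * pi * T * C) * dissipation"
    by (simp add: field_simps)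
  then show ?thesis by (simp add: C_def)
qed

end


section \<open>Contraction over one window for all dampings near a given one\<close>

lemma local_contraction:
  fixes p :: "int poly"
  assumes p: "degree p \<ge> 2" and T: "T > 0"
    and b: "(\<lambda>(t, x). b t x) \<in> borel_measurable (slab {0..T})"
    and fin: "norm_L1x_Linft {0..T} b < \<infinity>" and nz: "norm_L1x_Linft {0..T} b \<noteq> 0"
  obtains r q where "r > 0" "0 < q" "q < 1"
    "\<And>a u M. damped_solution p a u T M \<Longrightarrow> norm_L1x_Linft {0..T} (\<lambda>t x. a t x - b t x) < ennreal r \<Longrightarrow>
      (L2_norm_torus (u T))\<^sup>2 \<le> q * (L2_norm_torus (u 0))\<^sup>2"
proof -
  \<comment> \<open>The window has to fit inside m whole periods.\<close>
  obtain m :: nat where "T / (2 * pi) < real m" using reals_Archimedean2 by blast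
  then have m: "T < 2 * pi * real m" by (simp add: divide_less_eq mult.commute)
  then have m0: "m > 0" using T by (cases m) auto
  obtain \<kappa> r where \<kappa>: "\<kappa> > 0" and r: "r > 0" and
    obs: "\<And>a S c. (\<lambda>(t, x). a t x) \<in> borel_measurable (slab {0..T}) \<Longrightarrow>
      norm_L1x_Linft {0..T} (\<lambda>t x. a t x - b t x) \<le> ennreal r \<Longrightarrow> finite S \<Longrightarrow>
      ennreal (\<kappa> * (\<Sum>k\<in>S. (cmod (c k))\<^sup>2)) \<le>
      (\<integral>\<^sup>+ z. ennreal (min 1 \<bar>a (fst z) (snd z)\<bar>) * ennreal ((cmod (wavesum p S c z))\<^sup>2) \<partial>slab {0..T})"
    by (rule observability_stable[OF p m m0 b nz]) blast
  \<comment> \<open>A bound valid for every damping within r of b, so the constants below are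
    uniform on the ball.\<close>
  define K where "K = enn2real (norm_L1x_Linft {0..T} b) + r"
  have K: "0 \<le> K" using r by (simp add: K_def)
  define C where "C = 2 * pi * (2 + 4 * pi * T * ((K * (2 * pi * m * degree p) + 1) / (4 * pi\<^sup>2)))"
  have C: "C > 0" unfolding C_def using K T by (intro mult_pos_pos add_pos_nonneg) auto
  \<comment> \<open>The maximum with 1/2 keeps q positive, since its logarithm determines the decay
    rate.\<close>
  define q where "q = max (1 / 2) (1 - 2 * (\<kappa> / C))"
  have q: "0 < q" "q < 1" using \<kappa> C by (auto simp: q_def)
  show ?thesis
  proof (rule that[OF r q])
    fix a u M
    assume "damped_solution p a u T M" and close: "norm_L1x_Linft {0..T} (\<lambda>t x. a t x - b t x) < ennreal r"
    then interpret damped_solution p a u T M by simp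
    have "norm_L1x_Linft {0..T} a \<le> norm_L1x_Linft {0..T} b + norm_L1x_Linft {0..T} (\<lambda>t x. a t x - b t x)"
      by (rule norm_L1x_Linft_triangle[OF _ a_measurable b]) simp
    also have "\<dots> \<le> norm_L1x_Linft {0..T} b + ennreal r"
      using close by (intro add_left_mono) simp
    also have "\<dots> = ennreal K"
      using fin r by (simp add: K_def ennreal_plus)
    finally have aK: "norm_L1x_Linft {0..T} a \<le> ennreal K" .
    have "\<kappa> * (L2_norm_torus (u 0))\<^sup>2 \<le> C * dissipation"
      unfolding C_def
      by (rule damped_observability[OF _ m aK K obs[OF a_measurable less_imp_le[OF close]] \<kappa>]) (use p in auto)
    then have "\<kappa> / C * (L2_norm_torus (u 0))\<^sup>2 \<le> dissipation"
      using C by (simp add: field_simps)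
    then have "(L2_norm_torus (u T))\<^sup>2 \<le> (1 - 2 * (\<kappa> / C)) * (L2_norm_torus (u 0))\<^sup>2"
    proof -
      have "(1 - 2 * (\<kappa> / C)) * (L2_norm_torus (u 0))\<^sup>2 = (L2_norm_torus (u 0))\<^sup>2 - 2 * (\<kappa> / C * (L2_norm_torus (u 0))\<^sup>2)"
        by (simp add: algebra_simps)
      then show "\<kappa> / C * (L2_norm_torus (u 0))\<^sup>2 \<le> dissipation \<Longrightarrow> ?thesis"
        using energy_inequality by linarith
    qed
    also have "\<dots> \<le> q * (L2_norm_torus (u 0))\<^sup>2"
      by (intro mult_right_mono) (auto simp: q_def)
    finally show "(L2_norm_torus (u T))\<^sup>2 \<le> q * (L2_norm_torus (u 0))\<^sup>2" .
  qed
qed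

section \<open>Translation in time and passage from mild solutions\<close>

lemma measurable_slab_shift:
  assumes I: "\<And>t. t \<in> I \<Longrightarrow> s + t \<in> J" and f: "f \<in> borel_measurable (slab J)"
  shows "(\<lambda>z. f (s + fst z, snd z)) \<in> borel_measurable (slab I)"
proof (rule measurable_compose[OF _ f])
  have "(\<lambda>z. (s + fst z, snd z)) \<in> borel_measurable (borel :: (real \<times> real) measure)"
    by (intro borel_measurable_continuous_onI continuous_intros)
  then show "(\<lambda>z. (s + fst z, snd z)) \<in> measurable (slab I) (slab J)"
    unfolding slab_def using I by (intro measurable_restrict_space3) auto
qed

lemma AE_slab_shift:
  assumes IJ: "I \<in> sets borel" "J \<in> sets borel" "\<And>t. t \<in> I \<Longrightarrow> s + t \<in> J" and P: "AE z in slab J. P z"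
  shows "AE z in slab I. P (s + fst z, snd z)"
proof -
  have "AE z in lborel. z \<in> J \<times> {0..<2 * pi} \<longrightarrow> P z"
    using P IJ by (simp add: AE_slab_iff)
  then have "AE z in distr lborel borel ((+) (s, 0)). z \<in> J \<times> {0..<2 * pi} \<longrightarrow> P z"
    by (simp only: lborel_distr_plus)
  then have "AE z in lborel. (s, 0) + z \<in> J \<times> {0..<2 * pi} \<longrightarrow> P ((s, 0) + z)"
    by (rule AE_distrD[rotated]) simp
  then show ?thesis
    unfolding AE_slab_iff[OF IJ(1)] by eventually_elim (use IJ(3) in \<open>auto simp: plus_prod_def\<close>)
qed

lemma set_integral_singleton_lborel:
  fixes f :: "real \<Rightarrow> 'b::{banach, second_countable_topology}"
  shows "(LINT s:{c..c}|lborel. f s) = 0"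
proof -
  have "AE s in lborel. s \<noteq> c" by (rule AE_lborel_singleton)
  then have "AE s in lborel. indicator {c..c} s *\<^sub>R f s = 0"
    by eventually_elim (simp add: indicator_def)
  then show ?thesis
    unfolding set_lebesgue_integral_def by (rule integral_eq_zero_AE)
qed

lemma mild_solution_imp_damped_solution:
  assumes u: "mild_solution p a u0 u" and a: "a \<in> L1x_Linft {0..}"
    and nonneg: "AE z in slab {0..}. 0 \<le> a (fst z) (snd z)" and \<tau>: "\<tau> > 0"
  obtains M where "damped_solution p a u \<tau> M"
proof -
  have sub: "{0..\<tau>} \<subseteq> {0..}" by auto
  have am: "(\<lambda>(t, x). a t x) \<in> borel_measurable (slab {0..})"
    using a by (rule L1x_Linft_measurable) simp
  have um: "(\<lambda>(t, x). u t x) \<in> borel_measurable (slab {0..})"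
    using u by (simp add: mild_solution_def time_torus_eq_slab)
  have uL: "u \<in> Linfx_L2t {0..\<tau>}" using u \<tau> by (simp add: mild_solution_def)
  define B where "B = esssup torus (\<lambda>x. \<integral>\<^sup>+ t. ennreal ((cmod (u t x))\<^sup>2) \<partial>time {0..\<tau>})"
  have B: "B < \<infinity>" using uL by (simp add: Linfx_L2t_def B_def)
  \<comment> \<open>Duhamel's formula at time 0 only identifies Fourier coefficients; this is enough
    to restart it from \<open>u 0\<close>.\<close>
  have fc0: "fourier_coeff (u 0) k = fourier_coeff u0 k" for k
  proof -
    have "(LINT s:{0..0}|lborel. propagator p (0 - s) (fourier_coeff (\<lambda>x. complex_of_real (a s x) * u s x)) k) = 0"
      by (rule set_integral_singleton_lborel)
    moreover have "fourier_coeff (u 0) k = propagator p 0 (fourier_coeff u0) k -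
        (LINT s:{0..0}|lborel. propagator p (0 - s) (fourier_coeff (\<lambda>x. complex_of_real (a s x) * u s x)) k)"
      using u unfolding mild_solution_def by blast
    ultimately show ?thesis by (simp add: propagator_def)
  qed
  have "damped_solution p a u \<tau> (enn2real B)"
  proof
    show "0 \<le> \<tau>" using \<tau> by simp
    show "(\<lambda>(t, x). a t x) \<in> borel_measurable (slab {0..\<tau>})" "(\<lambda>(t, x). u t x) \<in> borel_measurable (slab {0..\<tau>})"
      using am um by (auto intro: measurable_slab_subset[OF _ sub])
    show "AE z in slab {0..\<tau>}. 0 \<le> a (fst z) (snd z)"
      using nonneg by (auto simp: AE_slab_iff elim!: eventually_mono)
    have "norm_L1x_Linft {0..} a < \<infinity>" using a by (simp add: L1x_Linft_def)
    then show "norm_L1x_Linft {0..\<tau>} a < \<infinity>"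
      using norm_L1x_Linft_subset[OF sub _ _ am] by (auto intro: le_less_trans)
    show "u t \<in> L2_torus" if "t \<in> {0..\<tau>}" for t using u that by (simp add: mild_solution_def)
    show "0 \<le> enn2real B" by simp
    have "AE x in torus. (\<integral>\<^sup>+ t. ennreal ((cmod (u t x))\<^sup>2) \<partial>time {0..\<tau>}) \<le> B"
      unfolding B_def by (rule esssup_AE)
    then show "AE x in torus. (\<integral>\<^sup>+ t. ennreal ((cmod (u t x))\<^sup>2) \<partial>time {0..\<tau>}) \<le> ennreal (enn2real B)"
      using B by simp
    show "fourier_coeff (u t) k = propagator p t (fourier_coeff (u 0)) k -
        (LINT s:{0..t}|lborel. propagator p (t - s) (fourier_coeff (\<lambda>x. complex_of_real (a s x) * u s x)) k)"
      if "t \<in> {0..\<tau>}" for t k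
    proof -
      have "propagator p t (fourier_coeff (u 0)) k = propagator p t (fourier_coeff u0) k"
        by (simp add: propagator_def fc0)
      then show ?thesis using u that by (simp add: mild_solution_def)
    qed
  qed
  then show ?thesis by (rule that)
qed

text \<open>The flow property. In the interaction picture the formulas at times s and s + t contain
  the same primitive, so the restarted source is the difference of its two values, rotated by the
  common factor.\<close>

lemma damped_solution_shift:
  assumes u: "damped_solution p a u (s + T) M" and s: "0 \<le> s" and T\<^sub>0: "0 \<le> T"
    and fin: "norm_L1x_Linft {0..T} (\<lambda>t. a (s + t)) < \<infinity>"
  shows "damped_solution p (\<lambda>t. a (s + t)) (\<lambda>t. u (s + t)) T M"
proof -
  interpret damped_solution p a u "s + T" M by fact
  have sh: "s + t \<in> {0..s + T}" if "t \<in> {0..T}" for t using that s by auto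
  show ?thesis
  proof
    show "0 \<le> T" "0 \<le> M" using T\<^sub>0 M by auto
    show "norm_L1x_Linft {0..T} (\<lambda>t. a (s + t)) < \<infinity>" by (rule fin)
    show "(\<lambda>(t, x). a (s + t) x) \<in> borel_measurable (slab {0..T})" "(\<lambda>(t, x). u (s + t) x) \<in> borel_measurable (slab {0..T})"
      using measurable_slab_shift[OF sh a_measurable] measurable_slab_shift[OF sh u_measurable]
      by (simp_all add: split_beta')
    show "AE z in slab {0..T}. 0 \<le> a (s + fst z) (snd z)"
      using AE_slab_shift[OF _ _ sh a_nonneg, of "{0..T}"] by simp
    show "u (s + t) \<in> L2_torus" if "t \<in> {0..T}" for t by (rule u_L2[OF sh[OF that]])
    show "AE x in torus. (\<integral>\<^sup>+ t. ennreal ((cmod (u (s + t) x))\<^sup>2) \<partial>time {0..T}) \<le> ennreal M"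
      using u_bound AE_space
    proof eventually_elim
      case (elim x)
      let ?g = "\<lambda>t. ennreal ((cmod (u t x))\<^sup>2) * indicator {0..s + T} t"
      have "(\<lambda>t. ennreal ((cmod (u t x))\<^sup>2)) \<in> borel_measurable (time {0..s + T})"
        using measurable_slab_section[OF _ W_measurable elim(2)] by simp
      then have gm: "?g \<in> borel_measurable borel"
        by (subst (asm) borel_measurable_restrict_space_iff_ennreal) (auto simp: mult.commute)
      \<comment> \<open>The redundant factor in \<open>s + 1 * t\<close> matches the affine
        substitution rule.\<close>
      have "(\<integral>\<^sup>+ t. ennreal ((cmod (u (s + t) x))\<^sup>2) \<partial>time {0..T}) \<le> (\<integral>\<^sup>+ t. ?g (s + 1 * t) \<partial>lborel)"
        using sh by (subst nn_integral_restrict_space) (auto intro!: nn_integral_mono simp: indicator_def)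
      also have "\<dots> = (\<integral>\<^sup>+ t. ?g t \<partial>lborel)"
        using nn_integral_real_affine[OF gm, of 1 s] by simp
      also have "\<dots> = (\<integral>\<^sup>+ t. ennreal ((cmod (u t x))\<^sup>2) \<partial>time {0..s + T})"
        by (subst nn_integral_restrict_space) auto
      finally show ?case using elim(1) by (rule order_trans)
    qed
    show "fourier_coeff (u (s + t)) k = propagator p t (fourier_coeff (u (s + 0))) k -
        (LINT r:{0..t}|lborel. propagator p (t - r) (fourier_coeff (\<lambda>x. complex_of_real (a (s + r) x) * u (s + r) x)) k)"
      if t: "t \<in> {0..T}" for t k
    proof -
      let ?q = "real_of_int (poly p k)"
      have ind: "integrable lborel (\<lambda>r. indicator {..y} r *\<^sub>R rot k r)" for y
        using integrable_rot by (rule integrable_mult_indicator[rotated]) simp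
      have "(LINT r:{0..t}|lborel. propagator p (t - r) (fourier_coeff (\<lambda>x. complex_of_real (a (s + r) x) * u (s + r) x)) k)
        = (LINT r|lborel. cis ((s + t) * ?q) * (indicator {s..s + t} (s + 1 * r) *\<^sub>R rot k (s + 1 * r)))"
        unfolding set_lebesgue_integral_def
      proof (intro Bochner_Integration.integral_cong refl)
        fix r
        have "cis ((t - r) * ?q) = cis ((s + t) * ?q) * cis (- ((s + r) * ?q))"
          by (simp add: cis_mult algebra_simps)
        then show "indicator {0..t} r *\<^sub>R propagator p (t - r) (fourier_coeff (\<lambda>x. complex_of_real (a (s + r) x) * u (s + r) x)) k
          = cis ((s + t) * ?q) * (indicator {s..s + t} (s + 1 * r) *\<^sub>R rot k (s + 1 * r))"
          using t s by (auto simp: propagator_def rot_def src_def indicator_def)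
      qed
      also have "\<dots> = cis ((s + t) * ?q) * (LINT r|lborel. indicator {s..s + t} (s + 1 * r) *\<^sub>R rot k (s + 1 * r))"
        by (rule integral_mult_right_zero)
      also have "(LINT r|lborel. indicator {s..s + t} (s + 1 * r) *\<^sub>R rot k (s + 1 * r)) = (LINT r|lborel. indicator {s..s + t} r *\<^sub>R rot k r)"
        using lborel_integral_real_affine[of 1 "\<lambda>r. indicator {s..s + t} r *\<^sub>R rot k r" s] by simp
      also have "\<dots> = (LINT r|lborel. indicator {..s + t} r *\<^sub>R rot k r - indicator {..s} r *\<^sub>R rot k r)"
      proof (rule integral_cong_AE)
        have "AE r in lborel. r \<noteq> s" by (rule AE_lborel_singleton)
        then show "AE r in lborel. indicator {s..s + t} r *\<^sub>R rot k r = indicator {..s + t} r *\<^sub>R rot k r - indicator {..s} r *\<^sub>R rot k r"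
          by eventually_elim (use t in \<open>auto simp: indicator_def\<close>)
      qed (use integrable_rot[of k] in \<open>auto dest: borel_measurable_integrable\<close>)
      also have "\<dots> = (LINT r|lborel. indicator {..s + t} r *\<^sub>R rot k r) - (LINT r|lborel. indicator {..s} r *\<^sub>R rot k r)"
        by (rule Bochner_Integration.integral_diff[OF ind ind])
      finally have 1: "(LINT r:{0..t}|lborel. propagator p (t - r) (fourier_coeff (\<lambda>x. complex_of_real (a (s + r) x) * u (s + r) x)) k) =
         cis ((s + t) * ?q) * ((LINT r|lborel. indicator {..s + t} r *\<^sub>R rot k r) - (LINT r|lborel. indicator {..s} r *\<^sub>R rot k r))" .
      have "cis (t * ?q) * cis (s * ?q) = cis ((s + t) * ?q)" by (simp add: cis_mult algebra_simps)
      then have 2: "propagator p t (fourier_coeff (u (s + 0))) k = cis ((s + t) * ?q) * (coef k 0 - (LINT r|lborel. indicator {..s} r *\<^sub>R rot k r))"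
        using coef_eq[of s k] s T\<^sub>0 by (simp add: propagator_def coef_def flip: mult.assoc)
      have "fourier_coeff (u (s + t)) k = cis ((s + t) * ?q) * (coef k 0 - (LINT r|lborel. indicator {..s + t} r *\<^sub>R rot k r))"
        using coef_eq[OF sh[OF t], of k] by (simp add: coef_def)
      then show ?thesis unfolding 1 2 by (simp add: algebra_simps)
    qed
  qed
qed

section \<open>Uniform contraction by compactness\<close>

lemma norm_L1x_Linft_zero:
  assumes "I \<in> sets borel" shows "norm_L1x_Linft I (\<lambda>t x. 0) = 0"
proof -
  have "linft_t I (\<lambda>t x. 0) x \<le> 0" for x
    unfolding linft_t_def by (rule esssup_I) auto
  then show ?thesis by (simp add: norm_L1x_Linft_eq)
qed

text \<open>Each weight in the closure has a ball with its own contraction factor; finitely many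
  balls cover, and the largest factor serves all. Radius and factor depend on the centre alone, not
  on the solution or on M. Arguing with open covers avoids the quotient of the
  pseudo-metric.\<close>

lemma uniform_contraction:
  fixes p :: "int poly"
  assumes p: "degree p \<ge> 2" and T: "T > 0" and \<alpha>: "\<alpha> > 0"
    and pre: "precompact_in (top_L1x_Linft {0..T}) \<A>"
    and low: "\<And>f. f \<in> \<A> \<Longrightarrow> ennreal \<alpha> \<le> norm_L1x_Linft {0..T} f"
  obtains q where "0 < q" "q < 1"
    "\<And>a u M. a \<in> \<A> \<Longrightarrow> damped_solution p a u T M \<Longrightarrow> (L2_norm_torus (u T))\<^sup>2 \<le> q * (L2_norm_torus (u 0))\<^sup>2"
proof -
  let ?X = "top_L1x_Linft {0..T}" and ?I = "{0..T}"
  define Ball where "Ball f r = {g \<in> L1x_Linft ?I. norm_L1x_Linft ?I (\<lambda>t x. g t x - f t x) < ennreal r}" for f r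
  have X: "?X = topology_generated_by {Ball f r | f r. f \<in> L1x_Linft ?I \<and> 0 < r}"
    unfolding top_L1x_Linft_def Ball_def ..
  have openB: "openin ?X (Ball f r)" if "f \<in> L1x_Linft ?I" "0 < r" for f r
    unfolding X using that by (intro topology_generated_by_Basis) blast
  have topX: "topspace ?X \<subseteq> L1x_Linft ?I"
    unfolding X topology_generated_by_topspace by (auto simp: Ball_def)
  define \<C> where "\<C> = ?X closure_of \<A>"
  have AX: "\<A> \<subseteq> topspace ?X" and comp: "compactin ?X \<C>"
    using pre by (auto simp: precompact_in_def \<C>_def)
  have AC: "\<A> \<subseteq> \<C>" unfolding \<C>_def by (rule closure_of_subset[OF AX])
  have CL: "b \<in> L1x_Linft ?I" if "b \<in> \<C>" for b
    using that topX closure_of_subset_topspace[of ?X \<A>] by (auto simp: \<C>_def)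
  have self: "b \<in> Ball b r" if "b \<in> L1x_Linft ?I" "r > 0" for b r
    using that by (simp add: Ball_def norm_L1x_Linft_zero)
  have loc: "\<exists>r q. r > 0 \<and> 0 < q \<and> q < 1 \<and> (\<forall>a u M. damped_solution p a u T M \<longrightarrow> a \<in> Ball b r \<longrightarrow>
      (L2_norm_torus (u T))\<^sup>2 \<le> q * (L2_norm_torus (u 0))\<^sup>2)" if b: "b \<in> \<C>" for b
  proof -
    have bL: "b \<in> L1x_Linft ?I" by (rule CL[OF b])
    have bm: "(\<lambda>(t, x). b t x) \<in> borel_measurable (slab ?I)" by (rule L1x_Linft_measurable[OF bL]) simp
    \<comment> \<open>Local contraction needs a nonzero weight. Every ball around b meets the
      family, so with norm 0 the radius \<alpha> would produce a member of norm below
      \<alpha>.\<close>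
    have nz: "norm_L1x_Linft ?I b \<noteq> 0"
    proof
      assume z: "norm_L1x_Linft ?I b = 0"
      obtain f where f: "f \<in> \<A>" "f \<in> Ball b \<alpha>"
        using b openB[OF bL \<alpha>] self[OF bL \<alpha>] unfolding \<C>_def in_closure_of by blast
      have fm: "(\<lambda>(t, x). f t x) \<in> borel_measurable (slab ?I)"
        using f(2) by (intro L1x_Linft_measurable) (auto simp: Ball_def)
      have "ennreal \<alpha> \<le> norm_L1x_Linft ?I b + norm_L1x_Linft ?I (\<lambda>t x. f t x - b t x)"
        using low[OF f(1)] norm_L1x_Linft_triangle[OF _ fm bm] by (auto intro: order_trans)
      also have "\<dots> < ennreal \<alpha>" using f(2) z by (simp add: Ball_def)
      finally show False by simp
    qed
    have "norm_L1x_Linft ?I b < \<infinity>" using bL by (simp add: L1x_Linft_def)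
    from local_contraction[OF p T bm this nz] obtain r q where *: "r > 0" "0 < q" "q < 1"
      "\<And>a u M. damped_solution p a u T M \<Longrightarrow> norm_L1x_Linft ?I (\<lambda>t x. a t x - b t x) < ennreal r \<Longrightarrow>
        (L2_norm_torus (u T))\<^sup>2 \<le> q * (L2_norm_torus (u 0))\<^sup>2"
      by blast
    show ?thesis
    proof (intro exI conjI allI impI)
      fix a u M assume "damped_solution p a u T M" "a \<in> Ball b r"
      then show "(L2_norm_torus (u T))\<^sup>2 \<le> q * (L2_norm_torus (u 0))\<^sup>2"
        by (intro *(4)) (auto simp: Ball_def)
    qed (use * in auto)
  qed
  then obtain r q where rq: "\<And>b. b \<in> \<C> \<Longrightarrow> r b > 0 \<and> 0 < q b \<and> q b < 1 \<and> (\<forall>a u M. damped_solution p a u T M \<longrightarrow> a \<in> Ball b (r b) \<longrightarrow>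
      (L2_norm_torus (u T))\<^sup>2 \<le> q b * (L2_norm_torus (u 0))\<^sup>2)"
    by metis
  have "\<exists>\<F>. finite \<F> \<and> \<F> \<subseteq> (\<lambda>b. Ball b (r b)) ` \<C> \<and> \<C> \<subseteq> \<Union>\<F>"
  proof (rule compactinD[OF comp])
    show "openin ?X U" if "U \<in> (\<lambda>b. Ball b (r b)) ` \<C>" for U
      using that openB CL rq by auto
    show "\<C> \<subseteq> \<Union>((\<lambda>b. Ball b (r b)) ` \<C>)"
      using self CL rq by blast
  qed
  then obtain \<F> where \<F>: "finite \<F>" "\<F> \<subseteq> (\<lambda>b. Ball b (r b)) ` \<C>" "\<C> \<subseteq> \<Union>\<F>" by blast
  from finite_subset_image[OF \<F>(1,2)] obtain B
    where B': "B \<subseteq> \<C>" "finite B" "\<F> = (\<lambda>b. Ball b (r b)) ` B" by blast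
  then have B: "finite B" "B \<subseteq> \<C>" "\<C> \<subseteq> (\<Union>b\<in>B. Ball b (r b))" using \<F>(3) by auto
  \<comment> \<open>The inserted 1/2 keeps the maximum defined for empty B, and positive.\<close>
  define q\<^sub>0 where "q\<^sub>0 = Max (insert (1 / 2) (q ` B))"
  have q0: "0 < q\<^sub>0" "q\<^sub>0 < 1" "\<And>b. b \<in> B \<Longrightarrow> q b \<le> q\<^sub>0"
  proof -
    have "1 / 2 \<le> q\<^sub>0" unfolding q\<^sub>0_def using B by (intro Max_ge) auto
    then show "0 < q\<^sub>0" by simp
    show "q\<^sub>0 < 1" unfolding q\<^sub>0_def using B rq by (subst Max_less_iff) auto
    show "q b \<le> q\<^sub>0" if "b \<in> B" for b unfolding q\<^sub>0_def using B that by (intro Max_ge) auto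
  qed
  show ?thesis
  proof (rule that[OF q0(1,2)])
    fix a u M assume "a \<in> \<A>" and u: "damped_solution p a u T M"
    then obtain b where b: "b \<in> B" "a \<in> Ball b (r b)" using AC B(3) by blast
    have "(L2_norm_torus (u T))\<^sup>2 \<le> q b * (L2_norm_torus (u 0))\<^sup>2"
      using rq[of b] b B(2) u by blast
    also have "\<dots> \<le> q\<^sub>0 * (L2_norm_torus (u 0))\<^sup>2"
      using q0(3)[OF b(1)] by (intro mult_right_mono) auto
    finally show "(L2_norm_torus (u T))\<^sup>2 \<le> q\<^sub>0 * (L2_norm_torus (u 0))\<^sup>2" .
  qed
qed

text \<open>The mild formulation compares \<open>u 0\<close> and \<open>u0\<close> only through
  their coefficients; Parseval turns this into equal norms.\<close>

lemma L2_norm_torus_cong_fourier: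
  assumes "f \<in> L2_torus" "g \<in> L2_torus" "\<And>k. fourier_coeff f k = fourier_coeff g k"
  shows "L2_norm_torus f = L2_norm_torus g"
proof -
  have "(L2_norm_torus f)\<^sup>2 = (L2_norm_torus g)\<^sup>2"
    using LIMSEQ_unique[OF parseval_torus[OF assms(1)]] parseval_torus[OF assms(2)] by (simp add: assms(3))
  then show ?thesis by (simp add: L2_norm_torus_def)
qed

theorem theorem4p1:
  fixes p :: "int poly" and a :: "real \<Rightarrow> real \<Rightarrow> real" and T \<alpha>\<^sub>0 :: real
  assumes "lead_coeff p = 1" and "degree p \<ge> 2"
    and "a \<in> L1x_Linft {0..}"
    and "AE (t, x) in time {0..} \<Otimes>\<^sub>M torus. 0 \<le> a t x"
    and "T > 0" and "\<alpha>\<^sub>0 > 0"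
    and "precompact_in (top_L1x_Linft {0..T}) {time_slice T a n | n. n \<ge> 1}"
    and "(INF n\<in>{1..}. norm_L1x_Linft {0..T} (time_slice T a n)) \<ge> ennreal \<alpha>\<^sub>0"
  shows "\<exists>C>0. \<exists>\<gamma>>0. \<forall>u0\<in>L2_torus. \<forall>u. mild_solution p a u0 u \<longrightarrow>
           (\<forall>t\<ge>0. L2_norm_torus (u t) \<le> C * exp (- \<gamma> * t) * L2_norm_torus u0)"
proof -
  let ?A = "{time_slice T a n | n. n \<ge> 1}"
  have nonneg: "AE z in slab {0..}. 0 \<le> a (fst z) (snd z)"
  proof -
    have eq: "time {0..} \<Otimes>\<^sub>M torus = slab {0..}" by (rule time_torus_eq_slab) simp
    show ?thesis using assms(4) unfolding eq by (simp add: split_beta')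
  qed
  have low: "ennreal \<alpha>\<^sub>0 \<le> norm_L1x_Linft {0..T} f" if f: "f \<in> ?A" for f
  proof -
    obtain n where "f = time_slice T a n" "n \<ge> 1" using f by blast
    then show ?thesis using assms(8) by (auto intro: order_trans[OF _ INF_lower])
  qed
  obtain q where q: "0 < q" "q < 1" and contr:
    "\<And>a u M. a \<in> ?A \<Longrightarrow> damped_solution p a u T M \<Longrightarrow> (L2_norm_torus (u T))\<^sup>2 \<le> q * (L2_norm_torus (u 0))\<^sup>2"
    by (rule uniform_contraction[OF assms(2,5,6,7) low]) (assumption, rule that)
  \<comment> \<open>The points of the topology are exactly those in some generating ball, and balls
    consist of functions of finite norm.\<close>
  have slice_fin: "norm_L1x_Linft {0..T} (time_slice T a n) < \<infinity>" if "n \<ge> 1" for n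
  proof -
    have "time_slice T a n \<in> topspace (top_L1x_Linft {0..T})"
      using assms(7) that unfolding precompact_in_def by blast
    then show ?thesis
      unfolding top_L1x_Linft_def topology_generated_by_topspace by (auto simp: L1x_Linft_def)
  qed
  \<comment> \<open>The factor 2 enters because q contracts squared norms, so that exp (- \<gamma>
    T)^2 = q.\<close>
  define \<gamma> where "\<gamma> = - ln q / (2 * T)"
  have \<gamma>: "\<gamma> > 0" using q assms(5) by (simp add: \<gamma>_def divide_neg_pos)
  \<comment> \<open>Compensates for the last window, which t may leave incomplete.\<close>
  define C where "C = exp (\<gamma> * T)"
  have sq: "exp (- \<gamma> * T) ^ 2 = q"
    using q assms(5) by (simp add: \<gamma>_def flip: exp_of_nat_mult)
  have "L2_norm_torus (u t) \<le> C * exp (- \<gamma> * t) * L2_norm_torus u0"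
    if u0: "u0 \<in> L2_torus" and u: "mild_solution p a u0 u" and t: "t \<ge> 0" for u0 u t
  proof -
    have N0: "0 \<le> L2_norm_torus f" for f by (simp add: L2_norm_torus_def)
    have block: "\<exists>M. damped_solution p (time_slice T a (Suc n)) (\<lambda>t. u (real n * T + t)) T M" for n
    proof -
      have pos: "0 < real n * T + T" using assms(5) by (simp add: add_nonneg_pos)
      obtain M where "damped_solution p a u (real n * T + T) M"
        using mild_solution_imp_damped_solution[OF u assms(3) nonneg pos] .
      \<comment> \<open>Slices are counted from 1, so slice \<open>Suc n\<close> starts at time n
        T.\<close>
      moreover have "time_slice T a (Suc n) = (\<lambda>t. a (real n * T + t))" by (simp add: time_slice_def)
      ultimately show ?thesis
        using damped_solution_shift[of p a u "real n * T" T M] assms(5) slice_fin[of "Suc n"] by auto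
    qed
    have step: "L2_norm_torus (u (real (Suc n) * T)) \<le> exp (- \<gamma> * T) * L2_norm_torus (u (real n * T))" for n
    proof -
      obtain M where M: "damped_solution p (time_slice T a (Suc n)) (\<lambda>t. u (real n * T + t)) T M"
        using block by blast
      have "time_slice T a (Suc n) \<in> ?A" by auto
      from contr[OF this M] have "(L2_norm_torus (u (real n * T + T)))\<^sup>2 \<le> (exp (- \<gamma> * T) * L2_norm_torus (u (real n * T)))\<^sup>2"
        unfolding power_mult_distrib sq by simp
      then have "L2_norm_torus (u (real n * T + T)) \<le> exp (- \<gamma> * T) * L2_norm_torus (u (real n * T))"
        by (rule power2_le_imp_le) (simp add: N0)
      then show ?thesis by (simp add: algebra_simps)
    qed
    have zero: "L2_norm_torus (u 0) = L2_norm_torus u0"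
    proof (rule L2_norm_torus_cong_fourier[OF _ u0])
      show "u 0 \<in> L2_torus" using u by (simp add: mild_solution_def)
      have "fourier_coeff (u 0) k = propagator p 0 (fourier_coeff u0) k -
        (LINT s:{0..0}|lborel. propagator p (0 - s) (fourier_coeff (\<lambda>x. complex_of_real (a s x) * u s x)) k)" for k
        using u unfolding mild_solution_def by blast
      then show "fourier_coeff (u 0) k = fourier_coeff u0 k" for k
        unfolding set_integral_singleton_lborel by (simp add: propagator_def)
    qed
    have iter: "L2_norm_torus (u (real n * T)) \<le> exp (- \<gamma> * (real n * T)) * L2_norm_torus u0" for n
    proof (induction n)
      case 0
      then show ?case by (simp add: zero)
    next
      case (Suc n)
      have "L2_norm_torus (u (real (Suc n) * T)) \<le> exp (- \<gamma> * T) * (exp (- \<gamma> * (real n * T)) * L2_norm_torus u0)"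
        by (rule order_trans[OF step]) (intro mult_left_mono Suc; simp)
      also have "\<dots> = exp (- \<gamma> * (real (Suc n) * T)) * L2_norm_torus u0"
        by (simp add: algebra_simps flip: exp_add)
      finally show ?case .
    qed
    \<comment> \<open>The number of windows completed by time t.\<close>
    define n where "n = nat \<lfloor>t / T\<rfloor>"
    have n: "real n * T \<le> t" "t \<le> real n * T + T"
    proof -
      have "real n = of_int \<lfloor>t / T\<rfloor>" using t assms(5) by (simp add: n_def)
      then have "real n \<le> t / T" "t / T \<le> real n + 1" by linarith+
      then show "real n * T \<le> t" "t \<le> real n * T + T" using assms(5) by (simp_all add: field_simps)
    qed
    obtain M where "damped_solution p (time_slice T a (Suc n)) (\<lambda>t. u (real n * T + t)) T M"
      using block by blast
    then interpret damped_solution p "time_slice T a (Suc n)" "\<lambda>t. u (real n * T + t)" T M .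
    \<comment> \<open>Inside the current window only monotonicity of the energy is used.\<close>
    have "L2_norm_torus (u t) \<le> L2_norm_torus (u (real n * T))"
      using energy_decreasing[of "t - real n * T"] n by simp
    also have "\<dots> \<le> exp (- \<gamma> * (real n * T)) * L2_norm_torus u0" by (rule iter)
    also have "\<dots> \<le> exp (\<gamma> * T + - \<gamma> * t) * L2_norm_torus u0"
    proof (rule mult_right_mono[OF _ N0])
      have "\<gamma> * t \<le> \<gamma> * (real n * T + T)" using n \<gamma> by (intro mult_left_mono) auto
      then show "exp (- \<gamma> * (real n * T)) \<le> exp (\<gamma> * T + - \<gamma> * t)" by (simp add: algebra_simps)
    qed
    finally show ?thesis by (simp only: C_def exp_add)
  qed
  moreover have "C > 0" by (simp add: C_def)
  ultimately show ?thesis using \<gamma> by blast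
qed

end
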